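(* Let $U\subset\mathbb{R}^n$, $n\in\mathbb{N}$, be a bounded open set with Lipschitz boundary. Let $a:\mathbb{R}^n\times\mathbb{R}^n\to\mathbb{R}^n$, $(\mathbf x,\mathbf p)\mapsto a(\mathbf x,\mathbf p)$, be a function for which there exist constants $C_L\ge0$, $C_M>0$, $C_Q\ge0$ such that for all $\mathbf x,\mathbf y,\mathbf p,\mathbf q\in\mathbb{R}^n$: $$|a(\mathbf x,\mathbf p)-a(\mathbf x,\mathbf q)|\le C_L|\mathbf p-\mathbf q|,$$ $$(a(\mathbf x,\mathbf p)-a(\mathbf x,\mathbf q))\cdot(\mathbf p-\mathbf q)\ge C_M|\mathbf p-\mathbf q|^2,$$ $$|a(\mathbf x,\mathbf p)-a(\mathbf y,\mathbf p)|\le C_Q(|\mathbf p|+1)|\mathbf x-\mathbf y|.$$ Let $f\in L^2(U)$, and let $u\in H^1(U)$ be a weak solution of $-\nabla\cdot a(\cdot,\nabla u)=f$ in $U$, $a(\cdot,\nabla u)\cdot\mathbf n=0$ on $\partial U$, i.e. $$\int_U a(\cdot,\nabla u)\cdot\nabla v\,\mathrm d\mathbf x=\int_U f\,v\,\mathrm d\mathbf x\qquad\text{for all }v\in H^1(U).$$ Then $u\in H^2_{\mathrm{loc}}(U)$, and for every open subset $V\subset\subset U$ there exists a constant $C\ge0$ depending only on $U$, $V$ and $a$ such that $$\|u\|_{H^2(V)}\le C\big(\|f\|_{L^2(U)}+\|u\|_{L^2(U)}+1\big).$$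
   Context: $\mathbf n$ denotes the outer unit normal vector field on $\partial U$. $V\subset\subset U$ means that $\overline V$ is compact and contained in $U$. $H^2_{\mathrm{loc}}(U)$ is the set of functions belonging to $H^2(V)$ for every open $V\subset\subset U$. "Depending only on $U$, $V$ and $a$" means in particular that $C$ can be chosen independently of $f$ and $u$. *)

theory Defs
  imports "HOL-Analysis.Analysis"
begin

text \<open>Elements of $L^2(U)$ and of the Sobolev spaces are represented by functions on the whole of
  $\mathbb{R}^n$ of which only the values in \<open>U\<close> matter; functions are not identified
  almost everywhere.\<close>

definition l2_space :: "(real^'n) set \<Rightarrow> (real^'n \<Rightarrow> real) set" where
  "l2_space U = {f. f \<in> borel_measurable (lebesgue_on U) \<and> integrable (lebesgue_on U) (\<lambda>x. (f x)\<^sup>2)}"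

definition l2_norm :: "(real^'n) set \<Rightarrow> (real^'n \<Rightarrow> real) \<Rightarrow> real" where
  "l2_norm U f = sqrt (LINT x|lebesgue_on U. (f x)\<^sup>2)"

definition locally_integrable :: "(real^'n) set \<Rightarrow> (real^'n \<Rightarrow> real) \<Rightarrow> bool" where
  "locally_integrable U f \<longleftrightarrow> (\<forall>K. compact K \<and> K \<subseteq> U \<longrightarrow> integrable (lebesgue_on K) f)"

definition partial_deriv :: "'n::finite \<Rightarrow> (real^'n \<Rightarrow> real) \<Rightarrow> (real^'n \<Rightarrow> real)" where
  "partial_deriv i f = (\<lambda>x. frechet_derivative f (at x) (axis i 1))"

text \<open>Higher derivatives are indexed by lists of coordinate directions: \<open>[i\<^sub>1, \<dots>, i\<^sub>k]\<close>
  stands for the operator $\partial_{i_1} \cdots \partial_{i_k}$.\<close>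

fun partial_derivs :: "'n::finite list \<Rightarrow> (real^'n \<Rightarrow> real) \<Rightarrow> (real^'n \<Rightarrow> real)" where
  "partial_derivs [] f = f"
| "partial_derivs (i # is) f = partial_deriv i (partial_derivs is f)"

text \<open>All iterated partial derivatives are (Frechet) differentiable, hence continuous; this is
  $C^\infty$.\<close>

definition smooth :: "(real^'n \<Rightarrow> real) \<Rightarrow> bool" where
  "smooth f \<longleftrightarrow> (\<forall>is x. partial_derivs is f differentiable (at x))"

text \<open>$C_c^\infty(U)$, each function being extended by zero outside \<open>U\<close>.\<close>

definition test_functions :: "(real^'n) set \<Rightarrow> (real^'n \<Rightarrow> real) set" where
  "test_functions U =
    {\<phi>. smooth \<phi> \<and> compact (closure {x. \<phi> x \<noteq> 0}) \<and> closure {x. \<phi> x \<noteq> 0} \<subseteq> U}"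

definition has_weak_deriv ::
    "(real^'n) set \<Rightarrow> 'n::finite list \<Rightarrow> (real^'n \<Rightarrow> real) \<Rightarrow> (real^'n \<Rightarrow> real) \<Rightarrow> bool" where
  "has_weak_deriv U is u g \<longleftrightarrow>
     locally_integrable U u \<and> locally_integrable U g \<and>
     (\<forall>\<phi>\<in>test_functions U.
        (LINT x|lebesgue_on U. u x * partial_derivs is \<phi> x) =
        (-1) ^ length is * (LINT x|lebesgue_on U. g x * \<phi> x))"

text \<open>Weak derivatives are unique up to null sets, so the choice of representative is
  immaterial.\<close>

definition weak_deriv ::
    "(real^'n) set \<Rightarrow> 'n::finite list \<Rightarrow> (real^'n \<Rightarrow> real) \<Rightarrow> (real^'n \<Rightarrow> real)" where
  "weak_deriv U is u = (SOME g. has_weak_deriv U is u g)"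

definition weak_grad :: "(real^'n) set \<Rightarrow> (real^'n \<Rightarrow> real) \<Rightarrow> (real^'n \<Rightarrow> real^'n)" where
  "weak_grad U u x = (\<chi> i. weak_deriv U [i] u x)"

definition sobolev :: "nat \<Rightarrow> (real^'n) set \<Rightarrow> (real^'n \<Rightarrow> real) set" where
  "sobolev k U = {u \<in> l2_space U.
     \<forall>is. length is \<le> k \<longrightarrow> (\<exists>g\<in>l2_space U. has_weak_deriv U is u g)}"

text \<open>Mixed derivatives are counted once for each order of differentiation, so that for
  \<open>k = 2\<close> the top-order part is the $L^2$ norm of the Frobenius norm of the Hessian.\<close>

definition sobolev_norm :: "nat \<Rightarrow> (real^'n) set \<Rightarrow> (real^'n \<Rightarrow> real) \<Rightarrow> real" where
  "sobolev_norm k U u = sqrt (\<Sum>is | length is \<le> k. (l2_norm U (weak_deriv U is u))\<^sup>2)"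

definition compactly_contained :: "(real^'n) set \<Rightarrow> (real^'n) set \<Rightarrow> bool" where
  "compactly_contained V U \<longleftrightarrow> compact (closure V) \<and> closure V \<subseteq> U"

definition sobolev_loc :: "nat \<Rightarrow> (real^'n) set \<Rightarrow> (real^'n \<Rightarrow> real) set" where
  "sobolev_loc k U = {u. \<forall>V. open V \<and> compactly_contained V U \<longrightarrow> u \<in> sobolev k V}"

text \<open>Near each boundary point, \<open>U\<close> is the set of points lying strictly above the graph of a
  Lipschitz function defined on the hyperplane orthogonal to a unit vector \<open>e\<close>. The vector
  \<open>e\<close> plays the role of the last coordinate axis in rotated coordinates.\<close>

definition lipschitz_boundary :: "(real^'n) set \<Rightarrow> bool" where
  "lipschitz_boundary U \<longleftrightarrow>
     (\<forall>x\<^sub>0\<in>frontier U. \<exists>e r L g. norm e = 1 \<and> 0 < r \<and> L-lipschitz_on {z. z \<bullet> e = 0} g \<and>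
        U \<inter> ball x\<^sub>0 r = {x \<in> ball x\<^sub>0 r. g (x - (x \<bullet> e) *\<^sub>R e) < x \<bullet> e})"

text \<open>The Neumann problem $-\nabla\cdot a(\cdot,\nabla u) = f$ in \<open>U\<close>,
  $a(\cdot,\nabla u)\cdot\mathbf{n} = 0$ on $\partial U$; the boundary condition is encoded by
  testing with all of $H^1(U)$.\<close>

definition weak_neumann_solution ::
    "(real^'n \<Rightarrow> real^'n \<Rightarrow> real^'n) \<Rightarrow> (real^'n) set \<Rightarrow> (real^'n \<Rightarrow> real) \<Rightarrow> (real^'n \<Rightarrow> real) \<Rightarrow> bool"
  where
  "weak_neumann_solution a U f u \<longleftrightarrow> u \<in> sobolev 1 U \<and>
     (\<forall>v\<in>sobolev 1 U. (LINT x|lebesgue_on U. a x (weak_grad U u x) \<bullet> weak_grad U v x) =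
                      (LINT x|lebesgue_on U. f x * v x))"

end

theory Submission
  imports Defs
begin

text \<open>Nirenberg's difference quotient method. Testing the equation with
  $v = -D_k^{-h}(\zeta^2 D_k^h u)$, where $\zeta$ is a cutoff function bounded below on \<open>V\<close>, and using
  the strong monotonicity and the Lipschitz continuity of \<open>a\<close> bounds
  $\|\zeta D_k^h \nabla u\|_{L^2}$ uniformly in \<open>h\<close> by the norms of $f$, $u$ and $\nabla u$; testing with
  $u$ itself bounds $\|\nabla u\|_{L^2}$. Both passages between difference quotients and weak
  derivatives are made by duality: $t \mapsto \int u(x)\, \varphi(x + t e_k)\, dx$ is differentiable for
  every test function $\varphi$, and a functional on the test functions that is bounded in the
  $L^2$ norm is represented by an $L^2$ function. No mollification is needed.\<close>

section \<open>Smooth functions and test functions\<close>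

text \<open>Two features of the statement shape the proof. Functions are not identified almost
  everywhere and \<open>weak_deriv\<close> is an arbitrary choice, so all functions are extended by
  zero and handled in L^2 of the whole space, where translations are isometries. And C must not
  depend on f and u: the constants live in a locale that fixes only \<open>U\<close>,
  \<open>a\<close> and the structural constants, and the cutoff is chosen before f and u. The
  increment of \<open>a\<close> between x and x + h e_k splits into an increment in p, which
  monotonicity turns into coercivity, and one in x, bounded after division by h by
  \<open>C\<^sub>Q\<close> (|P x| + 1). The latter and a(x, 0) are inhomogeneous and cause the
  summand 1 in the estimate. The norm of v is at most that of the k-th derivative of \<zeta>^2 D^h
  u, which contains the very quantity being estimated; a small weight in Young's inequality absorbs
  it. Since \<zeta>^2 D^h u vanishes near the boundary, it is weakly differentiable on the whole
  space, which makes v admissible in H^1(U).\<close>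

lemma partial_deriv_eq:
  assumes "(f has_derivative f') (at x)"
  shows "partial_deriv i f x = f' (axis i 1)"
  using frechet_derivative_at[OF assms] by (simp add: partial_deriv_def)

lemma smooth_differentiable: "smooth f \<Longrightarrow> f differentiable (at x)"
  unfolding smooth_def by (metis partial_derivs.simps(1))

lemma smooth_partial_deriv:
  assumes "smooth f" shows "smooth (partial_deriv i f)"
proof -
  have "partial_derivs (is @ [i]) f = partial_derivs is (partial_deriv i f)" for "is"
    by (induction "is") auto
  then show ?thesis using assms unfolding smooth_def by metis
qed

text \<open>The step keeps every \<open>partial_derivs is f\<close> inside \<open>P\<close>, hence
  differentiable. An invariant class thus replaces the computation of iterated derivatives of
  composite functions.\<close>

lemma smooth_coinduct:
  assumes "P f" and step: "\<And>f. P f \<Longrightarrow> (\<forall>x. f differentiable (at x)) \<and> (\<forall>i. P (partial_deriv i f))"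
  shows "smooth f"
proof -
  have "P (partial_derivs is f)" for "is"
    by (induction "is") (use assms in auto)
  then show ?thesis using step unfolding smooth_def by blast
qed

text \<open>The functions $t \mapsto e^{-1/t} t^{-n}$, extended by zero to $t \le 0$: a family whose span is
  closed under differentiation.\<close>

definition flat_exp :: "nat \<Rightarrow> real \<Rightarrow> real" where
  "flat_exp n t = (if t > 0 then exp (- 1 / t) / t ^ n else 0)"

text \<open>With s = 1/t the function becomes s^n / e^s, and the exponential beats every power at
  infinity.\<close>

lemma flat_exp_tendsto_0: "((\<lambda>t. flat_exp n t) \<longlongrightarrow> 0) (at_right 0)"
proof -
  have "((\<lambda>s::real. s ^ n / exp s) \<longlongrightarrow> 0) at_top"
    by (rule tendsto_power_div_exp_0)
  then have "((\<lambda>t. inverse t ^ n / exp (inverse t)) \<longlongrightarrow> (0::real)) (at_right 0)"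
    by (rule filterlim_compose[OF _ filterlim_inverse_at_top_right])
  moreover have "\<forall>\<^sub>F t::real in at_right 0. inverse t ^ n / exp (inverse t) = flat_exp n t"
    unfolding eventually_at_right_field
    by (intro exI[of _ 1]) (auto simp: flat_exp_def field_simps exp_minus power_inverse)
  ultimately show ?thesis by (rule Lim_transform_eventually)
qed

text \<open>Away from 0 this is the quotient rule. At 0 the claimed derivative is 0, and the
  difference quotient is \<open>flat_exp (n + 1)\<close> on the right and 0 on the left.\<close>

lemma flat_exp_deriv:
  "(flat_exp n has_real_derivative (flat_exp (n + 2) t - real n * flat_exp (n + 1) t)) (at t)"
proof -
  consider "t > 0" | "t < 0" | "t = 0" by linarith
  then show ?thesis
  proof cases
    case 1
    have "((\<lambda>t. exp (- 1 / t) / t ^ n) has_real_derivative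
        (flat_exp (n + 2) t - real n * flat_exp (n + 1) t)) (at t)"
    \<comment> \<open>The derivative of t^n involves t^(n - 1), so truncated subtraction makes n = 0
      a case of its own.\<close>
    proof (cases "n = 0")
      case True
      then show ?thesis using 1
        by (auto intro!: derivative_eq_intros simp: flat_exp_def field_simps power2_eq_square)
    next
      case False
      define q where "q = t ^ (n - 1)"
      have p: "t ^ n = t * q" using False by (cases n) (auto simp: q_def)
      have q: "q > 0" using 1 by (simp add: q_def)
      have "((\<lambda>t. exp (- 1 / t) / t ^ n) has_real_derivative
        (exp (- 1 / t) * (1 / t\<^sup>2) * t ^ n - exp (- 1 / t) * (real n * q)) / (t ^ n * t ^ n)) (at t)"
        using 1 by (auto intro!: derivative_eq_intros simp: power2_eq_square q_def)
      moreover have "(exp (- 1 / t) * (1 / t\<^sup>2) * t ^ n - exp (- 1 / t) * (real n * q)) / (t ^ n * t ^ n)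
          = flat_exp (n + 2) t - real n * flat_exp (n + 1) t"
        using 1 q unfolding flat_exp_def power_add p by (simp add: divide_simps power2_eq_square) (simp add: algebra_simps)
      ultimately show ?thesis by simp
    qed
    then show ?thesis
      by (rule has_field_derivative_transform_within_open[where S = "{0<..}" and f = "\<lambda>t. exp (- 1 / t) / t ^ n"])
        (use 1 in \<open>auto simp: flat_exp_def\<close>)
  next
    case 2
    have "((\<lambda>t. 0) has_real_derivative (flat_exp (n + 2) t - real n * flat_exp (n + 1) t)) (at t)"
      using 2 by (auto simp: flat_exp_def)
    then show ?thesis
      by (rule has_field_derivative_transform_within_open[where S = "{..<0}" and f = "\<lambda>t. 0"])
        (use 2 in \<open>auto simp: flat_exp_def\<close>)
  next
    case 3
    have "((\<lambda>h. (flat_exp n (0 + h) - flat_exp n 0) / h) \<longlongrightarrow> 0) (at_right 0)"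
      by (rule Lim_transform_eventually[OF flat_exp_tendsto_0[of "n + 1"]])
        (auto simp: eventually_at_right_field flat_exp_def field_simps intro!: exI[of _ 1])
    moreover have "((\<lambda>h. (flat_exp n (0 + h) - flat_exp n 0) / h) \<longlongrightarrow> 0) (at_left 0)"
      by (rule Lim_transform_eventually[OF tendsto_const])
        (auto simp: eventually_at_left_field flat_exp_def intro!: exI[of _ "- 1"])
    ultimately have "((\<lambda>h. (flat_exp n (0 + h) - flat_exp n 0) / h) \<longlongrightarrow> 0) (at 0)"
      by (simp add: filterlim_at_split)
    then show ?thesis using 3 by (simp add: DERIV_def flat_exp_def)
  qed
qed

text \<open>The smallest set of functions that contains the smooth ones and has the closure properties needed
  below is again closed under partial differentiation, so by coinduction it consists of smooth
  functions. This gives all closure properties at once.\<close>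

inductive smooth_closure :: "(real^'n \<Rightarrow> real) \<Rightarrow> bool" where
  base: "smooth f \<Longrightarrow> smooth_closure f"
| const: "smooth_closure (\<lambda>_. c)"
| coord: "smooth_closure (\<lambda>x. x $ i)"
| add: "smooth_closure f \<Longrightarrow> smooth_closure g \<Longrightarrow> smooth_closure (\<lambda>x. f x + g x)"
| mult: "smooth_closure f \<Longrightarrow> smooth_closure g \<Longrightarrow> smooth_closure (\<lambda>x. f x * g x)"
| exp: "smooth_closure f \<Longrightarrow> smooth_closure (\<lambda>x. exp (f x))"
| flat_exp: "smooth_closure f \<Longrightarrow> smooth_closure (\<lambda>x. flat_exp n (f x))"
| shift: "smooth_closure f \<Longrightarrow> smooth_closure (\<lambda>x. f (x + \<tau>))"

lemma partial_deriv_directional: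
  assumes "f differentiable (at (x + t *\<^sub>R axis i 1))"
  shows "((\<lambda>t. f (x + t *\<^sub>R axis i 1)) has_real_derivative partial_deriv i f (x + t *\<^sub>R axis i 1)) (at t)"
proof -
  obtain f' where f': "(f has_derivative f') (at (x + t *\<^sub>R axis i 1))" using assms by (auto simp: differentiable_def)
  have "((\<lambda>t. f (x + t *\<^sub>R axis i 1)) has_derivative (\<lambda>s. f' (s *\<^sub>R axis i 1))) (at t)"
    by (rule has_derivative_compose[where g = f and f = "\<lambda>t. x + t *\<^sub>R axis i 1", OF _ f']) (auto intro!: derivative_eq_intros)
  then show ?thesis
    using linear_scale[OF has_derivative_linear[OF f']]
    by (simp add: has_field_derivative_def partial_deriv_eq[OF f'] mult.commute[of _ "f' _"])
qed

lemma smooth_closure_step: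
  assumes "smooth_closure f"
  shows "(\<forall>x. f differentiable (at x)) \<and> (\<forall>i. smooth_closure (partial_deriv i f))"
  using assms
proof induction
  case (base f)
  then show ?case by (auto intro: smooth_differentiable smooth_closure.base smooth_partial_deriv)
next
  case (const c)
  have "partial_deriv i (\<lambda>_. c) = (\<lambda>_. 0)" for i :: 'a
    by (rule ext, subst partial_deriv_eq) (rule has_derivative_const, simp)
  then show ?case by (simp add: smooth_closure.const)
next
  case (coord j)
  have *: "((\<lambda>x. x $ j) has_derivative (\<lambda>x. x $ j)) (at x)" for x :: "real^'a"
    by (rule bounded_linear_imp_has_derivative[OF bounded_linear_vec_nth])
  have "partial_deriv i (\<lambda>x. x $ j) = (\<lambda>_. axis i 1 $ j)" for i :: 'a
    by (rule ext, subst partial_deriv_eq[OF *]) simp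
  then show ?case using * by (auto simp: differentiable_def intro: smooth_closure.const)
next
  case (add f g)
  have *: "((\<lambda>x. f x + g x) has_derivative
      (\<lambda>v. frechet_derivative f (at x) v + frechet_derivative g (at x) v)) (at x)" for x
    using add by (auto intro!: derivative_eq_intros simp flip: frechet_derivative_works)
  have "partial_deriv i (\<lambda>x. f x + g x) = (\<lambda>x. partial_deriv i f x + partial_deriv i g x)" for i
    by (rule ext, subst partial_deriv_eq[OF *]) (simp add: partial_deriv_def)
  then show ?case using * add by (auto simp: differentiable_def intro!: smooth_closure.add)
next
  case (mult f g)
  have *: "((\<lambda>x. f x * g x) has_derivative
      (\<lambda>v. f x * frechet_derivative g (at x) v + frechet_derivative f (at x) v * g x)) (at x)" for x
    using mult by (auto intro!: derivative_eq_intros simp flip: frechet_derivative_works)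
  have "partial_deriv i (\<lambda>x. f x * g x) = (\<lambda>x. f x * partial_deriv i g x + partial_deriv i f x * g x)" for i
    by (rule ext, subst partial_deriv_eq[OF *]) (simp add: partial_deriv_def)
  then show ?case using * mult
    by (auto simp: differentiable_def intro!: smooth_closure.add smooth_closure.mult)
next
  case (exp f)
  have *: "((\<lambda>x. exp (f x)) has_derivative
      (\<lambda>v. exp (f x) * frechet_derivative f (at x) v)) (at x)" for x
    using exp by (auto intro!: derivative_eq_intros simp flip: frechet_derivative_works)
  have "partial_deriv i (\<lambda>x. exp (f x)) = (\<lambda>x. exp (f x) * partial_deriv i f x)" for i
    by (rule ext, subst partial_deriv_eq[OF *]) (simp add: partial_deriv_def)
  then show ?case using * exp
    by (auto simp: differentiable_def intro!: smooth_closure.mult smooth_closure.exp)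
next
  case (flat_exp f n)
  have *: "((\<lambda>x. flat_exp n (f x)) has_derivative
      (\<lambda>v. frechet_derivative f (at x) v * (flat_exp (n + 2) (f x) - real n * flat_exp (n + 1) (f x)))) (at x)" for x
    by (rule DERIV_compose_FDERIV[OF flat_exp_deriv]) (use flat_exp in \<open>simp flip: frechet_derivative_works\<close>)
  \<comment> \<open>The difference is written as a sum with factor \<open>- real n\<close>:
    \<open>smooth_closure\<close> has rules for sums and products but none for differences.\<close>
  have "partial_deriv i (\<lambda>x. flat_exp n (f x)) =
      (\<lambda>x. partial_deriv i f x * (flat_exp (n + 2) (f x) + (- real n) * flat_exp (n + 1) (f x)))" for i
    by (rule ext, subst partial_deriv_eq[OF *]) (simp add: partial_deriv_def)
  moreover have "smooth_closure (\<lambda>x. partial_deriv i f x *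
      (flat_exp (n + 2) (f x) + (- real n) * flat_exp (n + 1) (f x)))" for i
    by (intro smooth_closure.mult smooth_closure.add smooth_closure.const smooth_closure.flat_exp)
      (use flat_exp in blast)+
  ultimately show ?case using * unfolding differentiable_def by metis
next
  case (shift f \<tau>)
  have *: "((\<lambda>x. f (x + \<tau>)) has_derivative frechet_derivative f (at (x + \<tau>))) (at x)" for x
  proof -
    have "(f has_derivative frechet_derivative f (at (x + \<tau>))) (at (x + \<tau>))"
      using shift by (simp flip: frechet_derivative_works)
    then show ?thesis
      by (rule has_derivative_compose[where g = f, rotated]) (auto intro!: derivative_eq_intros)
  qed
  have "partial_deriv i (\<lambda>x. f (x + \<tau>)) = (\<lambda>x. partial_deriv i f (x + \<tau>))" for i
    by (rule ext, subst partial_deriv_eq[OF *]) (simp add: partial_deriv_def)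
  moreover have "smooth_closure (\<lambda>x. partial_deriv i f (x + \<tau>))" for i
    by (rule smooth_closure.shift) (use shift in blast)
  ultimately show ?case using * unfolding differentiable_def by metis
qed

lemma smooth_closure_iff: "smooth_closure f \<longleftrightarrow> smooth f"
  using smooth_coinduct[of smooth_closure, OF _ smooth_closure_step] smooth_closure.base by blast

lemmas smooth_intros = smooth_closure.intros(2-7)[unfolded smooth_closure_iff]

lemmas smooth_shift = smooth_closure.shift[unfolded smooth_closure_iff]

lemma smooth_prod: "(\<And>i. i \<in> I \<Longrightarrow> smooth (f i)) \<Longrightarrow> smooth (\<lambda>x. \<Prod>i\<in>I. f i x)"
  by (induction I rule: infinite_finite_induct) (auto intro: smooth_intros)

lemma smooth_continuous: "smooth f \<Longrightarrow> continuous_on S f"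
  by (meson continuous_at_imp_continuous_on differentiable_imp_continuous_within smooth_differentiable)

lemma partial_deriv_add:
  assumes "smooth f" "smooth g"
  shows "partial_deriv i (\<lambda>x. f x + g x) x = partial_deriv i f x + partial_deriv i g x"
proof -
  have "((\<lambda>x. f x + g x) has_derivative
      (\<lambda>v. frechet_derivative f (at x) v + frechet_derivative g (at x) v)) (at x)"
    using assms[THEN smooth_differentiable] by (auto intro!: derivative_eq_intros simp flip: frechet_derivative_works)
  from partial_deriv_eq[OF this] show ?thesis by (simp add: partial_deriv_def)
qed

lemma partial_deriv_mult:
  assumes "smooth f" "smooth g"
  shows "partial_deriv i (\<lambda>x. f x * g x) x = f x * partial_deriv i g x + partial_deriv i f x * g x"
proof -
  have "((\<lambda>x. f x * g x) has_derivative
      (\<lambda>v. f x * frechet_derivative g (at x) v + frechet_derivative f (at x) v * g x)) (at x)"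
    using assms[THEN smooth_differentiable] by (auto intro!: derivative_eq_intros simp flip: frechet_derivative_works)
  from partial_deriv_eq[OF this] show ?thesis by (simp add: partial_deriv_def)
qed

lemma partial_deriv_const: "partial_deriv i (\<lambda>_. c) x = 0"
  by (simp add: partial_deriv_eq[OF has_derivative_const])

lemma partial_deriv_scale:
  "smooth f \<Longrightarrow> partial_deriv i (\<lambda>x. c * f x) x = c * partial_deriv i f x"
  using partial_deriv_mult[OF smooth_intros(1)[of c], of f i x] by (simp add: partial_deriv_const)

lemma partial_deriv_shift:
  assumes "smooth f"
  shows "partial_deriv i (\<lambda>x. f (x + \<tau>)) x = partial_deriv i f (x + \<tau>)"
proof -
  have "(f has_derivative frechet_derivative f (at (x + \<tau>))) (at (x + \<tau>))"
    using smooth_differentiable[OF assms] by (simp flip: frechet_derivative_works)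
  then have "((\<lambda>x. f (x + \<tau>)) has_derivative frechet_derivative f (at (x + \<tau>))) (at x)"
    by (rule has_derivative_compose[where g = f, rotated]) (auto intro!: derivative_eq_intros)
  from partial_deriv_eq[OF this] show ?thesis by (simp add: partial_deriv_def)
qed

section \<open>Closure properties of test functions, and cutoff functions\<close>

lemma test_functionsI:
  assumes "smooth f" "compact K" "K \<subseteq> U" "\<And>x. x \<notin> K \<Longrightarrow> f x = 0"
  shows "f \<in> test_functions U"
proof -
  have "closure {x. f x \<noteq> 0} \<subseteq> K"
    by (rule closure_minimal) (use assms compact_imp_closed in auto)
  moreover have "compact (closure {x. f x \<noteq> 0})"
    using \<open>compact K\<close> calculation by (metis closed_closure compact_Int_closed inf.absorb_iff2)
  ultimately show ?thesis using assms by (auto simp: test_functions_def)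
qed

text \<open>The complement of the support is open, so \<open>f\<close> agrees with 0 near each of
  its points and the derivatives vanish off the same \<open>K\<close>.\<close>

lemma test_functions_support:
  assumes "f \<in> test_functions U"
  obtains K where "compact K" "K \<subseteq> U" "\<And>x. x \<notin> K \<Longrightarrow> f x = 0" "\<And>x i. x \<notin> K \<Longrightarrow> partial_deriv i f x = 0"
proof -
  define K where "K = closure {x. f x \<noteq> 0}"
  have z: "f x = 0" if "x \<notin> K" for x using that closure_subset[of "{x. f x \<noteq> 0}"] unfolding K_def by blast
  have K: "compact K" "K \<subseteq> U" using assms by (auto simp: test_functions_def K_def)
  have "partial_deriv i f x = 0" if "x \<notin> K" for x i
  proof -
    have "((\<lambda>_. 0) has_derivative (\<lambda>_. 0)) (at x)" by simp
    then have "(f has_derivative (\<lambda>_. 0)) (at x)"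
      by (rule has_derivative_transform_within_open[of _ _ _ _ "- K"])
        (use that z in \<open>auto simp: open_Compl compact_imp_closed[OF K(1)]\<close>)
    from partial_deriv_eq[OF this] show ?thesis by simp
  qed
  then show ?thesis using that[of K] z K by blast
qed

lemma test_functions_smooth: "f \<in> test_functions U \<Longrightarrow> smooth f"
  by (simp add: test_functions_def)

lemma test_functions_mono: "U \<subseteq> V \<Longrightarrow> test_functions U \<subseteq> test_functions V"
  by (auto simp: test_functions_def)

lemma test_functions_outside: "f \<in> test_functions U \<Longrightarrow> x \<notin> U \<Longrightarrow> f x = 0"
  by (metis test_functions_support subsetD)

lemma test_functions_partial_deriv:
  "f \<in> test_functions U \<Longrightarrow> partial_deriv i f \<in> test_functions U"
  by (metis test_functions_support test_functionsI smooth_partial_deriv test_functions_smooth)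

lemma test_functions_mult:
  assumes "f \<in> test_functions U" "smooth g"
  shows "(\<lambda>x. g x * f x) \<in> test_functions U"
proof -
  obtain K where K: "compact K" "K \<subseteq> U" "\<And>x. x \<notin> K \<Longrightarrow> f x = 0"
    using test_functions_support[OF assms(1)] by metis
  show ?thesis
    by (rule test_functionsI[OF _ K(1,2)])
      (use assms K in \<open>auto intro!: smooth_intros dest: test_functions_smooth\<close>)
qed

lemma test_functions_scale:
  "f \<in> test_functions U \<Longrightarrow> (\<lambda>x. c * f x) \<in> test_functions U"
  using test_functions_mult[OF _ smooth_intros(1)] .

lemma test_functions_zero: "(\<lambda>_. 0) \<in> test_functions U"
  by (rule test_functionsI[of _ "{}"]) (auto intro: smooth_intros)

lemma test_functions_add:
  assumes "f \<in> test_functions U" "g \<in> test_functions U"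
  shows "(\<lambda>x. f x + g x) \<in> test_functions U"
proof -
  obtain K where K: "compact K" "K \<subseteq> U" "\<And>x. x \<notin> K \<Longrightarrow> f x = 0"
    using test_functions_support[OF assms(1)] by metis
  obtain L where L: "compact L" "L \<subseteq> U" "\<And>x. x \<notin> L \<Longrightarrow> g x = 0"
    using test_functions_support[OF assms(2)] by metis
  show ?thesis
    by (rule test_functionsI[of _ "K \<union> L"])
      (use assms K L in \<open>auto intro!: smooth_intros dest: test_functions_smooth\<close>)
qed

lemma test_functions_sum:
  "(\<And>j. j \<in> J \<Longrightarrow> f j \<in> test_functions U) \<Longrightarrow> (\<lambda>x. \<Sum>j\<in>J. f j x) \<in> test_functions U"
  by (induction J rule: infinite_finite_induct) (auto intro: test_functions_zero test_functions_add)

text \<open>The support moves by -\<tau>. The domain may change from \<open>W\<close> to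
  \<open>U\<close>; this is how step sizes smaller than the distance to the boundary enter.\<close>

lemma test_functions_shift:
  assumes "f \<in> test_functions W" "\<And>x. x \<in> W \<Longrightarrow> x - \<tau> \<in> U"
  shows "(\<lambda>x. f (x + \<tau>)) \<in> test_functions U"
proof -
  obtain K where K: "compact K" "K \<subseteq> W" "\<And>x. x \<notin> K \<Longrightarrow> f x = 0"
    using test_functions_support[OF assms(1)] by metis
  show ?thesis
  proof (rule test_functionsI[of _ "(\<lambda>x. x - \<tau>) ` K"])
    show "compact ((\<lambda>x. x - \<tau>) ` K)"
      by (rule compact_continuous_image[OF _ K(1)]) (intro continuous_intros)
    show "f (x + \<tau>) = 0" if "x \<notin> (\<lambda>x. x - \<tau>) ` K" for x
      using that K(3)[of "x + \<tau>"] by (metis add_diff_cancel image_eqI)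
  qed (use assms K in \<open>auto intro!: smooth_shift dest: test_functions_smooth\<close>)
qed

lemma test_functions_bounded:
  assumes "f \<in> test_functions U"
  obtains B where "B > 0" "\<And>x. \<bar>f x\<bar> \<le> B"
proof -
  obtain K where K: "compact K" "K \<subseteq> U" "\<And>x. x \<notin> K \<Longrightarrow> f x = 0"
    using test_functions_support[OF assms(1)] by metis
  have "compact (f ` K)"
    by (rule compact_continuous_image[OF smooth_continuous K(1)]) (rule test_functions_smooth[OF assms])
  then obtain B where B: "B > 0" "\<And>x. x \<in> K \<Longrightarrow> \<bar>f x\<bar> \<le> B"
    using compact_imp_bounded bounded_pos by (metis imageI real_norm_def)
  then have "\<bar>f x\<bar> \<le> B" for x using K(3)[of x] by (cases "x \<in> K") auto
  then show ?thesis using that B(1) by blast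
qed

text \<open>Written with sums and products only, so that the closure rules for smooth functions apply.\<close>

definition box_bump :: "real^'n \<Rightarrow> real^'n \<Rightarrow> real^'n \<Rightarrow> real" where
  "box_bump a b x = (\<Prod>i\<in>UNIV. flat_exp 0 (x $ i + - a $ i) * flat_exp 0 (b $ i + - 1 * x $ i))"

lemma flat_exp_nonneg: "flat_exp n t \<ge> 0"
  by (simp add: flat_exp_def)

lemma box_bump_smooth: "smooth (box_bump a b)"
  unfolding box_bump_def by (intro smooth_prod smooth_intros)

lemma box_bump_nonneg: "box_bump a b x \<ge> 0"
  unfolding box_bump_def by (intro prod_nonneg) (simp add: flat_exp_nonneg)

lemma box_bump_pos_iff: "box_bump a b x > 0 \<longleftrightarrow> x \<in> box a b"
proof -
  have "box_bump a b x \<noteq> 0 \<longleftrightarrow> x \<in> box a b"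
    by (force simp: box_bump_def flat_exp_def mem_box_cart)
  then show ?thesis using box_bump_nonneg[of a b x] by linarith
qed

lemma box_bump_test: "cbox a b \<subseteq> U \<Longrightarrow> box_bump a b \<in> test_functions U"
  by (rule test_functionsI[OF box_bump_smooth compact_cbox])
    (use box_bump_pos_iff[of a b] box_bump_nonneg[of a b] box_subset_cbox[of a b] in \<open>force simp: less_le\<close>)+

text \<open>Finitely many open boxes whose closed boxes lie in \<open>U\<close> cover
  \<open>K\<close>; the sum of their bumps is positive on \<open>K\<close> and attains its minimum
  there. A cutoff with a positive lower bound serves as well as one equal to 1, at the cost of a
  factor 1/c.\<close>

lemma test_function_pos_on_compact:
  assumes "compact K" "open U" "K \<subseteq> U"
  obtains \<zeta> c where "\<zeta> \<in> test_functions U" "c > 0" "\<And>x. x \<in> K \<Longrightarrow> \<zeta> x \<ge> c"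
proof (cases "K = {}")
  case True
  then show ?thesis using that[of "\<lambda>_. 0" 1] by (simp add: test_functions_zero)
next
  case False
  define I where "I = {(a, b). cbox a b \<subseteq> U}"
  have "\<exists>a b. cbox a b \<subseteq> U \<and> x \<in> box a b" if "x \<in> K" for x
    using assms that by (meson open_contains_cbox subsetD)
  then have "K \<subseteq> (\<Union>p\<in>I. box (fst p) (snd p))" by (auto simp: I_def)
  then obtain J where J: "J \<subseteq> I" "finite J" "K \<subseteq> (\<Union>p\<in>J. box (fst p) (snd p))"
    by (rule compactE_image[OF assms(1), rotated]) (auto intro: that)
  define \<zeta> where "\<zeta> x = (\<Sum>p\<in>J. box_bump (fst p) (snd p) x)" for x
  have t: "\<zeta> \<in> test_functions U" unfolding \<zeta>_def
    by (intro test_functions_sum box_bump_test) (use J(1) in \<open>force simp: I_def\<close>)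
  obtain x0 where x0: "x0 \<in> K" "\<And>x. x \<in> K \<Longrightarrow> \<zeta> x0 \<le> \<zeta> x"
    using continuous_attains_inf[OF assms(1) False smooth_continuous[OF test_functions_smooth[OF t]]] by blast
  obtain p where "p \<in> J" "x0 \<in> box (fst p) (snd p)" using x0(1) J(3) by blast
  then have "\<zeta> x0 > 0" unfolding \<zeta>_def using J(2) box_bump_pos_iff box_bump_nonneg
    by (intro sum_pos2[of J p]) auto
  then show ?thesis using that t x0(2) by blast
qed

section \<open>Square integrable functions\<close>

text \<open>Counterpart of \<open>l2_space\<close> for any measure. It is applied to
  \<open>lebesgue\<close> and to functions on the whole space, so that translates stay in the same
  space.\<close>

definition square_integrable :: "'a measure \<Rightarrow> ('a \<Rightarrow> real) \<Rightarrow> bool" where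
  "square_integrable M f \<longleftrightarrow> f \<in> borel_measurable M \<and> integrable M (\<lambda>x. (f x)\<^sup>2)"

definition norm2 :: "'a measure \<Rightarrow> ('a \<Rightarrow> real) \<Rightarrow> real" where
  "norm2 M f = sqrt (LINT x|M. (f x)\<^sup>2)"

lemma square_integrable_measurable: "square_integrable M f \<Longrightarrow> f \<in> borel_measurable M"
  by (simp add: square_integrable_def)

lemma square_integrable_bound:
  assumes "square_integrable M f" "g \<in> borel_measurable M" "AE x in M. \<bar>g x\<bar> \<le> B * \<bar>f x\<bar>"
  shows "square_integrable M g"
proof -
  have "integrable M (\<lambda>x. (g x)\<^sup>2)"
  proof (rule Bochner_Integration.integrable_bound)
    show "integrable M (\<lambda>x. B\<^sup>2 * (f x)\<^sup>2)" using assms(1) by (simp add: square_integrable_def)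
    show "(\<lambda>x. (g x)\<^sup>2) \<in> borel_measurable M" using assms(2) by measurable
    show "AE x in M. norm ((g x)\<^sup>2) \<le> norm (B\<^sup>2 * (f x)\<^sup>2)"
      using assms(3) by eventually_elim
        (metis abs_ge_zero norm_ge_zero power2_abs power_mono power_mult_distrib real_norm_def norm_power)
  qed
  then show ?thesis using assms by (simp add: square_integrable_def)
qed

lemma square_integrable_mult:
  assumes "square_integrable M f" "square_integrable M g"
  shows "integrable M (\<lambda>x. f x * g x)"
proof (rule Bochner_Integration.integrable_bound)
  show "integrable M (\<lambda>x. (f x)\<^sup>2 + (g x)\<^sup>2)" using assms by (simp add: square_integrable_def)
  show "(\<lambda>x. f x * g x) \<in> borel_measurable M"
    using assms unfolding square_integrable_def by (intro borel_measurable_times) blast+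
  show "AE x in M. norm (f x * g x) \<le> norm ((f x)\<^sup>2 + (g x)\<^sup>2)"
  proof (rule AE_I2)
    fix x
    have "2 * (\<bar>f x\<bar> * \<bar>g x\<bar>) \<le> (f x)\<^sup>2 + (g x)\<^sup>2"
      using sum_squares_bound[of "\<bar>f x\<bar>" "\<bar>g x\<bar>"] by simp
    moreover have "0 \<le> \<bar>f x\<bar> * \<bar>g x\<bar>" by simp
    ultimately have "\<bar>f x\<bar> * \<bar>g x\<bar> \<le> (f x)\<^sup>2 + (g x)\<^sup>2" by linarith
    then show "norm (f x * g x) \<le> norm ((f x)\<^sup>2 + (g x)\<^sup>2)" by (simp add: abs_mult)
  qed
qed

lemma square_integrable_add:
  assumes "square_integrable M f" "square_integrable M g"
  shows "square_integrable M (\<lambda>x. f x + g x)"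
  using assms square_integrable_mult[OF assms]
  by (auto simp: square_integrable_def power2_sum mult.assoc intro: borel_measurable_add)

lemma square_integrable_scale:
  "square_integrable M f \<Longrightarrow> square_integrable M (\<lambda>x. c * f x)"
  by (auto simp: square_integrable_def power_mult_distrib)

lemma square_integrable_diff:
  assumes "square_integrable M f" "square_integrable M g"
  shows "square_integrable M (\<lambda>x. f x - g x)"
  using square_integrable_add[OF assms(1) square_integrable_scale[OF assms(2), of "-1"]] by simp

lemma norm2_nonneg: "0 \<le> norm2 M f"
  by (simp add: norm2_def)

lemma norm2_power2: "(norm2 M f)\<^sup>2 = (LINT x|M. (f x)\<^sup>2)"
  by (simp add: norm2_def)

lemma norm2_le_iff: "0 \<le> B \<Longrightarrow> norm2 M f \<le> B \<longleftrightarrow> (LINT x|M. (f x)\<^sup>2) \<le> B\<^sup>2"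
  by (metis norm2_power2 norm2_nonneg power_mono power2_le_imp_le)

lemma norm2_cong_AE:
  assumes "f \<in> borel_measurable M" "g \<in> borel_measurable M" "AE x in M. f x = g x"
  shows "norm2 M f = norm2 M g"
proof -
  have "(LINT x|M. (f x)\<^sup>2) = (LINT x|M. (g x)\<^sup>2)"
    by (rule integral_cong_AE) (use assms in auto)
  then show ?thesis by (simp add: norm2_def)
qed

lemma norm2_mono:
  assumes "square_integrable M g" "\<And>x. \<bar>f x\<bar> \<le> \<bar>g x\<bar>"
  shows "norm2 M f \<le> norm2 M g"
proof -
  have "(LINT x|M. (f x)\<^sup>2) \<le> (LINT x|M. (g x)\<^sup>2)"
    by (rule integral_mono') (use assms in \<open>auto simp: square_integrable_def abs_le_square_iff\<close>)
  then show ?thesis by (simp add: norm2_def)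
qed

lemma norm2_scale: "norm2 M (\<lambda>x. c * f x) = \<bar>c\<bar> * norm2 M f"
  by (simp add: norm2_def power_mult_distrib real_sqrt_mult)

text \<open>The polynomial t \<mapsto> \<integral>(f - t g)^2 is nonnegative, so its discriminant is
  not positive.\<close>

lemma Cauchy_Schwarz_norm2:
  assumes "square_integrable M f" "square_integrable M g"
  shows "\<bar>LINT x|M. f x * g x\<bar> \<le> norm2 M f * norm2 M g"
proof -
  define a b c where "a = (LINT x|M. (f x)\<^sup>2)" "b = (LINT x|M. f x * g x)" "c = (LINT x|M. (g x)\<^sup>2)"
  note fg = square_integrable_mult[OF assms]
  have q: "0 \<le> a - 2 * t * b + t\<^sup>2 * c" for t
  proof -
    have "a - 2 * t * b + t\<^sup>2 * c = (LINT x|M. (f x)\<^sup>2 - 2 * t * (f x * g x) + t\<^sup>2 * (g x)\<^sup>2)"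
      using assms fg by (simp add: a_b_c_def square_integrable_def)
    also have "\<dots> = (LINT x|M. (f x - t * g x)\<^sup>2)"
      by (rule Bochner_Integration.integral_cong) (auto simp: power2_eq_square algebra_simps)
    finally show ?thesis by simp
  qed
  have "b\<^sup>2 \<le> a * c"
  proof (cases "c = 0")
    case True
    then have "2 * t * b \<le> a" for t using q[of t] by simp
    \<comment> \<open>For nonzero b this t would give a + 1 \<le> a.\<close>
    from this[of "(a + 1) / (2 * b)"] have "b = 0" by (auto split: if_splits)
    then show ?thesis using True by simp
  next
    case False
    moreover have "c \<ge> 0" by (simp add: a_b_c_def)
    ultimately have c: "c > 0" by simp
    \<comment> \<open>The polynomial is minimal at t = b / c.\<close>
    have "0 \<le> c * (a - 2 * (b / c) * b + (b / c)\<^sup>2 * c)" using q[of "b / c"] c by simp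
    also have "\<dots> = a * c - b\<^sup>2" using c by (simp add: field_simps power2_eq_square)
    finally show ?thesis by simp
  qed
  then have "\<bar>b\<bar> \<le> sqrt (a * c)" by (metis real_sqrt_abs real_sqrt_le_iff)
  then show ?thesis by (simp add: norm2_def a_b_c_def real_sqrt_mult)
qed

text \<open>Completeness of L^2 for sequences with a geometric rate: the whole sequence, not only a
  subsequence, converges almost everywhere, and Fatou's lemma transfers the rate to the
  limit.\<close>

lemma square_integrable_complete:
  assumes f: "\<And>k::nat. square_integrable M (f k)"
    and C: "\<And>j k. k \<le> j \<Longrightarrow> (LINT x|M. (f j x - f k x)\<^sup>2) \<le> C / 4 ^ k"
  shows "\<exists>w. square_integrable M w \<and> (\<forall>k. (LINT x|M. (w x - f k x)\<^sup>2) \<le> C / 4 ^ k)"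
proof -
  note [measurable] = square_integrable_measurable[OF f]
  have C0: "0 \<le> C" using C[of 0 0] by simp
  have i: "integrable M (\<lambda>x. (f j x - f k x)\<^sup>2)" for j k
    using square_integrable_diff[OF f f] by (simp add: square_integrable_def)
  have nn: "(\<integral>\<^sup>+x. ennreal ((f j x - f k x)\<^sup>2) \<partial>M) \<le> ennreal (C / 4 ^ k)" if "k \<le> j" for j k
    using i C[OF that] by (simp add: nn_integral_eq_integral ennreal_leI)
  \<comment> \<open>The integrals of the squares decay like 4^-k, so the weights 2^k leave a
    convergent series. Its finiteness almost everywhere controls the increments pointwise.\<close>
  have "(\<integral>\<^sup>+x. (\<Sum>k. ennreal (2 ^ k * (f (Suc k) x - f k x)\<^sup>2)) \<partial>M)
      = (\<Sum>k. \<integral>\<^sup>+x. ennreal (2 ^ k * (f (Suc k) x - f k x)\<^sup>2) \<partial>M)"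
    by (rule nn_integral_suminf) measurable
  also have "\<dots> \<le> (\<Sum>k. ennreal (C * (1 / 2) ^ k))"
  proof (rule suminf_le)
    fix k
    have "(\<integral>\<^sup>+x. ennreal (2 ^ k * (f (Suc k) x - f k x)\<^sup>2) \<partial>M)
        = ennreal (2 ^ k) * (\<integral>\<^sup>+x. ennreal ((f (Suc k) x - f k x)\<^sup>2) \<partial>M)"
      by (simp add: ennreal_mult' nn_integral_cmult)
    also have "\<dots> \<le> ennreal (2 ^ k) * ennreal (C / 4 ^ k)"
      by (rule mult_left_mono[OF nn]) auto
    also have "\<dots> = ennreal (C * (1 / 2) ^ k)"
    proof -
      have "(4::real) ^ k = 2 ^ k * 2 ^ k" by (simp flip: power_mult_distrib)
      then show ?thesis using C0 by (simp add: power_one_over field_simps flip: ennreal_mult)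
    qed
    finally show "(\<integral>\<^sup>+x. ennreal (2 ^ k * (f (Suc k) x - f k x)\<^sup>2) \<partial>M) \<le> ennreal (C * (1 / 2) ^ k)" .
  qed auto
  also have "\<dots> < \<infinity>"
    by (subst suminf_ennreal2) (use C0 in auto)
  finally have "AE x in M. (\<Sum>k. ennreal (2 ^ k * (f (Suc k) x - f k x)\<^sup>2)) \<noteq> \<infinity>"
    by (intro nn_integral_PInf_AE) auto
  then have conv: "AE x in M. convergent (\<lambda>k. f k x)"
  proof eventually_elim
    case (elim x)
    define d where "d k = f (Suc k) x - f k x" for k
    have "summable (\<lambda>k. 2 ^ k * (d k)\<^sup>2)"
      using elim by (intro summable_suminf_not_top) (auto simp: d_def)
    then have s: "summable (\<lambda>k. (1 / 2) ^ k + 2 ^ k * (d k)\<^sup>2)"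
      by (intro summable_add summable_geometric) auto
    have "summable d"
    proof (rule summable_comparison_test'[OF s])
      fix k
      \<comment> \<open>AM-GM trades the summability of the weighted squares for that of the differences\<close>
      have "0 \<le> (sqrt (2 ^ k) * \<bar>d k\<bar> - 1 / sqrt (2 ^ k))\<^sup>2" by simp
      also have "\<dots> = 2 ^ k * (d k)\<^sup>2 + (1 / 2) ^ k - 2 * \<bar>d k\<bar>"
        by (simp add: power2_diff power_mult_distrib power_divide power_one_over)
      finally show "norm (d k) \<le> (1 / 2) ^ k + 2 ^ k * (d k)\<^sup>2"
        by simp
    qed
    then have "convergent (\<lambda>n. f 0 x + (\<Sum>k<n. d k))"
      by (intro convergent_add convergent_const) (simp add: summable_iff_convergent)
    moreover have "f 0 x + (\<Sum>k<n. d k) = f n x" for n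
      unfolding d_def using sum_lessThan_telescope[of "\<lambda>k. f k x" n] by simp
    ultimately show ?case by simp
  qed
  \<comment> \<open>Where the sequence diverges, \<open>lim\<close> is an arbitrary value; this
    happens on a null set only.\<close>
  define w where "w x = lim (\<lambda>k. f k x)" for x
  have [measurable]: "w \<in> borel_measurable M" unfolding w_def by measurable
  have bd: "(\<integral>\<^sup>+x. ennreal ((w x - f k x)\<^sup>2) \<partial>M) \<le> ennreal (C / 4 ^ k)" for k
  proof -
    have "(\<integral>\<^sup>+x. ennreal ((w x - f k x)\<^sup>2) \<partial>M) = (\<integral>\<^sup>+x. liminf (\<lambda>j. ennreal ((f j x - f k x)\<^sup>2)) \<partial>M)"
    proof (rule nn_integral_cong_AE)
      show "AE x in M. ennreal ((w x - f k x)\<^sup>2) = liminf (\<lambda>j. ennreal ((f j x - f k x)\<^sup>2))"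
        using conv
      proof eventually_elim
        case (elim x)
        then have "(\<lambda>j. f j x) \<longlonglongrightarrow> w x" by (simp add: w_def convergent_LIMSEQ_iff)
        then have "(\<lambda>j. ennreal ((f j x - f k x)\<^sup>2)) \<longlonglongrightarrow> ennreal ((w x - f k x)\<^sup>2)"
          by (intro tendsto_intros)
        from lim_imp_Liminf[OF _ this] show ?case by simp
      qed
    qed
    also have "\<dots> \<le> liminf (\<lambda>j. \<integral>\<^sup>+x. ennreal ((f j x - f k x)\<^sup>2) \<partial>M)"
      by (rule nn_integral_liminf) measurable
    also have "\<dots> \<le> liminf (\<lambda>j. ennreal (C / 4 ^ k))"
      by (rule Liminf_mono) (use nn in \<open>auto simp: eventually_sequentially\<close>)
    also have "\<dots> = ennreal (C / 4 ^ k)" by (simp add: Liminf_const)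
    finally show ?thesis .
  qed
  have iw: "integrable M (\<lambda>x. (w x - f k x)\<^sup>2)" for k
    by (rule integrableI_nonneg) (use le_less_trans[OF bd[of k]] in auto)
  have "square_integrable M (\<lambda>x. w x - f 0 x)" using iw by (simp add: square_integrable_def)
  from square_integrable_add[OF this f[of 0]] have "square_integrable M w" by simp
  moreover have "(LINT x|M. (w x - f k x)\<^sup>2) \<le> C / 4 ^ k" for k
  proof -
    have "ennreal (LINT x|M. (w x - f k x)\<^sup>2) \<le> ennreal (C / 4 ^ k)"
      using bd[of k] nn_integral_eq_integral[OF iw] by simp
    then show ?thesis using C0 by (subst (asm) ennreal_le_iff) auto
  qed
  ultimately show ?thesis by blast
qed

section \<open>Translation invariance of the Lebesgue measure and of L^2\<close>

lemma distr_lebesgue_translation: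
  fixes \<tau> :: "'a::euclidean_space"
  shows "distr lebesgue lebesgue (\<lambda>x. x + \<tau>) = lebesgue"
    and measurable_lebesgue_translation: "(\<lambda>x. x + \<tau>) \<in> lebesgue \<rightarrow>\<^sub>M lebesgue"
proof -
  \<comment> \<open>A translation is an affine map with scaling factor 1 along every basis vector,
    so the density factor is 1.\<close>
  have *: "(\<lambda>x. \<tau> + (\<Sum>j\<in>Basis. (1 * (x \<bullet> j)) *\<^sub>R j)) = (\<lambda>x. x + \<tau>)"
    by (simp add: euclidean_representation add.commute)
  show "(\<lambda>x. x + \<tau>) \<in> lebesgue \<rightarrow>\<^sub>M lebesgue"
    using lebesgue_affine_measurable[of "\<lambda>_. 1" \<tau>] unfolding * by simp
  show "distr lebesgue lebesgue (\<lambda>x. x + \<tau>) = lebesgue"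
    using lebesgue_affine_euclidean[of "\<lambda>_. 1" \<tau>] unfolding * by (simp add: density_1)
qed

lemma borel_measurable_lebesgue_translation:
  fixes f :: "'a::euclidean_space \<Rightarrow> 'b::topological_space"
  assumes "f \<in> borel_measurable lebesgue"
  shows "(\<lambda>x. f (x + \<tau>)) \<in> borel_measurable lebesgue"
  using measurable_compose[OF measurable_lebesgue_translation assms] .

lemma integral_lebesgue_translation:
  fixes f :: "'a::euclidean_space \<Rightarrow> real"
  assumes "f \<in> borel_measurable lebesgue"
  shows "(LINT x|lebesgue. f (x + \<tau>)) = (LINT x|lebesgue. f x)"
  using integral_distr[OF measurable_lebesgue_translation assms, of \<tau>]
  by (simp add: distr_lebesgue_translation)

lemma integrable_lebesgue_translation:
  fixes f :: "'a::euclidean_space \<Rightarrow> real"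
  assumes "integrable lebesgue f"
  shows "integrable lebesgue (\<lambda>x. f (x + \<tau>))"
  using integrable_distr[OF measurable_lebesgue_translation[of \<tau>], of f] assms
  by (simp add: distr_lebesgue_translation)

lemma square_integrable_translation:
  fixes f :: "'a::euclidean_space \<Rightarrow> real"
  assumes "square_integrable lebesgue f"
  shows "square_integrable lebesgue (\<lambda>x. f (x + \<tau>))"
  using assms integrable_lebesgue_translation[of "\<lambda>x. (f x)\<^sup>2"] borel_measurable_lebesgue_translation[of f]
  by (simp add: square_integrable_def)

lemma norm2_translation:
  fixes f :: "'a::euclidean_space \<Rightarrow> real"
  assumes "f \<in> borel_measurable lebesgue"
  shows "norm2 lebesgue (\<lambda>x. f (x + \<tau>)) = norm2 lebesgue f"
  using integral_lebesgue_translation[of "\<lambda>x. (f x)\<^sup>2" \<tau>] assms by (simp add: norm2_def)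

section \<open>Fundamental lemma of the calculus of variations\<close>

text \<open>The sets A with \<integral>_A h = 0 form a Dynkin system containing the
  intersection-stable boxes, hence all Borel sets; complements are where \<open>tot0\<close> enters.
  A Lebesgue set differs from a Borel set by a null set.\<close>

lemma AE_zero_if_box_integrals_zero:
  fixes h :: "'a::euclidean_space \<Rightarrow> real"
  assumes h: "integrable lebesgue h"
    and box0: "\<And>a b. (LINT x|lebesgue. indicator (box a b) x * h x) = 0"
    and tot0: "(LINT x|lebesgue. h x) = 0"
  shows "AE x in lebesgue. h x = 0"
proof -
  have ih: "integrable lebesgue (\<lambda>x. indicator A x * h x)" if "A \<in> sets lebesgue" for A
    using integrable_mult_indicator[OF that h] by simp
  have borel0: "(LINT x|lebesgue. indicator A x * h x) = 0" if A: "A \<in> sets borel" for A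
  proof -
    have "Int_stable (range (\<lambda>(a, b). box a b :: 'a set))"
      by (auto simp: Int_stable_def box_Int_box)
    moreover have "(range (\<lambda>(a, b). box a b :: 'a set)) \<subseteq> Pow UNIV" by auto
    moreover have "A \<in> sigma_sets UNIV (range (\<lambda>(a, b). box a b))"
      using A unfolding borel_eq_box by simp
    ultimately show ?thesis
    proof (induction rule: sigma_sets_induct_disjoint)
      case (basic A) then show ?case using box0 by auto
    next
      case empty then show ?case by simp
    next
      case (compl A)
      then have "A \<in> sets borel" by (simp add: borel_eq_box)
      then have "A \<in> sets lebesgue" by simp
      have "(LINT x|lebesgue. indicator (UNIV - A) x * h x) = (LINT x|lebesgue. h x - indicator A x * h x)"
        by (rule Bochner_Integration.integral_cong) (auto simp: indicator_def)
      also have "\<dots> = 0" using h ih[OF \<open>A \<in> sets lebesgue\<close>] tot0 compl by simp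
      finally show ?case .
    next
      case (union F)
      then have "\<And>i. F i \<in> sets borel" by (simp add: borel_eq_box subset_eq)
      then have F: "\<And>i. F i \<in> sets lebesgue" by simp
      then have UF: "(\<Union>i. F i) \<in> sets lebesgue" by blast
      have "(LINT x:(\<Union>i. F i)|lebesgue. h x) = (\<Sum>i. (LINT x:(F i)|lebesgue. h x))"
      proof (rule lebesgue_integral_countable_add[OF F])
        show "F i \<inter> F j = {}" if "i \<noteq> j" for i j
          using union(1) that by (auto simp: disjoint_family_on_def)
        show "set_integrable lebesgue (\<Union>i. F i) h"
          using ih[OF UF] by (simp add: set_integrable_def)
      qed
      then show ?case using union.IH by (simp add: set_lebesgue_integral_def)
    qed
  qed
  show ?thesis
  proof (rule density_unique_real[OF h])
    fix A :: "'a set" assume "A \<in> sets lebesgue"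
    then obtain S N N' where A: "A = S \<union> N" "N \<subseteq> N'" "N' \<in> null_sets lborel" "S \<in> sets lborel"
      by (rule sets_completionE)
    have N': "AE x in lebesgue. x \<notin> N'"
      using A(3) by (intro AE_not_in) (simp add: null_sets_completionI)
    have "(LINT x|lebesgue. indicator A x * h x) = (LINT x|lebesgue. indicator S x * h x)"
    proof (rule integral_cong_AE)
      show "(\<lambda>x. indicator A x * h x) \<in> borel_measurable lebesgue"
        using ih[OF \<open>A \<in> sets lebesgue\<close>] by blast
      show "(\<lambda>x. indicator S x * h x) \<in> borel_measurable lebesgue"
        using ih[of S] A(4) by auto
      show "AE x in lebesgue. indicator A x * h x = indicator S x * h x"
        using N' by eventually_elim (use A in \<open>auto simp: indicator_def\<close>)
    qed
    also have "\<dots> = 0" using borel0 A(4) by simp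
    finally show "(LINT x:A|lebesgue. h x) = (LINT x:A|lebesgue. 0)"
      by (simp add: set_lebesgue_integral_def)
  qed simp
qed

lemma integral_lebesgue_on_eq:
  fixes F :: "'a::euclidean_space \<Rightarrow> real"
  assumes "U \<in> sets lebesgue"
  shows "(LINT x|lebesgue_on U. F x) = (LINT x|lebesgue. indicator U x * F x)"
  using integral_restrict_space[of U lebesgue F] assms by simp

lemma integrable_lebesgue_on_iff:
  fixes F :: "'a::euclidean_space \<Rightarrow> real"
  assumes "U \<in> sets lebesgue"
  shows "integrable (lebesgue_on U) F \<longleftrightarrow> integrable lebesgue (\<lambda>x. indicator U x * F x)"
  using integrable_restrict_space[of U lebesgue F] assms by simp

lemma AE_lebesgue_on_iff:
  assumes "U \<in> sets lebesgue"
  shows "(AE x in lebesgue_on U. P x) \<longleftrightarrow> (AE x in lebesgue. x \<in> U \<longrightarrow> P x)"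
  using AE_restrict_space_iff[of U lebesgue P] assms by simp

lemma smooth_measurable:
  fixes f :: "real^'n \<Rightarrow> real"
  assumes "smooth f" shows "f \<in> borel_measurable lebesgue"
  using borel_measurable_continuous_onI[OF smooth_continuous[OF assms]]
  by (simp add: measurable_completion)

text \<open>\<open>g\<close> is given as integrable on compact subsets only, so the product is
  rewritten with the indicator of the support \<open>K\<close> and dominated there by a multiple of
  \<open>g\<close>.\<close>

lemma locally_integrable_mult_test:
  assumes g: "locally_integrable U g" and "\<phi> \<in> test_functions U"
  shows "integrable lebesgue (\<lambda>x. indicator U x * (g x * \<phi> x))"
proof -
  obtain K where K: "compact K" "K \<subseteq> U" "\<And>x. x \<notin> K \<Longrightarrow> \<phi> x = 0"
    using test_functions_support[OF assms(2)] by metis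
  obtain B where B: "\<And>x. \<bar>\<phi> x\<bar> \<le> B" using test_functions_bounded[OF assms(2)] by metis
  have KS: "K \<in> sets lebesgue" using K(1) by (simp add: compact_imp_closed)
  have gK: "integrable lebesgue (\<lambda>x. indicator K x * g x)"
    using g K(1,2) integrable_lebesgue_on_iff[OF KS] by (auto simp: locally_integrable_def)
  have "integrable lebesgue (\<lambda>x. (indicator K x * g x) * \<phi> x)"
  proof (rule Bochner_Integration.integrable_bound)
    show "integrable lebesgue (\<lambda>x. B * (indicator K x * g x))" using gK by simp
    show "(\<lambda>x. indicator K x * g x * \<phi> x) \<in> borel_measurable lebesgue"
      by (rule borel_measurable_times[OF borel_measurable_integrable[OF gK]
            smooth_measurable[OF test_functions_smooth[OF assms(2)]]])
    have "\<bar>indicator K x * g x * \<phi> x\<bar> \<le> \<bar>B * (indicator K x * g x)\<bar>" for x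
      unfolding abs_mult mult.commute[of _ "\<bar>\<phi> x\<bar>"] using B[of x]
      by (intro mult_right_mono) auto
    then show "AE x in lebesgue. norm (indicator K x * g x * \<phi> x) \<le> norm (B * (indicator K x * g x))" by simp
  qed
  moreover have "(indicator K x * g x) * \<phi> x = indicator U x * (g x * \<phi> x)" for x
    using K(2,3) by (auto simp: indicator_def)
  ultimately show ?thesis by simp
qed

text \<open>Dominated convergence carries the hypothesis from test functions to indicators of boxes.
  Hence \<open>g\<close> vanishes almost everywhere on every closed box in \<open>U\<close>, and
  countably many of these cover \<open>U\<close>.\<close>

lemma fundamental_lemma_calculus_of_variations:
  fixes g :: "real^'n \<Rightarrow> real"
  assumes U: "open U" and g: "locally_integrable U g"
    and zero: "\<And>\<phi>. \<phi> \<in> test_functions U \<Longrightarrow> (LINT x|lebesgue_on U. g x * \<phi> x) = 0"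
  shows "AE x in lebesgue_on U. g x = 0"
proof -
  have US: "U \<in> sets lebesgue" using U by simp
  have gK: "integrable lebesgue (\<lambda>x. indicator K x * g x)" if "compact K" "K \<subseteq> U" for K
    using g that integrable_lebesgue_on_iff[of K g] by (auto simp: locally_integrable_def compact_imp_closed)
  have box0: "(LINT x|lebesgue. indicator (box a b) x * g x) = 0" if ab: "cbox a b \<subseteq> U" for a b
  proof -
    \<comment> \<open>test functions that increase to the indicator function of the box\<close>
    define \<phi> where "\<phi> m x = 1 + -1 * exp (- real m * box_bump a b x)" for m x
    have \<phi>0: "\<phi> m x = 0" if "x \<notin> cbox a b" for m x
    proof -
      have "box_bump a b x = 0"
        using that box_bump_pos_iff[of a b x] box_bump_nonneg[of a b x] box_subset_cbox[of a b] by fastforce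
      then show ?thesis by (simp add: \<phi>_def)
    qed
    have \<phi>: "\<phi> m \<in> test_functions U" for m
    proof (rule test_functionsI[OF _ compact_cbox ab \<phi>0])
      show "smooth (\<phi> m)" unfolding \<phi>_def by (intro smooth_intros box_bump_smooth)
    qed
    have "(\<lambda>m. LINT x|lebesgue. indicator (cbox a b) x * g x * \<phi> m x)
        \<longlonglongrightarrow> (LINT x|lebesgue. indicator (box a b) x * g x)"
    proof (rule integral_dominated_convergence[where w = "\<lambda>x. \<bar>indicator (cbox a b) x * g x\<bar>"])
      show "(\<lambda>x. indicator (box a b) x * g x) \<in> borel_measurable lebesgue"
      proof -
        have "(\<lambda>x. indicator (box a b) x * (indicator (cbox a b) x * g x)) \<in> borel_measurable lebesgue"
          by (rule borel_measurable_times[OF borel_measurable_indicator borel_measurable_integrable[OF gK[OF compact_cbox ab]]]) simp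
        moreover have "indicator (box a b) x * (indicator (cbox a b) x * g x) = indicator (box a b) x * g x" for x
          using box_subset_cbox[of a b] by (auto simp: indicator_def)
        ultimately show ?thesis by simp
      qed
      show "(\<lambda>x. indicator (cbox a b) x * g x * \<phi> m x) \<in> borel_measurable lebesgue" for m
        by (rule borel_measurable_times[OF borel_measurable_integrable[OF gK[OF compact_cbox ab]]
              smooth_measurable[OF test_functions_smooth[OF \<phi>]]])
      show "integrable lebesgue (\<lambda>x. \<bar>indicator (cbox a b) x * g x\<bar>)"
        using gK[OF compact_cbox ab] by simp
      have b1: "\<bar>\<phi> m x\<bar> \<le> 1" for m x
        using mult_nonneg_nonneg[OF of_nat_0_le_iff box_bump_nonneg, of m a b x] by (simp add: \<phi>_def)
      show "AE x in lebesgue. norm (indicator (cbox a b) x * g x * \<phi> m x) \<le> \<bar>indicator (cbox a b) x * g x\<bar>" for m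
        using mult_left_mono[OF b1, of "\<bar>indicator (cbox a b) x * g x\<bar>" m x for x] by (simp add: abs_mult)
      show "AE x in lebesgue. (\<lambda>m. indicator (cbox a b) x * g x * \<phi> m x) \<longlonglongrightarrow> indicator (box a b) x * g x"
      proof (rule AE_I2)
        fix x
        have "(\<lambda>m. \<phi> m x) \<longlonglongrightarrow> indicator (box a b) x"
        proof (cases "x \<in> box a b")
          case True
          define c where "c = box_bump a b x"
          have c: "c > 0" using True box_bump_pos_iff[of a b x] by (simp add: c_def)
          have "exp (- c) < 1" using c by simp
          then have "(\<lambda>m. exp (- c) ^ m) \<longlonglongrightarrow> 0"
            by (intro LIMSEQ_realpow_zero) simp_all
          then have "(\<lambda>m. 1 + -1 * exp (- c) ^ m) \<longlonglongrightarrow> 1 + -1 * 0"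
            by (intro tendsto_add tendsto_const tendsto_mult)
          moreover have "\<phi> m x = 1 + -1 * exp (- c) ^ m" for m
            by (simp add: \<phi>_def c_def flip: exp_of_nat_mult)
          ultimately show ?thesis using True by simp
        next
          case False
          then have "box_bump a b x = 0" using box_bump_pos_iff[of a b x] box_bump_nonneg[of a b x] by auto
          then show ?thesis using False by (simp add: \<phi>_def)
        qed
        then have "(\<lambda>m. indicator (cbox a b) x * g x * \<phi> m x) \<longlonglongrightarrow> indicator (cbox a b) x * g x * indicator (box a b) x"
          by (intro tendsto_intros)
        moreover have "indicator (cbox a b) x * g x * indicator (box a b) x = indicator (box a b) x * g x"
          using box_subset_cbox[of a b] by (auto simp: indicator_def)
        ultimately show "(\<lambda>m. indicator (cbox a b) x * g x * \<phi> m x) \<longlonglongrightarrow> indicator (box a b) x * g x" by simp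
      qed
    qed
    moreover have "(LINT x|lebesgue. indicator (cbox a b) x * g x * \<phi> m x) = 0" for m
    proof -
      have "indicator (cbox a b) x * g x * \<phi> m x = indicator U x * (g x * \<phi> m x)" for x
        using ab \<phi>0[of x m] by (cases "x \<in> cbox a b") auto
      then have "(LINT x|lebesgue. indicator (cbox a b) x * g x * \<phi> m x) = (LINT x|lebesgue. indicator U x * (g x * \<phi> m x))"
        by (intro Bochner_Integration.integral_cong) auto
      also have "\<dots> = 0" using zero[OF \<phi>, of m] by (simp only: integral_lebesgue_on_eq[OF US])
      finally show ?thesis .
    qed
    ultimately show ?thesis by (simp add: LIMSEQ_const_iff)
  qed
  have cbox0: "AE x in lebesgue. x \<in> cbox a b \<longrightarrow> g x = 0" if ab: "cbox a b \<subseteq> U" for a b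
  proof -
    have "AE x in lebesgue. indicator (box a b) x * g x = 0"
    proof (rule AE_zero_if_box_integrals_zero)
      have "integrable lebesgue (\<lambda>x. indicator (box a b) x *\<^sub>R (indicator (cbox a b) x * g x))"
        by (rule integrable_mult_indicator[OF _ gK[OF compact_cbox ab]]) simp
      moreover have "(\<lambda>x. indicator (box a b) x *\<^sub>R (indicator (cbox a b) x * g x)) = (\<lambda>x. indicator (box a b) x * g x)"
        using box_subset_cbox[of a b] by (auto simp: indicator_def fun_eq_iff)
      ultimately show "integrable lebesgue (\<lambda>x. indicator (box a b) x * g x)" by (simp only:)
      show "(LINT x|lebesgue. indicator (box a b) x * g x) = 0" by (rule box0[OF ab])
      fix c d
      obtain p q where pq: "box c d \<inter> box a b = box p q" by (rule that[OF box_Int_box])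
      show "(LINT x|lebesgue. indicator (box c d) x * (indicator (box a b) x * g x)) = 0"
      \<comment> \<open>If \<open>box p q\<close> is empty, nothing is known about the closed box
        with the same corners; otherwise that box is the closure of \<open>box p q\<close> and lies
        in \<open>U\<close>.\<close>
      proof (cases "box p q = {}")
        case True
        then have "(\<lambda>x. indicator (box c d) x * (indicator (box a b) x * g x)) = (\<lambda>x. 0)"
          using pq by (auto simp: indicator_def fun_eq_iff)
        then show ?thesis by (simp only: Bochner_Integration.integral_zero)
      next
        case False
        have "cbox p q = closure (box p q)" using closure_box[OF False] by simp
        also have "\<dots> \<subseteq> cbox a b"
          using pq box_subset_cbox[of a b] by (intro closure_minimal) auto
        finally have "cbox p q \<subseteq> U" using ab by simp
        moreover have "(\<lambda>x. indicator (box c d) x * (indicator (box a b) x * g x)) = (\<lambda>x. indicator (box p q) x * g x)"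
          unfolding pq[symmetric] by (auto simp: indicator_def fun_eq_iff)
        ultimately show ?thesis using box0 by (simp only:)
      qed
    qed
    \<comment> \<open>The faces of a box form a null set.\<close>
    moreover have "AE x in lebesgue. x \<notin> cbox a b - box a b"
      using negligible_frontier_interval[of a b] by (intro AE_not_in) (simp add: negligible_iff_null_sets)
    ultimately show ?thesis by eventually_elim (auto simp: indicator_def)
  qed
  obtain \<D> where D: "countable \<D>" "\<D> \<subseteq> Pow U" "\<And>X. X \<in> \<D> \<Longrightarrow> \<exists>a b. X = cbox a b" "\<Union>\<D> = U"
    by (rule open_countable_Union_open_cbox[OF U]) (rule that)
  have "AE x in lebesgue. \<forall>X\<in>\<D>. x \<in> X \<longrightarrow> g x = 0"
    unfolding AE_ball_countable[OF D(1)]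
  proof
    fix X assume X: "X \<in> \<D>"
    then obtain a b where ab: "X = cbox a b" using D(3) by blast
    show "AE x in lebesgue. x \<in> X \<longrightarrow> g x = 0"
      unfolding ab by (rule cbox0) (use X D(2) ab in blast)
  qed
  then have "AE x in lebesgue. x \<in> U \<longrightarrow> g x = 0"
    by eventually_elim (use D(4) in blast)
  then show ?thesis using AE_lebesgue_on_iff[OF US] by blast
qed

section \<open>Uniqueness of weak derivatives, and L^2 of an open set through extension by
  zero\<close>

lemma locally_integrable_diff:
  "locally_integrable U f \<Longrightarrow> locally_integrable U g \<Longrightarrow> locally_integrable U (\<lambda>x. f x - g x)"
  by (auto simp: locally_integrable_def)

text \<open>\<open>weak_deriv\<close> is a choice among all weak derivatives; uniqueness makes
  statements about it independent of that choice. The sign (-1)^k cancels and the fundamental lemma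
  applies to the difference.\<close>

lemma has_weak_deriv_unique:
  assumes U: "open U" and g: "has_weak_deriv U is u g" and h: "has_weak_deriv U is u h"
  shows "AE x in lebesgue_on U. g x = h x"
proof -
  have US: "U \<in> sets lebesgue" using U by simp
  have lg: "locally_integrable U g" and lh: "locally_integrable U h"
    using g h by (auto simp: has_weak_deriv_def)
  have "AE x in lebesgue_on U. g x - h x = 0"
  proof (rule fundamental_lemma_calculus_of_variations[OF U locally_integrable_diff[OF lg lh]])
    fix \<phi> assume t: "\<phi> \<in> test_functions U"
    have "(-1) ^ length is * (LINT x|lebesgue_on U. g x * \<phi> x) = (-1) ^ length is * (LINT x|lebesgue_on U. h x * \<phi> x)"
    proof -
      have "(LINT x|lebesgue_on U. u x * partial_derivs is \<phi> x) = (-1) ^ length is * (LINT x|lebesgue_on U. g x * \<phi> x)"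
        using g t unfolding has_weak_deriv_def by blast
      moreover have "(LINT x|lebesgue_on U. u x * partial_derivs is \<phi> x) = (-1) ^ length is * (LINT x|lebesgue_on U. h x * \<phi> x)"
        using h t unfolding has_weak_deriv_def by blast
      ultimately show ?thesis by (rule trans[OF sym])
    qed
    then have "(LINT x|lebesgue_on U. g x * \<phi> x) = (LINT x|lebesgue_on U. h x * \<phi> x)" by simp
    then have "(LINT x|lebesgue. indicator U x * (g x * \<phi> x)) = (LINT x|lebesgue. indicator U x * (h x * \<phi> x))"
      by (simp add: integral_lebesgue_on_eq[OF US])
    then have "(LINT x|lebesgue. indicator U x * (g x * \<phi> x) - indicator U x * (h x * \<phi> x)) = 0"
      using locally_integrable_mult_test[OF lg t] locally_integrable_mult_test[OF lh t] by simp
    then show "(LINT x|lebesgue_on U. (g x - h x) * \<phi> x) = 0"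
      by (simp add: integral_lebesgue_on_eq[OF US] algebra_simps)
  qed
  then show ?thesis by simp
qed

text \<open>Embeds L^2 of a subset isometrically into L^2 of the whole space, so that a single
  measure serves all domains and all translates.\<close>

definition zero_ext :: "'a set \<Rightarrow> ('a \<Rightarrow> real) \<Rightarrow> 'a \<Rightarrow> real" where
  "zero_ext U f x = indicator U x * f x"

lemma l2_space_iff:
  assumes "U \<in> sets lebesgue"
  shows "f \<in> l2_space U \<longleftrightarrow> square_integrable lebesgue (zero_ext U f)"
proof -
  have "(zero_ext U f x)\<^sup>2 = indicator U x * (f x)\<^sup>2" for x
    by (auto simp: zero_ext_def indicator_def)
  then show ?thesis
    using borel_measurable_restrict_space_iff[of U lebesgue f] assms
    by (simp add: l2_space_def square_integrable_def integrable_lebesgue_on_iff[OF assms] zero_ext_def[abs_def])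
qed

lemma l2_norm_eq:
  assumes "U \<in> sets lebesgue"
  shows "l2_norm U f = norm2 lebesgue (zero_ext U f)"
proof -
  have "(zero_ext U f x)\<^sup>2 = indicator U x * (f x)\<^sup>2" for x
    by (auto simp: zero_ext_def indicator_def)
  then show ?thesis by (simp add: l2_norm_def norm2_def integral_lebesgue_on_eq[OF assms])
qed

text \<open>A compact set has finite measure, so its indicator is square integrable, and a product
  of two square integrable functions is integrable.\<close>

lemma l2_space_locally_integrable:
  assumes "U \<in> sets lebesgue" "f \<in> l2_space U"
  shows "locally_integrable U f"
  unfolding locally_integrable_def
proof (intro allI impI)
  fix K assume K: "compact K \<and> K \<subseteq> U"
  then have KS: "K \<in> lmeasurable" by (simp add: lmeasurable_compact)
  have "(indicat_real K x)\<^sup>2 = indicator K x" for x by (simp add: indicator_def)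
  moreover have "integrable lebesgue (indicat_real K)"
    using KS by (intro integrable_real_indicator) (auto simp: fmeasurable_def)
  ultimately have "square_integrable lebesgue (indicat_real K)"
    unfolding square_integrable_def by (simp add: borel_measurable_integrable)
  moreover have "square_integrable lebesgue (zero_ext U f)" using assms l2_space_iff by blast
  ultimately have "integrable lebesgue (\<lambda>x. indicator K x * zero_ext U f x)"
    by (rule square_integrable_mult)
  moreover have "indicator K x * zero_ext U f x = indicator K x * f x" for x
    using K by (auto simp: zero_ext_def indicator_def)
  ultimately show "integrable (lebesgue_on K) f"
    using integrable_lebesgue_on_iff[of K f] KS by (simp add: fmeasurableD)
qed

lemma integral_lebesgue_on_mult:
  assumes "U \<in> sets lebesgue"
  shows "(LINT x|lebesgue_on U. f x * g x) = (LINT x|lebesgue. zero_ext U f x * g x)"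
  by (simp add: integral_lebesgue_on_eq[OF assms] zero_ext_def mult.assoc)

lemma has_weak_deriv_l2_iff:
  assumes "U \<in> sets lebesgue" "u \<in> l2_space U" "g \<in> l2_space U"
  shows "has_weak_deriv U is u g \<longleftrightarrow> (\<forall>\<phi>\<in>test_functions U.
    (LINT x|lebesgue. zero_ext U u x * partial_derivs is \<phi> x) =
    (-1) ^ length is * (LINT x|lebesgue. zero_ext U g x * \<phi> x))"
  unfolding has_weak_deriv_def
  by (simp add: l2_space_locally_integrable[OF assms(1)] assms(2,3) integral_lebesgue_on_mult[OF assms(1)])

lemma weak_deriv_AE_eq:
  assumes "open U" "has_weak_deriv U is u g"
  shows "AE x in lebesgue. zero_ext U (weak_deriv U is u) x = zero_ext U g x"
proof -
  have US: "U \<in> sets lebesgue" using assms(1) by simp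
  have "has_weak_deriv U is u (weak_deriv U is u)"
    unfolding weak_deriv_def by (rule someI[of "has_weak_deriv U is u", OF assms(2)])
  from has_weak_deriv_unique[OF assms(1) this assms(2)]
  have "AE x in lebesgue. x \<in> U \<longrightarrow> weak_deriv U is u x = g x"
    by (simp add: AE_lebesgue_on_iff[OF US])
  then show ?thesis by eventually_elim (auto simp: zero_ext_def indicator_def)
qed

text \<open>The chosen derivative equals \<open>g\<close> almost everywhere on \<open>U\<close>, and
  measurability survives a change on a null set because the Lebesgue measure is complete.\<close>

lemma weak_deriv_l2:
  assumes "open U" "has_weak_deriv U is u g" "g \<in> l2_space U"
  shows "weak_deriv U is u \<in> l2_space U" "has_weak_deriv U is u (weak_deriv U is u)"
    "l2_norm U (weak_deriv U is u) = l2_norm U g"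
proof -
  have US: "U \<in> sets lebesgue" using assms(1) by simp
  have g: "square_integrable lebesgue (zero_ext U g)" using assms(3) l2_space_iff[OF US] by blast
  note AE = weak_deriv_AE_eq[OF assms(1,2)]
  have m: "zero_ext U (weak_deriv U is u) \<in> borel_measurable lebesgue"
    by (rule borel_measurable_AE[OF square_integrable_measurable[OF g]]) (use AE in eventually_elim, simp)
  have "square_integrable lebesgue (zero_ext U (weak_deriv U is u))"
    by (rule square_integrable_bound[OF g m, of 1]) (use AE in eventually_elim, simp)
  then show "weak_deriv U is u \<in> l2_space U" using l2_space_iff[OF US] by blast
  show "has_weak_deriv U is u (weak_deriv U is u)"
    unfolding weak_deriv_def by (rule someI[of "has_weak_deriv U is u", OF assms(2)])
  show "l2_norm U (weak_deriv U is u) = l2_norm U g"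
    unfolding l2_norm_eq[OF US] by (rule norm2_cong_AE[OF m square_integrable_measurable[OF g] AE])
qed

section \<open>Riesz representation\<close>

lemma square_integrable_indicator:
  "K \<in> lmeasurable \<Longrightarrow> square_integrable lebesgue (indicat_real K)"
proof -
  assume K: "K \<in> lmeasurable"
  have "(indicat_real K x)\<^sup>2 = indicator K x" for x by (simp add: indicator_def)
  moreover have "integrable lebesgue (indicat_real K)"
    using K by (intro integrable_real_indicator) (auto simp: fmeasurable_def)
  ultimately show ?thesis
    unfolding square_integrable_def by (simp add: borel_measurable_integrable)
qed

lemma zero_ext_measurable:
  fixes f :: "'a::euclidean_space \<Rightarrow> real"
  assumes "f \<in> borel_measurable lebesgue" "W \<in> sets lebesgue"
  shows "zero_ext W f \<in> borel_measurable lebesgue"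
  unfolding zero_ext_def[abs_def]
  by (rule borel_measurable_times[OF borel_measurable_indicator[OF assms(2)] assms(1)])

lemma abs_zero_ext_le: "\<bar>zero_ext W f x\<bar> \<le> \<bar>f x\<bar>"
  by (cases "x \<in> W") (auto simp: zero_ext_def)

lemma square_integrable_zero_ext:
  fixes f :: "'a::euclidean_space \<Rightarrow> real"
  assumes "square_integrable lebesgue f" "W \<in> sets lebesgue"
  shows "square_integrable lebesgue (zero_ext W f)"
  by (rule square_integrable_bound[OF assms(1), of _ 1])
    (auto simp: abs_zero_ext_le zero_ext_measurable square_integrable_measurable assms)

lemma square_integrable_test:
  assumes "\<phi> \<in> test_functions U"
  shows "square_integrable lebesgue \<phi>"
proof -
  obtain K where K: "compact K" "K \<subseteq> U" "\<And>x. x \<notin> K \<Longrightarrow> \<phi> x = 0"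
    using test_functions_support[OF assms] by metis
  obtain B where B: "\<And>x. \<bar>\<phi> x\<bar> \<le> B" using test_functions_bounded[OF assms] by metis
  have "\<bar>\<phi> x\<bar> \<le> B * \<bar>indicat_real K x\<bar>" for x
    using B K(3) by (cases "x \<in> K") auto
  then show ?thesis
    by (intro square_integrable_bound[OF square_integrable_indicator[OF lmeasurable_compact[OF K(1)]],
          of _ B]) (auto simp: smooth_measurable test_functions_smooth[OF assms])
qed

text \<open>The Riesz representation theorem on the closure of the test functions in $L^2$: a minimizing
  sequence of $\|\varphi\|^2 - 2 \ell(\varphi)$ is Cauchy by the parallelogram identity.\<close>

lemma riesz_test_functions:
  fixes l :: "(real^'n \<Rightarrow> real) \<Rightarrow> real"
  assumes U: "U \<in> sets lebesgue" and M: "M \<ge> 0"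
    and add: "\<And>\<phi> \<psi>. \<phi> \<in> test_functions U \<Longrightarrow> \<psi> \<in> test_functions U \<Longrightarrow> l (\<lambda>x. \<phi> x + \<psi> x) = l \<phi> + l \<psi>"
    and scale: "\<And>\<phi> c. \<phi> \<in> test_functions U \<Longrightarrow> l (\<lambda>x. c * \<phi> x) = c * l \<phi>"
    and bound: "\<And>\<phi>. \<phi> \<in> test_functions U \<Longrightarrow> \<bar>l \<phi>\<bar> \<le> M * norm2 lebesgue \<phi>"
  obtains w where "square_integrable lebesgue w" "\<And>x. x \<notin> U \<Longrightarrow> w x = 0" "norm2 lebesgue w \<le> M"
    "\<And>\<phi>. \<phi> \<in> test_functions U \<Longrightarrow> l \<phi> = (LINT x|lebesgue. w x * \<phi> x)"
proof -
  define J where "J \<phi> = (LINT x|lebesgue. (\<phi> x)\<^sup>2) - 2 * l \<phi>" for \<phi>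
  define m where "m = Inf (J ` test_functions U)"
  have "J \<phi> \<ge> - M\<^sup>2" if "\<phi> \<in> test_functions U" for \<phi>
  proof -
    \<comment> \<open>Completing the square bounds the functional from below by -M^2.\<close>
    have "0 \<le> (norm2 lebesgue \<phi> - M)\<^sup>2" by simp
    then have "(norm2 lebesgue \<phi>)\<^sup>2 - 2 * (M * norm2 lebesgue \<phi>) \<ge> - M\<^sup>2"
      by (simp add: power2_diff algebra_simps)
    then show ?thesis using bound[OF that] unfolding J_def norm2_power2 by linarith
  qed
  then have bdd: "bdd_below (J ` test_functions U)" by (meson bdd_belowI2)
  have m: "m \<le> J \<phi>" if "\<phi> \<in> test_functions U" for \<phi>
    unfolding m_def using bdd that by (intro cInf_lower) auto
  have "\<exists>\<phi>\<in>test_functions U. J \<phi> < m + 1 / 4 ^ k" for k :: nat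
  proof -
    have "Inf (J ` test_functions U) < m + 1 / 4 ^ k" by (simp add: m_def)
    then obtain y where "y \<in> J ` test_functions U" "y < m + 1 / 4 ^ k"
      using cInf_lessD[of "J ` test_functions U" "m + 1 / 4 ^ k"] test_functions_zero by blast
    then show ?thesis by blast
  qed
  then obtain f where f: "\<And>k. f k \<in> test_functions U" "\<And>k::nat. J (f k) < m + 1 / 4 ^ k" by metis
  note sf = square_integrable_test[OF f(1)]
  have i2: "integrable lebesgue (\<lambda>x. (f k x)\<^sup>2)" for k using sf by (simp add: square_integrable_def)
  \<comment> \<open>Parallelogram identity: the squared distance of f_j and f_k is 2 J(f_j) + 2
    J(f_k) - 4 J((f_j + f_k) / 2) \<le> 2 / 4^j + 2 / 4^k, hence the constant 4.\<close>
  have "\<exists>w. square_integrable lebesgue w \<and> (\<forall>k. (LINT x|lebesgue. (w x - f k x)\<^sup>2) \<le> 4 / 4 ^ k)"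
  proof (rule square_integrable_complete[OF sf])
    fix j k :: nat assume "k \<le> j"
    have "(1::real) / 4 ^ j \<le> 1 / 4 ^ k" using \<open>k \<le> j\<close> by (intro divide_left_mono power_increasing) auto
    have imul: "integrable lebesgue (\<lambda>x. f j x * f k x)" by (rule square_integrable_mult[OF sf sf])
    define a b c where "a = (LINT x|lebesgue. (f j x)\<^sup>2)" "b = (LINT x|lebesgue. (f k x)\<^sup>2)"
      "c = (LINT x|lebesgue. f j x * f k x)"
    have "m \<le> J (\<lambda>x. (1 / 2) * (f j x + f k x))"
      by (intro m test_functions_scale test_functions_add f)
    also have "\<dots> = (LINT x|lebesgue. ((1 / 2) * (f j x + f k x))\<^sup>2) - (l (f j) + l (f k))"
      by (simp only: J_def scale[OF test_functions_add[OF f(1) f(1)]] add[OF f(1) f(1)]) (simp add: field_simps)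
    also have "(LINT x|lebesgue. ((1 / 2) * (f j x + f k x))\<^sup>2)
        = (LINT x|lebesgue. (1/4) * (f j x)\<^sup>2 + (1/4) * (f k x)\<^sup>2 + (1/2) * (f j x * f k x))"
      by (rule Bochner_Integration.integral_cong) (auto simp: power2_eq_square field_simps)
    also have "\<dots> = a / 4 + b / 4 + c / 2" using i2 imul by (simp add: a_b_c_def)
    finally have 1: "m \<le> a / 4 + b / 4 + c / 2 - (l (f j) + l (f k))" .
    have "(LINT x|lebesgue. (f j x - f k x)\<^sup>2) = (LINT x|lebesgue. (f j x)\<^sup>2 + (f k x)\<^sup>2 - 2 * (f j x * f k x))"
      by (rule Bochner_Integration.integral_cong) (auto simp: power2_eq_square algebra_simps)
    also have "\<dots> = a + b - 2 * c" using i2 imul by (simp add: a_b_c_def)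
    finally have 2: "(LINT x|lebesgue. (f j x - f k x)\<^sup>2) = a + b - 2 * c" .
    have 3: "a - 2 * l (f j) < m + 1 / 4 ^ j" "b - 2 * l (f k) < m + 1 / 4 ^ k"
      using f(2)[of j] f(2)[of k] by (simp_all add: J_def a_b_c_def)
    show "(LINT x|lebesgue. (f j x - f k x)\<^sup>2) \<le> 4 / 4 ^ k"
    proof -
      have "(4::real) / 4 ^ k = 4 * (1 / 4 ^ k)" by simp
      then show ?thesis using 1 2 3 \<open>(1::real) / 4 ^ j \<le> 1 / 4 ^ k\<close> by linarith
    qed
  qed
  then obtain v where v: "square_integrable lebesgue v" "\<And>k. (LINT x|lebesgue. (v x - f k x)\<^sup>2) \<le> 4 / 4 ^ k" by blast
  \<comment> \<open>Restricting the limit to \<open>U\<close> does not increase its distance to the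
    functions \<open>f k\<close>, which vanish off \<open>U\<close> themselves.\<close>
  define w where "w x = indicator U x * v x" for x
  have sw: "square_integrable lebesgue w"
    unfolding w_def using square_integrable_zero_ext[OF v(1) U] by (simp add: zero_ext_def[abs_def])
  have swf: "square_integrable lebesgue (\<lambda>x. w x - f k x)" for k by (rule square_integrable_diff[OF sw sf])
  have nwf: "norm2 lebesgue (\<lambda>x. w x - f k x) \<le> 2 * (1/2) ^ k" for k
  proof -
    have "norm2 lebesgue (\<lambda>x. w x - f k x) \<le> norm2 lebesgue (\<lambda>x. v x - f k x)"
      by (rule norm2_mono[OF square_integrable_diff[OF v(1) sf]])
        (auto simp: w_def indicator_def test_functions_outside[OF f(1)])
    also have "\<dots> \<le> 2 * (1/2) ^ k"
    proof (subst norm2_le_iff)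
      have "(4::real) ^ k = (2 ^ k)\<^sup>2" by (simp add: power2_eq_square flip: power_mult_distrib)
      then show "(LINT x|lebesgue. (v x - f k x)\<^sup>2) \<le> (2 * (1/2) ^ k)\<^sup>2"
        using v(2)[of k] by (simp add: power_mult_distrib power_divide)
    qed simp
    finally show ?thesis .
  qed
  have lim: "(\<lambda>k. LINT x|lebesgue. f k x * \<psi> x) \<longlonglongrightarrow> (LINT x|lebesgue. w x * \<psi> x)"
    if "square_integrable lebesgue \<psi>" for \<psi>
  proof -
    have b: "\<bar>(LINT x|lebesgue. f k x * \<psi> x) - (LINT x|lebesgue. w x * \<psi> x)\<bar> \<le> 2 * (1/2) ^ k * norm2 lebesgue \<psi>" for k
    proof -
      have "(LINT x|lebesgue. w x * \<psi> x) - (LINT x|lebesgue. f k x * \<psi> x) = (LINT x|lebesgue. (w x - f k x) * \<psi> x)"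
        using square_integrable_mult[OF sw that] square_integrable_mult[OF sf that] by (simp add: algebra_simps)
      also have "\<bar>\<dots>\<bar> \<le> norm2 lebesgue (\<lambda>x. w x - f k x) * norm2 lebesgue \<psi>"
        by (rule Cauchy_Schwarz_norm2[OF swf that])
      also have "\<dots> \<le> 2 * (1/2) ^ k * norm2 lebesgue \<psi>"
        by (rule mult_right_mono[OF nwf norm2_nonneg])
      finally show ?thesis by (simp add: abs_minus_commute)
    qed
    have "(\<lambda>k. 2 * (1/2) ^ k * norm2 lebesgue \<psi>) \<longlonglongrightarrow> 2 * 0 * norm2 lebesgue \<psi>"
      by (intro tendsto_mult tendsto_const LIMSEQ_realpow_zero) auto
    then have z: "(\<lambda>k. 2 * (1/2) ^ k * norm2 lebesgue \<psi>) \<longlonglongrightarrow> 0" by simp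
    have "(\<lambda>k. (LINT x|lebesgue. f k x * \<psi> x) - (LINT x|lebesgue. w x * \<psi> x)) \<longlonglongrightarrow> 0"
    proof (rule Lim_null_comparison[OF _ z], rule always_eventually, rule allI)
      show "norm ((LINT x|lebesgue. f k x * \<psi> x) - (LINT x|lebesgue. w x * \<psi> x)) \<le> 2 * (1/2) ^ k * norm2 lebesgue \<psi>" for k
        unfolding real_norm_def by (rule b)
    qed
    then show ?thesis by (simp add: LIM_zero_iff)
  qed
  have rep: "l \<phi> = (LINT x|lebesgue. w x * \<phi> x)" if \<phi>: "\<phi> \<in> test_functions U" for \<phi>
  proof -
    note s\<phi> = square_integrable_test[OF \<phi>]
    define A B where "A = (LINT x|lebesgue. w x * \<phi> x) - l \<phi>" and "B = (LINT x|lebesgue. (\<phi> x)\<^sup>2)"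
    have "0 \<le> 2 * t * A + t\<^sup>2 * B" for t
    proof -
      \<comment> \<open>First variation: m \<le> J(f_k + t \<phi>) while J(f_k) < m + 4^-k, and the
        error disappears as k grows.\<close>
      have ineq: "- ((1/4) ^ k) \<le> 2 * t * ((LINT x|lebesgue. f k x * \<phi> x) - l \<phi>) + t\<^sup>2 * B" for k
      proof -
        have "m \<le> J (\<lambda>x. f k x + t * \<phi> x)"
          by (intro m test_functions_add test_functions_scale f \<phi>)
        also have "\<dots> = (LINT x|lebesgue. (f k x + t * \<phi> x)\<^sup>2) - 2 * (l (f k) + t * l \<phi>)"
          by (simp only: J_def add[OF f(1) test_functions_scale[OF \<phi>]] scale[OF \<phi>])
        also have "(LINT x|lebesgue. (f k x + t * \<phi> x)\<^sup>2)
            = (LINT x|lebesgue. (f k x)\<^sup>2 + 2 * t * (f k x * \<phi> x) + t\<^sup>2 * (\<phi> x)\<^sup>2)"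
          by (rule Bochner_Integration.integral_cong) (auto simp: power2_eq_square algebra_simps)
        also have "\<dots> = (LINT x|lebesgue. (f k x)\<^sup>2) + 2 * t * (LINT x|lebesgue. f k x * \<phi> x) + t\<^sup>2 * B"
          using i2 s\<phi> square_integrable_mult[OF sf s\<phi>] by (simp add: B_def square_integrable_def)
        finally show ?thesis using f(2)[of k] by (simp add: J_def power_one_over algebra_simps)
      qed
      have "(\<lambda>k. - ((1/4) ^ k)) \<longlonglongrightarrow> - (0::real)"
        by (intro tendsto_minus LIMSEQ_realpow_zero) auto
      moreover have "(\<lambda>k. 2 * t * ((LINT x|lebesgue. f k x * \<phi> x) - l \<phi>) + t\<^sup>2 * B) \<longlonglongrightarrow> 2 * t * A + t\<^sup>2 * B"
        unfolding A_def by (intro tendsto_intros lim s\<phi>)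
      ultimately have "- 0 \<le> 2 * t * A + t\<^sup>2 * B"
        by (rule LIMSEQ_le) (use ineq in blast)
      then show ?thesis by simp
    qed
    moreover have "B \<ge> 0" by (simp add: B_def)
    ultimately have "A = 0"
    proof -
      assume q: "\<And>t. 0 \<le> 2 * t * A + t\<^sup>2 * B" and B: "B \<ge> 0"
      \<comment> \<open>The value t = -A / (B + 1) forces A = 0; the 1 avoids division by zero when
        B = 0.\<close>
      define r where "r = A / (B + 1)"
      have A: "A = r * (B + 1)" using B by (simp add: r_def)
      have "0 \<le> 2 * (- r) * A + (- r)\<^sup>2 * B" by (rule q)
      also have "\<dots> = - (r\<^sup>2 * (B + 2))"
        unfolding A by (simp add: power2_eq_square algebra_simps)
      finally have "r\<^sup>2 * (B + 2) \<le> 0" by simp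
      moreover have "r\<^sup>2 * (B + 2) > 0" if "r \<noteq> 0" using that B by (intro mult_pos_pos) auto
      ultimately have "r = 0" by fastforce
      then show ?thesis by (simp add: A)
    qed
    then show ?thesis by (simp add: A_def)
  qed
  \<comment> \<open>\<open>w\<close> need not be a test function, so the bound on \<open>l\<close>
    is applied to \<open>f k\<close>; in the limit it becomes N^2 \<le> M N.\<close>
  have nw: "norm2 lebesgue w \<le> M"
  proof -
    define N where "N = norm2 lebesgue w"
    have l1: "(\<lambda>k. LINT x|lebesgue. f k x * w x) \<longlonglongrightarrow> N\<^sup>2"
      using lim[OF sw] unfolding N_def norm2_power2 by (simp add: power2_eq_square)
    have e0: "(\<lambda>k. (norm2 lebesgue (\<lambda>x. w x - f k x))\<^sup>2) \<longlonglongrightarrow> 0"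
    proof -
      have "(\<lambda>k. 2 * (1/2) ^ k) \<longlonglongrightarrow> 2 * (0::real)"
        by (intro tendsto_mult tendsto_const LIMSEQ_realpow_zero) auto
      then have z: "(\<lambda>k. 2 * (1/2) ^ k) \<longlonglongrightarrow> (0::real)" by simp
      have "(\<lambda>k. norm2 lebesgue (\<lambda>x. w x - f k x)) \<longlonglongrightarrow> 0"
      proof (rule Lim_null_comparison[OF _ z], rule always_eventually, rule allI)
        show "norm (norm2 lebesgue (\<lambda>x. w x - f k x)) \<le> 2 * (1/2) ^ k" for k
          using nwf[of k] norm2_nonneg[of lebesgue "\<lambda>x. w x - f k x"] by simp
      qed
      from tendsto_power[OF this, of 2] show ?thesis by simp
    qed
    have "(LINT x|lebesgue. (f k x)\<^sup>2) = (norm2 lebesgue (\<lambda>x. w x - f k x))\<^sup>2 - N\<^sup>2 + 2 * (LINT x|lebesgue. f k x * w x)" for k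
    proof -
      have "(norm2 lebesgue (\<lambda>x. w x - f k x))\<^sup>2 = (LINT x|lebesgue. (w x)\<^sup>2 + (f k x)\<^sup>2 - 2 * (f k x * w x))"
        unfolding norm2_power2
        by (rule Bochner_Integration.integral_cong) (auto simp: power2_eq_square algebra_simps)
      also have "\<dots> = N\<^sup>2 + (LINT x|lebesgue. (f k x)\<^sup>2) - 2 * (LINT x|lebesgue. f k x * w x)"
        using i2 sw square_integrable_mult[OF sf sw] by (simp add: N_def norm2_power2 square_integrable_def)
      finally show ?thesis by simp
    qed
    then have "(\<lambda>k. LINT x|lebesgue. (f k x)\<^sup>2) \<longlonglongrightarrow> 0 - N\<^sup>2 + 2 * N\<^sup>2"
      by (simp only:) (intro tendsto_intros e0 l1)
    then have "(\<lambda>k. M * sqrt (LINT x|lebesgue. (f k x)\<^sup>2)) \<longlonglongrightarrow> M * sqrt (0 - N\<^sup>2 + 2 * N\<^sup>2)"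
      by (intro tendsto_intros)
    then have l2: "(\<lambda>k. M * norm2 lebesgue (f k)) \<longlonglongrightarrow> M * N"
      by (simp add: norm2_def N_def)
    have "(LINT x|lebesgue. f k x * w x) \<le> M * norm2 lebesgue (f k)" for k
      using rep[OF f(1)[of k]] bound[OF f(1)[of k]] by (simp add: mult.commute)
    then have "N\<^sup>2 \<le> M * N" using LIMSEQ_le[OF l1 l2] by blast
    moreover have "N \<ge> 0" by (simp add: N_def norm2_nonneg)
    ultimately have "N \<le> M" using M by (cases "N = 0") (auto simp: power2_eq_square)
    then show ?thesis by (simp add: N_def)
  qed
  have "w x = 0" if "x \<notin> U" for x using that by (simp add: w_def)
  from that[OF sw this nw rep] show ?thesis by blast
qed

text \<open>Riesz represents \<phi> \<mapsto> \<integral> f \<phi> by some \<open>w\<close> of norm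
  at most \<open>M\<close>, and the fundamental lemma identifies \<open>w\<close> with
  \<open>f\<close> on \<open>W\<close>. This takes the place of the density of test functions in
  L^2.\<close>

lemma norm2_le_by_duality:
  fixes f :: "real^'n \<Rightarrow> real"
  assumes W: "open W" and M: "M \<ge> 0" and f: "square_integrable lebesgue f"
    and bound: "\<And>\<phi>. \<phi> \<in> test_functions W \<Longrightarrow> \<bar>LINT x|lebesgue. f x * \<phi> x\<bar> \<le> M * norm2 lebesgue \<phi>"
  shows "norm2 lebesgue (zero_ext W f) \<le> M"
proof -
  have WS: "W \<in> sets lebesgue" using W by simp
  have i: "integrable lebesgue (\<lambda>x. f x * \<phi> x)" if "\<phi> \<in> test_functions W" for \<phi>
    by (rule square_integrable_mult[OF f square_integrable_test[OF that]])
  obtain w where w: "square_integrable lebesgue w" "\<And>x. x \<notin> W \<Longrightarrow> w x = 0" "norm2 lebesgue w \<le> M"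
    "\<And>\<phi>. \<phi> \<in> test_functions W \<Longrightarrow> (LINT x|lebesgue. f x * \<phi> x) = (LINT x|lebesgue. w x * \<phi> x)"
    by (rule riesz_test_functions[OF WS M, of "\<lambda>\<phi>. LINT x|lebesgue. f x * \<phi> x"])
      (use i bound in \<open>auto simp: distrib_left mult.left_commute\<close>)
  have sfw: "square_integrable lebesgue (\<lambda>x. f x - w x)" by (rule square_integrable_diff[OF f w(1)])
  have "(\<lambda>x. f x - w x) \<in> l2_space W"
    unfolding l2_space_iff[OF WS] by (rule square_integrable_zero_ext[OF sfw WS])
  then have "AE x in lebesgue_on W. f x - w x = 0"
  proof (intro fundamental_lemma_calculus_of_variations[OF W] l2_space_locally_integrable[OF WS])
    fix \<phi> assume \<phi>: "\<phi> \<in> test_functions W"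
    have "(LINT x|lebesgue_on W. (f x - w x) * \<phi> x) = (LINT x|lebesgue. f x * \<phi> x - w x * \<phi> x)"
      unfolding integral_lebesgue_on_eq[OF WS]
    proof (rule Bochner_Integration.integral_cong)
      fix x show "indicator W x * ((f x - w x) * \<phi> x) = f x * \<phi> x - w x * \<phi> x"
        using test_functions_outside[OF \<phi>, of x] by (cases "x \<in> W") (simp_all add: left_diff_distrib)
    qed simp
    also have "\<dots> = 0"
      using w(4)[OF \<phi>] i[OF \<phi>] square_integrable_mult[OF w(1) square_integrable_test[OF \<phi>]] by simp
    finally show "(LINT x|lebesgue_on W. (f x - w x) * \<phi> x) = 0" .
  qed
  then have AE: "AE x in lebesgue. w x = zero_ext W f x"
    unfolding AE_lebesgue_on_iff[OF WS] by eventually_elim (use w(2) in \<open>auto simp: zero_ext_def indicator_def\<close>)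
  note mw = square_integrable_measurable[OF w(1)]
  show ?thesis using norm2_cong_AE[OF mw borel_measurable_AE[OF mw AE] AE] w(3) by simp
qed

section \<open>Difference quotients\<close>

lemma test_functions_shift_UNIV:
  "\<phi> \<in> test_functions W \<Longrightarrow> (\<lambda>x. \<phi> (x + \<tau>)) \<in> test_functions UNIV"
  by (rule test_functions_shift[of _ W]) auto

text \<open>Two mean value inequalities along the line through \<open>x\<close>. Bounding the
  increment of the derivative by B |s| on the whole segment gives B rather than B/2; what matters is
  the quadratic order in \<open>s\<close>.\<close>

lemma test_function_taylor_bound:
  assumes \<phi>: "\<phi> \<in> test_functions U" and B: "\<And>x. \<bar>partial_deriv i (partial_deriv i \<phi>) x\<bar> \<le> B"
  shows "\<bar>\<phi> (x + s *\<^sub>R axis i 1) - \<phi> x - s * partial_deriv i \<phi> x\<bar> \<le> B * s\<^sup>2"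
proof -
  let ?e = "axis i 1 :: real^'a"
  have B0: "B \<ge> 0" using B[of x] by linarith
  note d1 = partial_deriv_directional[OF smooth_differentiable[OF test_functions_smooth[OF \<phi>]]]
  note d2 = partial_deriv_directional[OF smooth_differentiable[OF test_functions_smooth[OF test_functions_partial_deriv[OF \<phi>]]]]
  have 1: "\<bar>partial_deriv i \<phi> (x + \<sigma> *\<^sub>R ?e) - partial_deriv i \<phi> (x + 0 *\<^sub>R ?e)\<bar> \<le> B * \<bar>\<sigma> - 0\<bar>" for \<sigma>
    using field_differentiable_bound[where S = UNIV and f = "\<lambda>\<sigma>. partial_deriv i \<phi> (x + \<sigma> *\<^sub>R ?e)"
        and f' = "\<lambda>\<sigma>. partial_deriv i (partial_deriv i \<phi>) (x + \<sigma> *\<^sub>R ?e)" and B = B and x = \<sigma> and y = 0] d2 B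
    by simp
  define r where "r \<sigma> = \<phi> (x + \<sigma> *\<^sub>R ?e) - \<sigma> * partial_deriv i \<phi> x" for \<sigma>
  have "norm (r s - r 0) \<le> B * \<bar>s\<bar> * norm (s - 0)"
  proof (rule field_differentiable_bound[where S = "closed_segment 0 s"])
    show "(r has_real_derivative partial_deriv i \<phi> (x + \<sigma> *\<^sub>R ?e) - partial_deriv i \<phi> x)
        (at \<sigma> within closed_segment 0 s)" if "\<sigma> \<in> closed_segment 0 s" for \<sigma>
      unfolding r_def
      by (rule derivative_eq_intros DERIV_subset[OF d1] refl subset_UNIV)+ simp
    show "norm (partial_deriv i \<phi> (x + \<sigma> *\<^sub>R ?e) - partial_deriv i \<phi> x) \<le> B * \<bar>s\<bar>"
      if "\<sigma> \<in> closed_segment 0 s" for \<sigma>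
    proof -
      have "\<bar>\<sigma>\<bar> \<le> \<bar>s\<bar>" using that by (auto simp: closed_segment_eq_real_ivl split: if_splits)
      then have "B * \<bar>\<sigma>\<bar> \<le> B * \<bar>s\<bar>" using B0 by (rule mult_left_mono)
      then show ?thesis using 1[of \<sigma>] by simp
    qed
  qed auto
  then show ?thesis by (simp add: r_def power2_eq_square abs_mult_self_eq mult.assoc algebra_simps)
qed

text \<open>Translating the test function instead of the $L^2$ function makes difference quotients
  differentiable in the step size.\<close>

lemma has_derivative_pairing_translation:
  fixes u :: "real^'n \<Rightarrow> real"
  assumes u: "square_integrable lebesgue u" and \<phi>: "\<phi> \<in> test_functions W"
  shows "((\<lambda>t. LINT x|lebesgue. u x * \<phi> (x + t *\<^sub>R axis i 1)) has_real_derivative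
    (LINT x|lebesgue. u x * partial_deriv i \<phi> (x + t *\<^sub>R axis i 1))) (at t)"
proof -
  let ?e = "axis i 1 :: real^'n"
  define F where "F t = (LINT x|lebesgue. u x * \<phi> (x + t *\<^sub>R ?e))" for t
  define F' where "F' t = (LINT x|lebesgue. u x * partial_deriv i \<phi> (x + t *\<^sub>R ?e))" for t
  obtain B where B: "\<And>x. \<bar>partial_deriv i (partial_deriv i \<phi>) x\<bar> \<le> B" "B > 0"
    using test_functions_bounded[OF test_functions_partial_deriv[OF test_functions_partial_deriv[OF \<phi>]]] by metis
  obtain K where K: "compact K" "\<And>x. x \<notin> K \<Longrightarrow> \<phi> x = 0" "\<And>x i. x \<notin> K \<Longrightarrow> partial_deriv i \<phi> x = 0"
    using test_functions_support[OF \<phi>] by metis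
  obtain R where R: "\<And>x. x \<in> K \<Longrightarrow> norm x \<le> R"
    using compact_imp_bounded[OF K(1)] bounded_iff by metis
  \<comment> \<open>This ball contains every point that a shift of length at most |t| + 1 carries
    into the support, so the Taylor remainder vanishes outside it. It has finite measure, so
    \<open>u\<close> is integrable on it.\<close>
  define L where "L = cball (0::real^'n) (R + \<bar>t\<bar> + 1)"
  have iL: "integrable lebesgue (\<lambda>x. \<bar>u x\<bar> * indicator L x)"
  proof -
    have "square_integrable lebesgue (indicat_real L)"
      unfolding L_def by (rule square_integrable_indicator) simp
    from integrable_abs[OF square_integrable_mult[OF u this]] show ?thesis by (simp add: abs_mult)
  qed
  define A where "A = (LINT x|lebesgue. \<bar>u x\<bar> * indicator L x)"
  have i1: "integrable lebesgue (\<lambda>x. u x * \<phi> (x + \<tau>))" for \<tau>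
    by (rule square_integrable_mult[OF u square_integrable_test[OF test_functions_shift_UNIV[OF \<phi>]]])
  have i2: "integrable lebesgue (\<lambda>x. u x * partial_deriv i \<phi> (x + \<tau>))" for \<tau>
    by (rule square_integrable_mult[OF u square_integrable_test[OF
            test_functions_shift_UNIV[OF test_functions_partial_deriv[OF \<phi>]]]])
  have key: "\<bar>F (t + s) - F t - s * F' t\<bar> \<le> (B * s\<^sup>2) * A" if s: "\<bar>s\<bar> \<le> 1" for s
  proof -
    define r where "r x = \<phi> (x + (t + s) *\<^sub>R ?e) - \<phi> (x + t *\<^sub>R ?e) - s * partial_deriv i \<phi> (x + t *\<^sub>R ?e)" for x
    have ur: "u x * r x = u x * \<phi> (x + (t + s) *\<^sub>R ?e) - u x * \<phi> (x + t *\<^sub>R ?e) - s * (u x * partial_deriv i \<phi> (x + t *\<^sub>R ?e))" for x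
      by (simp add: r_def algebra_simps)
    have "F (t + s) - F t - s * F' t = (LINT x|lebesgue. u x * r x)"
      unfolding F_def F'_def ur using i1 i2 by simp
    also have "\<bar>\<dots>\<bar> \<le> (LINT x|lebesgue. \<bar>u x * r x\<bar>)" by (rule integral_abs_bound)
    also have "\<dots> \<le> (LINT x|lebesgue. (B * s\<^sup>2) * (\<bar>u x\<bar> * indicator L x))"
    proof (rule integral_mono)
      show "integrable lebesgue (\<lambda>x. \<bar>u x * r x\<bar>)"
        unfolding ur by (intro integrable_abs Bochner_Integration.integrable_diff integrable_mult_right i1 i2)
      show "integrable lebesgue (\<lambda>x. (B * s\<^sup>2) * (\<bar>u x\<bar> * indicator L x))" using iL by simp
      fix x
      show "\<bar>u x * r x\<bar> \<le> (B * s\<^sup>2) * (\<bar>u x\<bar> * indicator L x)"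
      proof (cases "x \<in> L")
        case True
        have "\<bar>r x\<bar> \<le> B * s\<^sup>2"
          using test_function_taylor_bound[OF \<phi> B(1), of "x + t *\<^sub>R ?e" s]
          by (simp add: r_def scaleR_add_left add.assoc)
        from mult_left_mono[OF this, of "\<bar>u x\<bar>"] show ?thesis using True by (simp add: abs_mult mult.commute)
      next
        case False
        have far: "x + \<sigma> *\<^sub>R ?e \<notin> K" if "\<bar>\<sigma>\<bar> \<le> \<bar>t\<bar> + 1" for \<sigma>
        proof
          assume "x + \<sigma> *\<^sub>R ?e \<in> K"
          then have "norm (x + \<sigma> *\<^sub>R ?e) \<le> R" by (rule R)
          moreover have "norm x \<le> norm (x + \<sigma> *\<^sub>R ?e) + norm (\<sigma> *\<^sub>R ?e)"
            using norm_triangle_ineq4[of "x + \<sigma> *\<^sub>R ?e" "\<sigma> *\<^sub>R ?e"] by simp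
          ultimately have "norm x \<le> R + \<bar>t\<bar> + 1" using that by simp
          then show False using False by (simp add: L_def)
        qed
        have "r x = 0"
          unfolding r_def using s by (simp add: K(2,3)[OF far])
        then show ?thesis using False by simp
      qed
    qed
    also have "\<dots> = (B * s\<^sup>2) * A" by (simp add: A_def)
    finally show ?thesis .
  qed
  have "(\<lambda>s. (F (t + s) - F t) / s - F' t) \<midarrow>0\<rightarrow> 0"
  proof (rule Lim_null_comparison)
    have "norm ((F (t + s) - F t) / s - F' t) \<le> B * \<bar>s\<bar> * A" if "s \<noteq> 0" "\<bar>s\<bar> < 1" for s
    proof -
      have "(F (t + s) - F t) / s - F' t = (F (t + s) - F t - s * F' t) / s" using that by (simp add: field_simps)
      then have "norm ((F (t + s) - F t) / s - F' t) = \<bar>F (t + s) - F t - s * F' t\<bar> / \<bar>s\<bar>" by simp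
      also have "\<dots> \<le> (B * s\<^sup>2) * A / \<bar>s\<bar>"
        by (rule divide_right_mono[OF key]) (use that in auto)
      also have "\<dots> = B * \<bar>s\<bar> * A" using that by (simp add: power2_eq_square field_simps abs_if)
      finally show ?thesis .
    qed
    then show "\<forall>\<^sub>F s in at 0. norm ((F (t + s) - F t) / s - F' t) \<le> B * \<bar>s\<bar> * A"
      unfolding eventually_at by (intro exI[of _ 1]) (auto simp: dist_real_def)
    have "(\<lambda>s::real. B * \<bar>s\<bar> * A) \<midarrow>0\<rightarrow> B * \<bar>0\<bar> * A" by (intro tendsto_intros)
    then show "(\<lambda>s::real. B * \<bar>s\<bar> * A) \<midarrow>0\<rightarrow> 0" by simp
  qed
  then have "(F has_real_derivative F' t) (at t)" by (simp add: DERIV_def LIM_zero_iff)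
  then show ?thesis by (simp only: F_def[abs_def] F'_def)
qed

text \<open>Summation by parts: translation invariance moves the shift to the other factor, with the
  opposite sign.\<close>

lemma pairing_difference_quotient:
  fixes u :: "real^'n \<Rightarrow> real"
  assumes u: "square_integrable lebesgue u" and \<phi>: "square_integrable lebesgue \<phi>"
  shows "(LINT x|lebesgue. (u (x + \<tau>) - u x) / h * \<phi> x) =
    ((LINT x|lebesgue. u x * \<phi> (x - \<tau>)) - (LINT x|lebesgue. u x * \<phi> x)) / h"
proof -
  note i = square_integrable_mult[OF square_integrable_translation[OF u] \<phi>] square_integrable_mult[OF u \<phi>]
  note i' = square_integrable_mult[OF u square_integrable_translation[OF \<phi>, of "- \<tau>"]]
  have "(LINT x|lebesgue. u (x + \<tau>) * \<phi> x) = (LINT x|lebesgue. u x * \<phi> (x - \<tau>))"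
    using integral_lebesgue_translation[OF borel_measurable_integrable[OF i'], of \<tau>] by simp
  moreover have "(LINT x|lebesgue. (u (x + \<tau>) - u x) / h * \<phi> x) = (LINT x|lebesgue. (u (x + \<tau>) * \<phi> x - u x * \<phi> x) / h)"
    by (rule Bochner_Integration.integral_cong) (auto simp: algebra_simps diff_divide_distrib)
  ultimately show ?thesis using i by simp
qed

text \<open>For a test function on \<open>W\<close> the pairing with the quotient is (F(-h) - F(0))
  / h, and F'(t) is minus the pairing of \<open>g\<close> with a translate of \<phi>, which
  Cauchy-Schwarz bounds uniformly in t. \<open>seg\<close> keeps these translates inside
  \<open>U\<close>.\<close>

lemma difference_quotient_norm_le:
  fixes u g :: "real^'n \<Rightarrow> real"
  assumes W: "open W" and u: "square_integrable lebesgue u" and g: "square_integrable lebesgue g"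
    and weak: "\<And>\<phi>. \<phi> \<in> test_functions U \<Longrightarrow>
      (LINT x|lebesgue. u x * partial_deriv i \<phi> x) = - (LINT x|lebesgue. g x * \<phi> x)"
    and h: "h \<noteq> 0" and seg: "\<And>x t. x \<in> W \<Longrightarrow> t \<in> closed_segment 0 h \<Longrightarrow> x + t *\<^sub>R axis i 1 \<in> U"
  shows "norm2 lebesgue (zero_ext W (\<lambda>x. (u (x + h *\<^sub>R axis i 1) - u x) / h)) \<le> norm2 lebesgue g"
proof (rule norm2_le_by_duality[OF W norm2_nonneg])
  let ?e = "axis i 1 :: real^'n"
  show "square_integrable lebesgue (\<lambda>x. (u (x + h *\<^sub>R ?e) - u x) / h)"
    using square_integrable_scale[OF square_integrable_diff[OF square_integrable_translation[OF u, of "h *\<^sub>R ?e"] u], of "1 / h"]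
    by simp
  fix \<phi> assume \<phi>: "\<phi> \<in> test_functions W"
  define F where "F t = (LINT x|lebesgue. u x * \<phi> (x + t *\<^sub>R ?e))" for t
  define F' where "F' t = (LINT x|lebesgue. u x * partial_deriv i \<phi> (x + t *\<^sub>R ?e))" for t
  have d: "(F has_real_derivative F' t) (at t)" for t
    unfolding F_def[abs_def] F'_def by (rule has_derivative_pairing_translation[OF u \<phi>])
  have bd: "norm (F' t) \<le> norm2 lebesgue g * norm2 lebesgue \<phi>" if "t \<in> closed_segment 0 (- h)" for t
  proof -
    have "- t \<in> closed_segment 0 h"
      using that by (auto simp: closed_segment_eq_real_ivl split: if_splits)
    then have shift: "(\<lambda>x. \<phi> (x + t *\<^sub>R ?e)) \<in> test_functions U"
      using test_functions_shift[OF \<phi>, of "t *\<^sub>R ?e" U] seg[of _ "- t"] by simp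
    have "F' t = - (LINT x|lebesgue. g x * \<phi> (x + t *\<^sub>R ?e))"
      using weak[OF shift] by (simp add: F'_def partial_deriv_shift[OF test_functions_smooth[OF \<phi>]])
    also have "norm \<dots> \<le> norm2 lebesgue g * norm2 lebesgue (\<lambda>x. \<phi> (x + t *\<^sub>R ?e))"
      using Cauchy_Schwarz_norm2[OF g square_integrable_test[OF shift]] by simp
    also have "norm2 lebesgue (\<lambda>x. \<phi> (x + t *\<^sub>R ?e)) = norm2 lebesgue \<phi>"
      by (rule norm2_translation[OF square_integrable_measurable[OF square_integrable_test[OF \<phi>]]])
    finally show ?thesis .
  qed
  have "norm (F (- h) - F 0) \<le> norm2 lebesgue g * norm2 lebesgue \<phi> * norm (- h - 0)"
    by (rule field_differentiable_bound[where S = "closed_segment 0 (- h)" and f' = F'])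
      (use d bd in \<open>auto intro: has_field_derivative_at_within\<close>)
  moreover have "(LINT x|lebesgue. (u (x + h *\<^sub>R ?e) - u x) / h * \<phi> x) = (F (- h) - F 0) / h"
    unfolding pairing_difference_quotient[OF u square_integrable_test[OF \<phi>]] by (simp add: F_def)
  ultimately show "\<bar>LINT x|lebesgue. (u (x + h *\<^sub>R ?e) - u x) / h * \<phi> x\<bar> \<le> norm2 lebesgue g * norm2 lebesgue \<phi>"
    using h by (simp add: field_simps)
qed

text \<open>The pairing of \<open>g\<close> with the derivative of a test function is a limit of
  pairings of difference quotients, so it inherits the bound \<open>M\<close>, and Riesz turns it
  into a function. This takes the place of a weakly convergent subsequence.\<close>

lemma weak_deriv_from_difference_quotients:
  fixes g :: "real^'n \<Rightarrow> real"
  assumes V: "V \<in> sets lebesgue" and g: "square_integrable lebesgue g" and M: "M \<ge> 0" and \<delta>: "\<delta> > 0"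
    and bound: "\<And>h. h \<noteq> 0 \<Longrightarrow> \<bar>h\<bar> < \<delta> \<Longrightarrow>
      norm2 lebesgue (zero_ext V (\<lambda>x. (g (x + h *\<^sub>R axis i 1) - g x) / h)) \<le> M"
  obtains w where "square_integrable lebesgue w" "\<And>x. x \<notin> V \<Longrightarrow> w x = 0" "norm2 lebesgue w \<le> M"
    "\<And>\<phi>. \<phi> \<in> test_functions V \<Longrightarrow>
      (LINT x|lebesgue. g x * partial_deriv i \<phi> x) = - (LINT x|lebesgue. w x * \<phi> x)"
proof -
  let ?e = "axis i 1 :: real^'n"
  define l where "l \<phi> = - (LINT x|lebesgue. g x * partial_deriv i \<phi> x)" for \<phi>
  have ig: "integrable lebesgue (\<lambda>x. g x * partial_deriv i \<phi> x)" if "\<phi> \<in> test_functions V" for \<phi>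
    by (rule square_integrable_mult[OF g square_integrable_test[OF test_functions_partial_deriv[OF that]]])
  have l_bound: "\<bar>l \<phi>\<bar> \<le> M * norm2 lebesgue \<phi>" if \<phi>: "\<phi> \<in> test_functions V" for \<phi>
  proof -
    define F where "F t = (LINT x|lebesgue. g x * \<phi> (x + t *\<^sub>R ?e))" for t
    have "(F has_real_derivative (LINT x|lebesgue. g x * partial_deriv i \<phi> (x + 0 *\<^sub>R ?e))) (at 0)"
      unfolding F_def[abs_def] by (rule has_derivative_pairing_translation[OF g \<phi>])
    then have "(\<lambda>s. (F (0 + s) - F 0) / s) \<midarrow>0\<rightarrow> - l \<phi>" by (simp add: DERIV_def l_def)
    then have lim: "(\<lambda>s. \<bar>(F s - F 0) / s\<bar>) \<midarrow>0\<rightarrow> \<bar>- l \<phi>\<bar>" by (intro tendsto_rabs) simp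
    have "\<bar>(F s - F 0) / s\<bar> \<le> M * norm2 lebesgue \<phi>" if "s \<noteq> 0" "\<bar>s\<bar> < \<delta>" for s
    proof -
      \<comment> \<open>The step is - s because shifting \<phi> by s amounts to shifting
        \<open>g\<close> by - s.\<close>
      define q where "q x = (g (x + (- s) *\<^sub>R ?e) - g x) / (- s)" for x
      have sq: "square_integrable lebesgue q"
        unfolding q_def
        using square_integrable_scale[OF square_integrable_diff[OF square_integrable_translation[OF g, of "(- s) *\<^sub>R ?e"] g], of "1 / (- s)"]
        by simp
      have "(LINT x|lebesgue. q x * \<phi> x) = (F s - F 0) / (- s)"
        unfolding q_def pairing_difference_quotient[OF g square_integrable_test[OF \<phi>]] by (simp add: F_def)
      moreover have "(LINT x|lebesgue. q x * \<phi> x) = (LINT x|lebesgue. zero_ext V q x * \<phi> x)"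
      proof (rule Bochner_Integration.integral_cong)
        fix x show "q x * \<phi> x = zero_ext V q x * \<phi> x"
          using test_functions_outside[OF \<phi>, of x] by (cases "x \<in> V") (simp_all add: zero_ext_def)
      qed simp
      moreover have "\<bar>LINT x|lebesgue. zero_ext V q x * \<phi> x\<bar> \<le> norm2 lebesgue (zero_ext V q) * norm2 lebesgue \<phi>"
        by (rule Cauchy_Schwarz_norm2[OF square_integrable_zero_ext[OF sq V] square_integrable_test[OF \<phi>]])
      moreover have "norm2 lebesgue (zero_ext V q) * norm2 lebesgue \<phi> \<le> M * norm2 lebesgue \<phi>"
        unfolding q_def[abs_def] by (rule mult_right_mono[OF bound norm2_nonneg]) (use that in auto)
      ultimately show ?thesis by simp
    qed
    then have "\<forall>\<^sub>F s in at 0. \<bar>(F s - F 0) / s\<bar> \<le> M * norm2 lebesgue \<phi>"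
      unfolding eventually_at by (intro exI[of _ \<delta>]) (use \<delta> in \<open>auto simp: dist_real_def\<close>)
    from tendsto_upperbound[OF lim this] show ?thesis by simp
  qed
  show ?thesis
  proof (rule riesz_test_functions[OF V M, of l])
    show "l (\<lambda>x. \<phi> x + \<psi> x) = l \<phi> + l \<psi>" if "\<phi> \<in> test_functions V" "\<psi> \<in> test_functions V" for \<phi> \<psi>
      using ig[OF that(1)] ig[OF that(2)] that[THEN test_functions_smooth]
      by (simp add: l_def partial_deriv_add distrib_left)
    show "l (\<lambda>x. c * \<phi> x) = c * l \<phi>" if "\<phi> \<in> test_functions V" for \<phi> c
      using test_functions_smooth[OF that] by (simp add: l_def partial_deriv_scale mult.left_commute)
    show "\<bar>l \<phi>\<bar> \<le> M * norm2 lebesgue \<phi>" if "\<phi> \<in> test_functions V" for \<phi> by (rule l_bound[OF that])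
  next
    fix w assume w: "square_integrable lebesgue w" "\<And>x. x \<notin> V \<Longrightarrow> w x = 0" "norm2 lebesgue w \<le> M"
      "\<And>\<phi>. \<phi> \<in> test_functions V \<Longrightarrow> l \<phi> = (LINT x|lebesgue. w x * \<phi> x)"
    show ?thesis
    proof (rule that[OF w(1-3)])
      fix \<phi> assume "\<phi> \<in> test_functions V"
      from w(4)[OF this] show "(LINT x|lebesgue. g x * partial_deriv i \<phi> x) = - (LINT x|lebesgue. w x * \<phi> x)"
        by (simp add: l_def)
    qed
  qed
qed

section \<open>Cutoffs and the weak formulation\<close>

text \<open>Both functions are square integrable on the whole space, while the equation is tested in
  \<open>U\<close> only. So they can be translated freely, and the case \<open>UNIV\<close>
  expresses global weak differentiability.\<close>

definition weak_partial :: "(real^'n) set \<Rightarrow> 'n::finite \<Rightarrow> (real^'n \<Rightarrow> real) \<Rightarrow> (real^'n \<Rightarrow> real) \<Rightarrow> bool" where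
  "weak_partial U i u g \<longleftrightarrow> square_integrable lebesgue u \<and> square_integrable lebesgue g \<and>
    (\<forall>\<phi>\<in>test_functions U. (LINT x|lebesgue. u x * partial_deriv i \<phi> x) = - (LINT x|lebesgue. g x * \<phi> x))"

lemma weak_partial_mono: "weak_partial V i u g \<Longrightarrow> U \<subseteq> V \<Longrightarrow> weak_partial U i u g"
  using test_functions_mono[of U V] by (auto simp: weak_partial_def)

lemma zero_ext_mult_test:
  "\<phi> \<in> test_functions U \<Longrightarrow> zero_ext U u x * \<phi> x = u x * \<phi> x"
  using test_functions_outside[of \<phi> U x] by (cases "x \<in> U") (auto simp: zero_ext_def)

lemma weak_partial_scale:
  assumes "weak_partial U i u g"
  shows "weak_partial U i (\<lambda>x. c * u x) (\<lambda>x. c * g x)"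
  using assms by (auto simp: weak_partial_def mult.assoc intro: square_integrable_scale)

lemma weak_partial_diff:
  assumes u: "weak_partial U i u g" and v: "weak_partial U i v h"
  shows "weak_partial U i (\<lambda>x. u x - v x) (\<lambda>x. g x - h x)"
  unfolding weak_partial_def
proof (intro conjI ballI)
  fix \<phi> assume \<phi>: "\<phi> \<in> test_functions U"
  note s = square_integrable_test[OF \<phi>] square_integrable_test[OF test_functions_partial_deriv[OF \<phi>, of i]]
  have sq: "square_integrable lebesgue u" "square_integrable lebesgue g" "square_integrable lebesgue v" "square_integrable lebesgue h"
    using u v by (auto simp: weak_partial_def)
  show "(LINT x|lebesgue. (u x - v x) * partial_deriv i \<phi> x) = - (LINT x|lebesgue. (g x - h x) * \<phi> x)"
    using u v \<phi> square_integrable_mult[OF sq(1) s(2)] square_integrable_mult[OF sq(2) s(1)]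
      square_integrable_mult[OF sq(3) s(2)] square_integrable_mult[OF sq(4) s(1)]
    by (simp add: weak_partial_def left_diff_distrib)
qed (use u v in \<open>auto simp: weak_partial_def intro: square_integrable_diff\<close>)

lemma square_integrable_mult_test:
  assumes u: "square_integrable lebesgue u" and \<zeta>: "\<zeta> \<in> test_functions W"
  shows "square_integrable lebesgue (\<lambda>x. \<zeta> x * u x)"
proof -
  obtain B where B: "\<And>x. \<bar>\<zeta> x\<bar> \<le> B" using test_functions_bounded[OF \<zeta>] by metis
  show ?thesis
  proof (rule square_integrable_bound[OF u, of _ B])
    show "(\<lambda>x. \<zeta> x * u x) \<in> borel_measurable lebesgue"
      by (rule borel_measurable_times[OF smooth_measurable[OF test_functions_smooth[OF \<zeta>]] square_integrable_measurable[OF u]])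
    show "AE x in lebesgue. \<bar>\<zeta> x * u x\<bar> \<le> B * \<bar>u x\<bar>"
      by (rule AE_I2) (simp add: abs_mult mult_right_mono[OF B])
  qed
qed

text \<open>Cutting off a translate by \<open>\<zeta>\<close> extends it by zero without destroying weak differentiability:
  the product of \<open>\<zeta>\<close> with any test function is, after translation, a test function on \<open>U\<close>.\<close>

lemma weak_partial_cutoff_translation:
  assumes u: "weak_partial U i u g" and \<zeta>: "\<zeta> \<in> test_functions W"
    and W: "\<And>x. x \<in> W \<Longrightarrow> x + \<tau> \<in> U"
  shows "weak_partial UNIV i (\<lambda>x. \<zeta> x * u (x + \<tau>)) (\<lambda>x. \<zeta> x * g (x + \<tau>) + partial_deriv i \<zeta> x * u (x + \<tau>))"
proof -
  have su: "square_integrable lebesgue u" and sg: "square_integrable lebesgue g"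
    using u by (auto simp: weak_partial_def)
  note sut = square_integrable_translation[OF su, of \<tau>] and sgt = square_integrable_translation[OF sg, of \<tau>]
  note \<zeta>' = test_functions_partial_deriv[OF \<zeta>, of i]
  show ?thesis
    unfolding weak_partial_def
  proof (intro conjI ballI)
    show "square_integrable lebesgue (\<lambda>x. \<zeta> x * u (x + \<tau>))"
      by (rule square_integrable_mult_test[OF sut \<zeta>])
    show "square_integrable lebesgue (\<lambda>x. \<zeta> x * g (x + \<tau>) + partial_deriv i \<zeta> x * u (x + \<tau>))"
      by (intro square_integrable_add square_integrable_mult_test[OF sut \<zeta>'] square_integrable_mult_test[OF sgt \<zeta>])
    fix \<phi> :: "real^'a \<Rightarrow> real" assume \<phi>: "\<phi> \<in> test_functions UNIV"
    note s\<phi> = test_functions_smooth[OF \<phi>] and s\<zeta> = test_functions_smooth[OF \<zeta>]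
    define \<psi> where "\<psi> x = \<phi> x * \<zeta> x" for x
    have \<psi>: "\<psi> \<in> test_functions W" unfolding \<psi>_def by (rule test_functions_mult[OF \<zeta> s\<phi>])
    define \<omega> where "\<omega> x = \<psi> (x + - \<tau>)" for x
    have \<omega>: "\<omega> \<in> test_functions U"
      unfolding \<omega>_def by (rule test_functions_shift[OF \<psi>]) (simp add: W)
    have d\<omega>: "partial_deriv i \<omega> (x + \<tau>) = \<phi> x * partial_deriv i \<zeta> x + partial_deriv i \<phi> x * \<zeta> x" for x
      unfolding \<omega>_def partial_deriv_shift[OF test_functions_smooth[OF \<psi>]]
      by (simp add: \<psi>_def[abs_def] partial_deriv_mult[OF s\<phi> s\<zeta>])
    have t1: "(LINT x|lebesgue. u (x + \<tau>) * partial_deriv i \<omega> (x + \<tau>)) = (LINT x|lebesgue. u x * partial_deriv i \<omega> x)"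
      by (rule integral_lebesgue_translation[OF borel_measurable_integrable[OF
            square_integrable_mult[OF su square_integrable_test[OF test_functions_partial_deriv[OF \<omega>]]]]])
    have t2: "(LINT x|lebesgue. g (x + \<tau>) * \<omega> (x + \<tau>)) = (LINT x|lebesgue. g x * \<omega> x)"
      by (rule integral_lebesgue_translation[OF borel_measurable_integrable[OF
            square_integrable_mult[OF sg square_integrable_test[OF \<omega>]]]])
    have i1: "integrable lebesgue (\<lambda>x. (\<zeta> x * u (x + \<tau>)) * partial_deriv i \<phi> x)"
      by (rule square_integrable_mult[OF square_integrable_mult_test[OF sut \<zeta>]
            square_integrable_test[OF test_functions_partial_deriv[OF \<phi>]]])
    have i2: "integrable lebesgue (\<lambda>x. (partial_deriv i \<zeta> x * u (x + \<tau>)) * \<phi> x)"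
      by (rule square_integrable_mult[OF square_integrable_mult_test[OF sut \<zeta>'] square_integrable_test[OF \<phi>]])
    have i3: "integrable lebesgue (\<lambda>x. (\<zeta> x * g (x + \<tau>)) * \<phi> x)"
      by (rule square_integrable_mult[OF square_integrable_mult_test[OF sgt \<zeta>] square_integrable_test[OF \<phi>]])
    have "(LINT x|lebesgue. (\<zeta> x * u (x + \<tau>)) * partial_deriv i \<phi> x) + (LINT x|lebesgue. (partial_deriv i \<zeta> x * u (x + \<tau>)) * \<phi> x)
        = (LINT x|lebesgue. u (x + \<tau>) * partial_deriv i \<omega> (x + \<tau>))"
      unfolding Bochner_Integration.integral_add[OF i1 i2, symmetric]
      by (rule Bochner_Integration.integral_cong) (simp_all add: d\<omega> algebra_simps)
    also have "\<dots> = - (LINT x|lebesgue. g (x + \<tau>) * \<omega> (x + \<tau>))"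
      unfolding t1 t2 using u \<omega> by (simp add: weak_partial_def)
    also have "(LINT x|lebesgue. g (x + \<tau>) * \<omega> (x + \<tau>)) = (LINT x|lebesgue. (\<zeta> x * g (x + \<tau>)) * \<phi> x)"
      by (rule Bochner_Integration.integral_cong) (simp_all add: \<omega>_def \<psi>_def mult_ac)
    finally show "(LINT x|lebesgue. \<zeta> x * u (x + \<tau>) * partial_deriv i \<phi> x)
        = - (LINT x|lebesgue. (\<zeta> x * g (x + \<tau>) + partial_deriv i \<zeta> x * u (x + \<tau>)) * \<phi> x)"
      unfolding distrib_right Bochner_Integration.integral_add[OF i3 i2] by simp
  qed
qed

lemma weak_partial_translation:
  assumes u: "weak_partial UNIV i u g"
  shows "weak_partial UNIV i (\<lambda>x. u (x + \<tau>)) (\<lambda>x. g (x + \<tau>))"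
proof -
  have su: "square_integrable lebesgue u" and sg: "square_integrable lebesgue g"
    using u by (auto simp: weak_partial_def)
  show ?thesis
    unfolding weak_partial_def
  proof (intro conjI ballI)
    fix \<phi> :: "real^'a \<Rightarrow> real" assume \<phi>: "\<phi> \<in> test_functions UNIV"
    have \<omega>: "(\<lambda>x. \<phi> (x + - \<tau>)) \<in> test_functions UNIV" by (rule test_functions_shift_UNIV[OF \<phi>])
    note d = partial_deriv_shift[OF test_functions_smooth[OF \<phi>], of i "- \<tau>"]
    have "(LINT x|lebesgue. u (x + \<tau>) * partial_deriv i \<phi> x) = (LINT x|lebesgue. u x * partial_deriv i \<phi> (x + - \<tau>))"
      using integral_lebesgue_translation[OF borel_measurable_integrable[OF
            square_integrable_mult[OF su square_integrable_test[OF test_functions_shift_UNIV[OF test_functions_partial_deriv[OF \<phi>, of i], of "- \<tau>"]]]], of \<tau>]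
      by simp
    also have "\<dots> = - (LINT x|lebesgue. g x * \<phi> (x + - \<tau>))"
    proof -
      have "(LINT x|lebesgue. u x * partial_deriv i (\<lambda>x. \<phi> (x + - \<tau>)) x) = - (LINT x|lebesgue. g x * \<phi> (x + - \<tau>))"
        using u \<omega> unfolding weak_partial_def by blast
      then show ?thesis by (simp only: d)
    qed
    also have "(LINT x|lebesgue. g x * \<phi> (x + - \<tau>)) = (LINT x|lebesgue. g (x + \<tau>) * \<phi> x)"
      using integral_lebesgue_translation[OF borel_measurable_integrable[OF
            square_integrable_mult[OF sg square_integrable_test[OF \<omega>]]], of \<tau>]
      by simp
    finally show "(LINT x|lebesgue. u (x + \<tau>) * partial_deriv i \<phi> x) = - (LINT x|lebesgue. g (x + \<tau>) * \<phi> x)" .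
  qed (use su sg square_integrable_translation in auto)
qed

lemma has_weak_deriv_Nil:
  assumes "U \<in> sets lebesgue" "u \<in> l2_space U"
  shows "has_weak_deriv U [] u u"
  by (simp add: has_weak_deriv_l2_iff[OF assms assms(2)])

lemma weak_partial_imp_has_weak_deriv:
  assumes U: "U \<in> sets lebesgue" and w: "weak_partial U i u g"
  shows "u \<in> l2_space U" "g \<in> l2_space U" "has_weak_deriv U [i] u g"
proof -
  show l: "u \<in> l2_space U" "g \<in> l2_space U"
    using w square_integrable_zero_ext[OF _ U] by (auto simp: weak_partial_def l2_space_iff[OF U])
  show "has_weak_deriv U [i] u g"
    unfolding has_weak_deriv_l2_iff[OF U l]
    using w by (auto simp: weak_partial_def zero_ext_mult_test zero_ext_mult_test[OF test_functions_partial_deriv])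
qed

lemma has_weak_deriv_imp_weak_partial:
  assumes U: "U \<in> sets lebesgue" and l: "u \<in> l2_space U" "g \<in> l2_space U" and w: "has_weak_deriv U [i] u g"
  shows "weak_partial U i (zero_ext U u) (zero_ext U g)"
  using l w by (auto simp: weak_partial_def l2_space_iff[OF U] has_weak_deriv_l2_iff[OF U l])

lemma sobolev_1I:
  assumes U: "U \<in> sets lebesgue" and w: "\<And>i. weak_partial U i u (g i)"
  shows "u \<in> sobolev 1 U"
  unfolding sobolev_def
proof (intro CollectI conjI allI impI)
  show u: "u \<in> l2_space U" by (rule weak_partial_imp_has_weak_deriv(1)[OF U w])
  fix "is" :: "'a list" assume "length is \<le> 1"
  then consider "is = []" | i where "is = [i]" by (cases "is") auto
  then show "\<exists>g\<in>l2_space U. has_weak_deriv U is u g"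
  proof cases
    case 1 then show ?thesis using has_weak_deriv_Nil[OF U u] u by blast
  next
    case 2 then show ?thesis using weak_partial_imp_has_weak_deriv[OF U w] by blast
  qed
qed

section \<open>The weak equation on the whole space and the bound on the gradient\<close>

lemma borel_measurable_vecI:
  fixes f :: "'a \<Rightarrow> real^'n"
  assumes "\<And>i. (\<lambda>x. f x $ i) \<in> borel_measurable M"
  shows "f \<in> borel_measurable M"
proof -
  have "(\<lambda>x. f x \<bullet> b) \<in> borel_measurable M" if b: "b \<in> Basis" for b
  proof -
    obtain i where "b = axis i 1" using b by (auto simp: Basis_vec_def)
    then show ?thesis using assms by (simp add: inner_axis)
  qed
  then show ?thesis by (simp add: borel_measurable_euclidean_space[of f])
qed

lemma norm_vec_power2: "(norm (x :: real^'n))\<^sup>2 = (\<Sum>i\<in>UNIV. (x $ i)\<^sup>2)"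
  unfolding dot_square_norm[symmetric] by (simp add: inner_vec_def power2_eq_square)

text \<open>Only the data of the problem are fixed here; \<open>f\<close> and \<open>u\<close> enter
  in \<open>neumann_solution\<close>. Constants defined in this locale therefore cannot depend on
  them. \<open>R\<close> expresses the boundedness of \<open>U\<close>.\<close>

locale neumann_problem =
  fixes U :: "(real^'n) set" and a :: "real^'n \<Rightarrow> real^'n \<Rightarrow> real^'n" and C\<^sub>L C\<^sub>M C\<^sub>Q R :: real
  assumes open_U: "open U" and U_bounded: "\<And>x. x \<in> U \<Longrightarrow> norm x \<le> R"
    and C\<^sub>L: "C\<^sub>L \<ge> 0" and C\<^sub>M: "C\<^sub>M > 0" and C\<^sub>Q: "C\<^sub>Q \<ge> 0"
    and lipschitz: "\<And>x p q. norm (a x p - a x q) \<le> C\<^sub>L * norm (p - q)"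
    and monotone: "\<And>x p q. (a x p - a x q) \<bullet> (p - q) \<ge> C\<^sub>M * (norm (p - q))\<^sup>2"
    and lipschitz_x: "\<And>x y p. norm (a x p - a y p) \<le> C\<^sub>Q * (norm p + 1) * norm (x - y)"
begin

lemma U_sets: "U \<in> sets lebesgue" using open_U by simp

lemma U_lmeasurable: "U \<in> lmeasurable"
proof -
  have "bounded U" unfolding bounded_iff using U_bounded by blast
  then show ?thesis using open_U by (rule lmeasurable_open)
qed

text \<open>The two Lipschitz conditions, joined at \<open>a (fst z) q\<close>, make
  \<open>a\<close> jointly continuous, so x \<mapsto> a(x, P x) is a Borel function composed with a
  Lebesgue measurable one.\<close>

lemma a_measurable:
  assumes P: "P \<in> borel_measurable lebesgue"
  shows "(\<lambda>x. a x (P x)) \<in> borel_measurable lebesgue"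
proof -
  have "continuous (at (y, q)) (\<lambda>z. a (fst z) (snd z))" for y q
  proof -
    have "((\<lambda>z. a (fst z) (snd z) - a y q) \<longlongrightarrow> 0) (at (y, q))"
    proof (rule Lim_null_comparison)
      show "\<forall>\<^sub>F z in at (y, q). norm (a (fst z) (snd z) - a y q)
          \<le> C\<^sub>L * norm (snd z - q) + C\<^sub>Q * (norm q + 1) * norm (fst z - y)"
      proof (rule always_eventually, rule allI)
        fix z
        have "norm (a (fst z) (snd z) - a y q) \<le> norm (a (fst z) (snd z) - a (fst z) q) + norm (a (fst z) q - a y q)"
          using norm_triangle_ineq[of "a (fst z) (snd z) - a (fst z) q" "a (fst z) q - a y q"] by simp
        then show "norm (a (fst z) (snd z) - a y q)
          \<le> C\<^sub>L * norm (snd z - q) + C\<^sub>Q * (norm q + 1) * norm (fst z - y)"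
          using lipschitz[of "fst z" "snd z" q] lipschitz_x[of "fst z" q y] by linarith
      qed
      have "((\<lambda>z. C\<^sub>L * norm (snd z - q) + C\<^sub>Q * (norm q + 1) * norm (fst z - y)) \<longlongrightarrow>
          C\<^sub>L * norm (snd (y, q) - q) + C\<^sub>Q * (norm q + 1) * norm (fst (y, q) - y)) (at (y, q))"
        by (intro tendsto_intros)
      then show "((\<lambda>z. C\<^sub>L * norm (snd z - q) + C\<^sub>Q * (norm q + 1) * norm (fst z - y)) \<longlongrightarrow> 0) (at (y, q))"
        by simp
    qed
    then show ?thesis unfolding continuous_at by (simp add: LIM_zero_iff)
  qed
  then have "continuous_on UNIV (\<lambda>z. a (fst z) (snd z))"
    by (intro continuous_at_imp_continuous_on) auto
  then have m: "(\<lambda>z. a (fst z) (snd z)) \<in> borel_measurable borel"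
    by (rule borel_measurable_continuous_onI)
  have "(\<lambda>x. x) \<in> borel_measurable (lebesgue :: (real^'n) measure)"
    by (simp add: measurable_completion)
  then have "(\<lambda>x. (x, P x)) \<in> borel_measurable lebesgue"
    using P by (rule borel_measurable_Pair)
  from measurable_compose[OF this m] show ?thesis by simp
qed

text \<open>Comparison of a(x, 0) with a(0, 0) through the Lipschitz condition in x at p = 0, with
  |x| \<le> |R| on \<open>U\<close>.\<close>

definition A0 :: real where "A0 = norm (a 0 0) + C\<^sub>Q * \<bar>R\<bar>"

lemma norm_a_0_le: "x \<in> U \<Longrightarrow> norm (a x 0) \<le> A0"
proof -
  assume x: "x \<in> U"
  have "norm (a x 0) \<le> norm (a 0 0) + norm (a x 0 - a 0 0)" by (rule norm_triangle_sub)
  also have "norm (a x 0 - a 0 0) \<le> C\<^sub>Q * norm x" using lipschitz_x[of x 0 0] by simp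
  also have "C\<^sub>Q * norm x \<le> C\<^sub>Q * \<bar>R\<bar>" using U_bounded[OF x] C\<^sub>Q by (intro mult_left_mono) auto
  finally show ?thesis by (simp add: A0_def)
qed

end

locale neumann_solution = neumann_problem U a C\<^sub>L C\<^sub>M C\<^sub>Q R
  for U :: "(real^'n) set" and a :: "real^'n \<Rightarrow> real^'n \<Rightarrow> real^'n" and C\<^sub>L C\<^sub>M C\<^sub>Q R :: real +
  fixes f u :: "real^'n \<Rightarrow> real"
  assumes f_l2: "f \<in> l2_space U" and sol: "weak_neumann_solution a U f u"
begin

definition u0 where "u0 = zero_ext U u"
definition f0 where "f0 = zero_ext U f"
definition p where "p i = zero_ext U (weak_deriv U [i] u)"
definition P where "P x = (\<chi> i. p i x)"
text \<open>The flux extended by zero. \<open>P\<close> vanishes off \<open>U\<close>, but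
  \<open>a x 0\<close> need not, hence the explicit indicator.\<close>

definition F where "F x = indicator U x *\<^sub>R a x (P x)"

lemma u_l2: "u \<in> l2_space U"
  and weak_deriv_u: "weak_deriv U [i] u \<in> l2_space U" "has_weak_deriv U [i] u (weak_deriv U [i] u)"
proof -
  have s: "u \<in> sobolev 1 U" using sol by (simp add: weak_neumann_solution_def)
  then show "u \<in> l2_space U" by (simp add: sobolev_def)
  have "\<forall>is. length is \<le> 1 \<longrightarrow> (\<exists>g\<in>l2_space U. has_weak_deriv U is u g)"
    using s by (simp add: sobolev_def)
  from this[rule_format, of "[i]"] obtain g where g: "g \<in> l2_space U" "has_weak_deriv U [i] u g"
    by auto
  show "weak_deriv U [i] u \<in> l2_space U" "has_weak_deriv U [i] u (weak_deriv U [i] u)"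
    by (rule weak_deriv_l2[OF open_U g(2,1)])+
qed

lemma weak_partial_u0: "weak_partial U i u0 (p i)"
  unfolding u0_def p_def by (rule has_weak_deriv_imp_weak_partial[OF U_sets u_l2 weak_deriv_u])

lemma sq_u0: "square_integrable lebesgue u0" and sq_p: "square_integrable lebesgue (p i)"
  using weak_partial_u0 by (auto simp: weak_partial_def)

lemma sq_f0: "square_integrable lebesgue f0"
  using f_l2 by (simp add: f0_def l2_space_iff[OF U_sets])

lemma P_measurable: "P \<in> borel_measurable lebesgue"
  by (rule borel_measurable_vecI) (simp add: P_def square_integrable_measurable[OF sq_p])

lemma sq_norm_P: "square_integrable lebesgue (\<lambda>x. norm (P x))"
  and integral_norm_P: "(LINT x|lebesgue. (norm (P x))\<^sup>2) = (\<Sum>i\<in>UNIV. (norm2 lebesgue (p i))\<^sup>2)"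
proof -
  have i: "integrable lebesgue (\<lambda>x. (p i x)\<^sup>2)" for i using sq_p by (simp add: square_integrable_def)
  have e: "(norm (P x))\<^sup>2 = (\<Sum>i\<in>UNIV. (p i x)\<^sup>2)" for x by (simp add: norm_vec_power2 P_def)
  show "square_integrable lebesgue (\<lambda>x. norm (P x))"
    using P_measurable i by (simp add: square_integrable_def e)
  show "(LINT x|lebesgue. (norm (P x))\<^sup>2) = (\<Sum>i\<in>UNIV. (norm2 lebesgue (p i))\<^sup>2)"
    using i by (simp add: e norm2_power2)
qed

lemma F_measurable: "F \<in> borel_measurable lebesgue"
  unfolding F_def[abs_def]
  by (intro borel_measurable_scaleR a_measurable P_measurable borel_measurable_indicator U_sets)

lemma sq_F: "square_integrable lebesgue (\<lambda>x. F x $ i)"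
proof -
  \<comment> \<open>Majorant from the linear growth |a(x, p)| \<le> \<open>A0\<close> +
    \<open>C\<^sub>L\<close> |p| on \<open>U\<close>; the constant part is square integrable because
    \<open>U\<close> has finite measure.\<close>
  have 1: "square_integrable lebesgue (\<lambda>x. C\<^sub>L * norm (P x) + A0 * indicator U x)"
    by (intro square_integrable_add square_integrable_scale sq_norm_P square_integrable_indicator U_lmeasurable)
  show ?thesis
  proof (rule square_integrable_bound[OF 1, of _ 1])
    have "(\<lambda>x. F x \<bullet> axis i 1) \<in> borel_measurable lebesgue"
      by (intro borel_measurable_inner F_measurable borel_measurable_const)
    then show "(\<lambda>x. F x $ i) \<in> borel_measurable lebesgue" by (simp add: inner_axis)
    show "AE x in lebesgue. \<bar>F x $ i\<bar> \<le> 1 * \<bar>C\<^sub>L * norm (P x) + A0 * indicator U x\<bar>"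
    proof (rule AE_I2)
      fix x
      have "norm (F x) \<le> C\<^sub>L * norm (P x) + A0 * indicator U x"
      proof (cases "x \<in> U")
        case True
        have "norm (a x (P x)) \<le> norm (a x 0) + norm (a x (P x) - a x 0)" by (rule norm_triangle_sub)
        also have "\<dots> \<le> A0 + C\<^sub>L * norm (P x)"
          using norm_a_0_le[OF True] lipschitz[of x "P x" 0] by simp
        finally show ?thesis using True by (simp add: F_def)
      qed (use C\<^sub>L in \<open>simp add: F_def\<close>)
      then show "\<bar>F x $ i\<bar> \<le> 1 * \<bar>C\<^sub>L * norm (P x) + A0 * indicator U x\<bar>"
        using order_trans[OF component_le_norm_cart order_trans[OF _ abs_ge_self]] by simp
    qed
  qed
qed

text \<open>Any L^2 representative \<open>\<Gamma>\<close> may replace the chosen gradient of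
  \<open>v\<close>: the two agree almost everywhere on \<open>U\<close>, and \<open>F\<close>
  vanishes elsewhere. Test functions can then be given with an explicit gradient.\<close>

lemma weak_formulation:
  assumes v: "\<And>i. weak_partial U i v (\<Gamma> i)"
  shows "(\<Sum>i\<in>UNIV. LINT x|lebesgue. F x $ i * \<Gamma> i x) = (LINT x|lebesgue. f0 x * v x)"
proof -
  have vs: "v \<in> sobolev 1 U" by (rule sobolev_1I[OF U_sets v])
  note wd = weak_partial_imp_has_weak_deriv[OF U_sets v]
  define q where "q i = zero_ext U (weak_deriv U [i] v)" for i
  have sq: "square_integrable lebesgue (q i)" for i
    unfolding q_def using weak_deriv_l2(1)[OF open_U wd(3) wd(2)] l2_space_iff[OF U_sets] by blast
  have sG: "square_integrable lebesgue (\<Gamma> i)" for i using v by (simp add: weak_partial_def)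
  have pt: "indicator U x * (a x (weak_grad U u x) \<bullet> weak_grad U v x) = (\<Sum>i\<in>UNIV. F x $ i * q i x)" for x
  proof (cases "x \<in> U")
    case True
    then have "weak_grad U u x = P x"
      by (simp add: vec_eq_iff weak_grad_def P_def p_def zero_ext_def)
    then show ?thesis using True
      by (simp add: F_def inner_vec_def q_def zero_ext_def weak_grad_def)
  qed (simp add: F_def)
  have "(LINT x|lebesgue. f0 x * v x) = (LINT x|lebesgue_on U. f x * v x)"
    by (simp add: f0_def integral_lebesgue_on_mult[OF U_sets])
  also have "\<dots> = (LINT x|lebesgue_on U. a x (weak_grad U u x) \<bullet> weak_grad U v x)"
    using sol vs by (simp add: weak_neumann_solution_def)
  also have "\<dots> = (LINT x|lebesgue. (\<Sum>i\<in>UNIV. F x $ i * q i x))"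
    unfolding integral_lebesgue_on_eq[OF U_sets] pt ..
  also have "\<dots> = (\<Sum>i\<in>UNIV. LINT x|lebesgue. F x $ i * q i x)"
    by (rule Bochner_Integration.integral_sum) (rule square_integrable_mult[OF sq_F sq])
  also have "\<dots> = (\<Sum>i\<in>UNIV. LINT x|lebesgue. F x $ i * \<Gamma> i x)"
  proof (rule sum.cong[OF refl], rule integral_cong_AE)
    fix i
    show "(\<lambda>x. F x $ i * q i x) \<in> borel_measurable lebesgue" "(\<lambda>x. F x $ i * \<Gamma> i x) \<in> borel_measurable lebesgue"
      by (rule borel_measurable_integrable[OF square_integrable_mult[OF sq_F]], rule sq sG)+
    show "AE x in lebesgue. F x $ i * q i x = F x $ i * \<Gamma> i x"
      using weak_deriv_AE_eq[OF open_U wd(3)[of i]]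
    proof eventually_elim
      case (elim x)
      then show ?case by (cases "x \<in> U") (simp_all add: q_def F_def zero_ext_def)
    qed
  qed
  finally show ?thesis by simp
qed

text \<open>Monotonicity against q = 0 gives a(x, p) \<cdot> p \<ge> \<open>C\<^sub>M\<close> |p|^2
  + a(x, 0) \<cdot> p. Young's inequality spends half of the square on \<open>A0\<close> |p| and
  leaves a constant to integrate over \<open>U\<close>; the other side is \<integral> f u, at most
  half the sum of the squared norms.\<close>

lemma gradient_bound:
  "(LINT x|lebesgue. (norm (P x))\<^sup>2) \<le>
    (1 / C\<^sub>M + (A0 / C\<^sub>M)\<^sup>2 * measure lebesgue U) * ((l2_norm U f)\<^sup>2 + (l2_norm U u)\<^sup>2 + 1)"
proof -
  define N where "N = (LINT x|lebesgue. (norm (P x))\<^sup>2)"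
  define S where "S = (l2_norm U f)\<^sup>2 + (l2_norm U u)\<^sup>2"
  have S0: "S \<ge> 0" by (simp add: S_def)
  have iP: "integrable lebesgue (\<lambda>x. (norm (P x))\<^sup>2)" using sq_norm_P by (simp add: square_integrable_def)
  have iU: "integrable lebesgue (indicat_real U)"
    using U_lmeasurable by (intro integrable_real_indicator) (auto simp: fmeasurable_def)
  have iFp: "integrable lebesgue (\<lambda>x. F x $ i * p i x)" for i by (rule square_integrable_mult[OF sq_F sq_p])
  have pt: "C\<^sub>M / 2 * (norm (P x))\<^sup>2 - A0\<^sup>2 / (2 * C\<^sub>M) * indicator U x \<le> (\<Sum>i\<in>UNIV. F x $ i * p i x)" for x
  proof (cases "x \<in> U")
    case True
    have "A0 * norm (P x) \<le> C\<^sub>M / 2 * (norm (P x))\<^sup>2 + A0\<^sup>2 / (2 * C\<^sub>M)"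
    proof -
      have "0 \<le> (C\<^sub>M * norm (P x) - A0)\<^sup>2 / (2 * C\<^sub>M)" using C\<^sub>M by simp
      also have "\<dots> = C\<^sub>M / 2 * (norm (P x))\<^sup>2 + A0\<^sup>2 / (2 * C\<^sub>M) - A0 * norm (P x)"
        using C\<^sub>M by (simp add: power2_eq_square field_simps)
      finally show ?thesis by simp
    qed
    moreover have "C\<^sub>M * (norm (P x))\<^sup>2 \<le> (a x (P x) - a x 0) \<bullet> P x" using monotone[where x = x and p = "P x" and q = 0] by simp
    moreover have "- (a x 0 \<bullet> P x) \<le> A0 * norm (P x)"
    proof -
      have "- (a x 0 \<bullet> P x) \<le> norm (a x 0) * norm (P x)" using Cauchy_Schwarz_ineq2[of "a x 0" "P x"] by linarith
      also have "\<dots> \<le> A0 * norm (P x)" by (rule mult_right_mono[OF norm_a_0_le[OF True]]) simp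
      finally show ?thesis .
    qed
    ultimately have "C\<^sub>M / 2 * (norm (P x))\<^sup>2 - A0\<^sup>2 / (2 * C\<^sub>M) \<le> a x (P x) \<bullet> P x"
      by (simp add: inner_diff_left)
    then show ?thesis using True by (simp add: F_def inner_vec_def P_def)
  next
    case False
    then have "P x = 0" by (simp add: vec_eq_iff P_def p_def zero_ext_def)
    then show ?thesis using False by (simp add: F_def)
  qed
  have "C\<^sub>M / 2 * N - A0\<^sup>2 / (2 * C\<^sub>M) * measure lebesgue U
      = (LINT x|lebesgue. C\<^sub>M / 2 * (norm (P x))\<^sup>2 - A0\<^sup>2 / (2 * C\<^sub>M) * indicator U x)"
    using iP iU by (simp add: N_def)
  also have "\<dots> \<le> (LINT x|lebesgue. (\<Sum>i\<in>UNIV. F x $ i * p i x))"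
    by (rule integral_mono[OF _ _ pt])
      (intro Bochner_Integration.integrable_diff integrable_mult_right iP iU Bochner_Integration.integrable_sum iFp)+
  also have "\<dots> = (LINT x|lebesgue. f0 x * u0 x)"
    using iFp weak_formulation[OF weak_partial_u0] by simp
  also have "\<dots> \<le> norm2 lebesgue f0 * norm2 lebesgue u0" using Cauchy_Schwarz_norm2[OF sq_f0 sq_u0] by linarith
  also have "\<dots> \<le> S / 2"
    using sum_squares_bound[of "norm2 lebesgue f0" "norm2 lebesgue u0"]
    by (simp add: S_def l2_norm_eq[OF U_sets] f0_def u0_def)
  finally have "C\<^sub>M / 2 * N \<le> S / 2 + A0\<^sup>2 / (2 * C\<^sub>M) * measure lebesgue U" by simp
  then have "N \<le> (2 / C\<^sub>M) * (S / 2 + A0\<^sup>2 / (2 * C\<^sub>M) * measure lebesgue U)"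
    using C\<^sub>M by (simp add: field_simps)
  also have "\<dots> = 1 / C\<^sub>M * S + (A0 / C\<^sub>M)\<^sup>2 * measure lebesgue U * 1"
    using C\<^sub>M by (simp add: power2_eq_square field_simps)
  also have "\<dots> \<le> 1 / C\<^sub>M * (S + 1) + (A0 / C\<^sub>M)\<^sup>2 * measure lebesgue U * (S + 1)"
    using C\<^sub>M S0 by (intro add_mono mult_left_mono) auto
  finally show ?thesis by (simp add: N_def S_def algebra_simps)
qed

end

section \<open>The difference quotient estimate\<close>

lemma young_inequality_scaled:
  fixes x y e :: real
  assumes "e > 0"
  shows "2 * (x * y) \<le> e * x\<^sup>2 + y\<^sup>2 / e"
proof -
  have "0 \<le> (e * x - y)\<^sup>2 / e" using assms by simp
  also have "\<dots> = e * x\<^sup>2 + y\<^sup>2 / e - 2 * (x * y)"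
    using assms by (simp add: power2_eq_square field_simps)
  finally show ?thesis by simp
qed

text \<open>Pointwise core of the estimate. In the application \<open>A\<^sub>1\<close> and
  \<open>A\<^sub>2\<close> are the parts of D^h a due to the change of p and of x, D = D^h
  \<nabla>u, d = D^h u, z = \<zeta>, Z = \<nabla>\<zeta> and s = |\<nabla>u| + 1, so the last factor
  is \<nabla>(\<zeta>^2 D^h u). Two cross terms consume a quarter of the coercive term each, which
  leaves the factor \<open>C\<^sub>M / 2\<close>.\<close>

lemma cutoff_coercivity:
  fixes A\<^sub>1 A\<^sub>2 D Z :: "'a::real_inner" and z d s B :: real
  assumes C\<^sub>M: "C\<^sub>M > 0" and C\<^sub>L: "C\<^sub>L \<ge> 0" and C\<^sub>Q: "C\<^sub>Q \<ge> 0" and s: "s \<ge> 0"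
    and mono: "C\<^sub>M * (norm D)\<^sup>2 \<le> A\<^sub>1 \<bullet> D" and A1: "norm A\<^sub>1 \<le> C\<^sub>L * norm D" and A2: "norm A\<^sub>2 \<le> C\<^sub>Q * s"
    and Z: "norm Z \<le> B" and z: "\<bar>z\<bar> \<le> B"
  shows "C\<^sub>M / 2 * (z\<^sup>2 * (norm D)\<^sup>2) - (4 * C\<^sub>L\<^sup>2 * B\<^sup>2 / C\<^sub>M + B\<^sup>2 * C\<^sub>Q\<^sup>2 / C\<^sub>M + B\<^sup>2 * C\<^sub>Q) * (s\<^sup>2 + d\<^sup>2)
    \<le> (A\<^sub>1 + A\<^sub>2) \<bullet> (z\<^sup>2 *\<^sub>R D + (2 * z * d) *\<^sub>R Z)"
proof -
  define n where "n = norm D"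
  have B: "B \<ge> 0" using z by linarith
  have n: "n \<ge> 0" by (simp add: n_def)
  have zB: "z\<^sup>2 \<le> B\<^sup>2" using z by (metis abs_ge_zero power2_abs power_mono)
  have t1: "C\<^sub>M * (z\<^sup>2 * n\<^sup>2) \<le> z\<^sup>2 * (A\<^sub>1 \<bullet> D)"
    using mult_left_mono[OF mono, of "z\<^sup>2"] by (simp add: n_def mult_ac)
  have t2: "- (2 * z * d * (A\<^sub>1 \<bullet> Z)) \<le> C\<^sub>M / 4 * (z\<^sup>2 * n\<^sup>2) + 4 * C\<^sub>L\<^sup>2 * B\<^sup>2 / C\<^sub>M * d\<^sup>2"
  proof -
    have "\<bar>A\<^sub>1 \<bullet> Z\<bar> \<le> norm A\<^sub>1 * norm Z" by (rule Cauchy_Schwarz_ineq2)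
    also have "\<dots> \<le> (C\<^sub>L * n) * B"
      unfolding n_def by (rule mult_mono[OF A1 Z]) (use C\<^sub>L in auto)
    finally have "\<bar>2 * z * d\<bar> * \<bar>A\<^sub>1 \<bullet> Z\<bar> \<le> \<bar>2 * z * d\<bar> * ((C\<^sub>L * n) * B)"
      by (rule mult_left_mono) simp
    then have "- (2 * z * d * (A\<^sub>1 \<bullet> Z)) \<le> 2 * ((\<bar>z\<bar> * n) * (C\<^sub>L * B * \<bar>d\<bar>))"
      unfolding abs_mult[symmetric] using abs_ge_minus_self[of "2 * z * d * (A\<^sub>1 \<bullet> Z)"]
      by (simp add: abs_mult mult_ac)
    also have "\<dots> \<le> (C\<^sub>M / 4) * (\<bar>z\<bar> * n)\<^sup>2 + (C\<^sub>L * B * \<bar>d\<bar>)\<^sup>2 / (C\<^sub>M / 4)"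
      by (rule young_inequality_scaled) (use C\<^sub>M in simp)
    also have "\<dots> = C\<^sub>M / 4 * (z\<^sup>2 * n\<^sup>2) + 4 * C\<^sub>L\<^sup>2 * B\<^sup>2 / C\<^sub>M * d\<^sup>2"
      by (simp add: power_mult_distrib)
    finally show ?thesis .
  qed
  have t3: "- (z\<^sup>2 * (A\<^sub>2 \<bullet> D)) \<le> C\<^sub>M / 4 * (z\<^sup>2 * n\<^sup>2) + B\<^sup>2 * C\<^sub>Q\<^sup>2 / C\<^sub>M * s\<^sup>2"
  proof -
    have "\<bar>A\<^sub>2 \<bullet> D\<bar> \<le> norm A\<^sub>2 * norm D" by (rule Cauchy_Schwarz_ineq2)
    also have "\<dots> \<le> (C\<^sub>Q * s) * n"
      unfolding n_def by (rule mult_right_mono[OF A2]) simp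
    finally have "z\<^sup>2 * (- (A\<^sub>2 \<bullet> D)) \<le> z\<^sup>2 * ((C\<^sub>Q * s) * n)"
      by (intro mult_left_mono) auto
    also have "\<dots> = (\<bar>z\<bar> * n) * (\<bar>z\<bar> * (C\<^sub>Q * s))"
      by (simp add: power2_eq_square)
    finally have 1: "- (z\<^sup>2 * (A\<^sub>2 \<bullet> D)) \<le> (\<bar>z\<bar> * n) * (\<bar>z\<bar> * (C\<^sub>Q * s))"
      by (simp only: mult_minus_right)
    \<comment> \<open>Twice the weight used for the previous cross term, because the product to be
      bounded now lacks the factor 2.\<close>
    have "2 * ((\<bar>z\<bar> * n) * (\<bar>z\<bar> * (C\<^sub>Q * s))) \<le> (C\<^sub>M / 2) * (\<bar>z\<bar> * n)\<^sup>2 + (\<bar>z\<bar> * (C\<^sub>Q * s))\<^sup>2 / (C\<^sub>M / 2)"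
      by (rule young_inequality_scaled) (use C\<^sub>M in simp)
    also have "\<dots> = 2 * (C\<^sub>M / 4 * (z\<^sup>2 * n\<^sup>2)) + 2 * (z\<^sup>2 * (C\<^sub>Q\<^sup>2 / C\<^sub>M * s\<^sup>2))"
      by (simp add: power_mult_distrib mult_ac)
    also have "z\<^sup>2 * (C\<^sub>Q\<^sup>2 / C\<^sub>M * s\<^sup>2) \<le> B\<^sup>2 * (C\<^sub>Q\<^sup>2 / C\<^sub>M * s\<^sup>2)"
      by (rule mult_right_mono[OF zB]) (use C\<^sub>M in simp)
    finally have 2: "2 * ((\<bar>z\<bar> * n) * (\<bar>z\<bar> * (C\<^sub>Q * s)))
        \<le> 2 * (C\<^sub>M / 4 * (z\<^sup>2 * n\<^sup>2)) + 2 * (B\<^sup>2 * (C\<^sub>Q\<^sup>2 / C\<^sub>M * s\<^sup>2))" by simp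
    have "B\<^sup>2 * (C\<^sub>Q\<^sup>2 / C\<^sub>M * s\<^sup>2) = B\<^sup>2 * C\<^sub>Q\<^sup>2 / C\<^sub>M * s\<^sup>2" by simp
    with 1 2 show ?thesis by linarith
  qed
  \<comment> \<open>\<open>D\<close> does not occur here, so nothing has to be absorbed and 2 s |d|
    \<le> s^2 + d^2 is enough.\<close>
  have t4: "- (2 * z * d * (A\<^sub>2 \<bullet> Z)) \<le> B\<^sup>2 * C\<^sub>Q * (s\<^sup>2 + d\<^sup>2)"
  proof -
    have "\<bar>A\<^sub>2 \<bullet> Z\<bar> \<le> norm A\<^sub>2 * norm Z" by (rule Cauchy_Schwarz_ineq2)
    also have "\<dots> \<le> (C\<^sub>Q * s) * B"
      by (rule mult_mono[OF A2 Z]) (use C\<^sub>Q s in auto)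
    finally have "\<bar>z * d\<bar> * \<bar>A\<^sub>2 \<bullet> Z\<bar> \<le> (B * \<bar>d\<bar>) * ((C\<^sub>Q * s) * B)"
      unfolding abs_mult[of z d] by (intro mult_mono z) (use B in auto)
    then have "- (2 * z * d * (A\<^sub>2 \<bullet> Z)) \<le> B\<^sup>2 * C\<^sub>Q * (2 * (s * \<bar>d\<bar>))"
      using abs_ge_minus_self[of "(z * d) * (A\<^sub>2 \<bullet> Z)"]
      by (simp add: abs_mult power2_eq_square mult_ac)
    also have "\<dots> \<le> B\<^sup>2 * C\<^sub>Q * (s\<^sup>2 + d\<^sup>2)"
      using young_inequality_scaled[of 1 s "\<bar>d\<bar>"] C\<^sub>Q by (intro mult_left_mono) auto
    finally show ?thesis .
  qed
  \<comment> \<open>The common factor s^2 + d^2 in the statement adds these two terms, which none of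
    the four estimates produces.\<close>
  have nn: "0 \<le> 4 * C\<^sub>L\<^sup>2 * B\<^sup>2 / C\<^sub>M * s\<^sup>2" "0 \<le> B\<^sup>2 * C\<^sub>Q\<^sup>2 / C\<^sub>M * d\<^sup>2"
    using C\<^sub>M by auto
  have "(A\<^sub>1 + A\<^sub>2) \<bullet> (z\<^sup>2 *\<^sub>R D + (2 * z * d) *\<^sub>R Z)
      = z\<^sup>2 * (A\<^sub>1 \<bullet> D) + 2 * z * d * (A\<^sub>1 \<bullet> Z) + z\<^sup>2 * (A\<^sub>2 \<bullet> D) + 2 * z * d * (A\<^sub>2 \<bullet> Z)"
    by (simp add: inner_add_left inner_add_right distrib_left)
  moreover have "(4 * C\<^sub>L\<^sup>2 * B\<^sup>2 / C\<^sub>M + B\<^sup>2 * C\<^sub>Q\<^sup>2 / C\<^sub>M + B\<^sup>2 * C\<^sub>Q) * (s\<^sup>2 + d\<^sup>2)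
      = 4 * C\<^sub>L\<^sup>2 * B\<^sup>2 / C\<^sub>M * s\<^sup>2 + 4 * C\<^sub>L\<^sup>2 * B\<^sup>2 / C\<^sub>M * d\<^sup>2 + B\<^sup>2 * C\<^sub>Q\<^sup>2 / C\<^sub>M * s\<^sup>2
        + B\<^sup>2 * C\<^sub>Q\<^sup>2 / C\<^sub>M * d\<^sup>2 + B\<^sup>2 * C\<^sub>Q * (s\<^sup>2 + d\<^sup>2)"
    by (simp only: distrib_left distrib_right)
  ultimately show ?thesis using t1 t2 t3 t4 nn unfolding n_def[symmetric] by linarith
qed

section \<open>The main estimate and its constants\<close>

context neumann_problem begin

text \<open>\<open>K1\<close> is the factor in \<open>gradient_bound\<close>, and
  \<open>C1 B\<close> the error factor in \<open>cutoff_coercivity\<close>.\<close>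

definition K1 :: real where "K1 = 1 / C\<^sub>M + (A0 / C\<^sub>M)\<^sup>2 * measure lebesgue U"

definition C1 :: "real \<Rightarrow> real" where
  "C1 B = 4 * C\<^sub>L\<^sup>2 * B\<^sup>2 / C\<^sub>M + B\<^sup>2 * C\<^sub>Q\<^sup>2 / C\<^sub>M + B\<^sup>2 * C\<^sub>Q"

text \<open>Result of solving the final inequality for the integral: 4 / \<open>C\<^sub>M\<close>
  undoes the remaining coercive factor, the first summand comes from \<open>f\<close>, the second
  collects the gradient and quotient terms, and the third comes from the 1 in |P| + 1.\<close>

definition K2 :: "real \<Rightarrow> real" where
  "K2 B = 4 / C\<^sub>M * (2 * B\<^sup>2 / C\<^sub>M + (B\<^sup>2 * C\<^sub>M + 3 * C1 B) * K1 + 2 * C1 B * measure lebesgue U)"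

lemma K1_nonneg: "K1 \<ge> 0" using C\<^sub>M by (simp add: K1_def)

lemma C1_nonneg: "C1 B \<ge> 0" using C\<^sub>M C\<^sub>Q by (simp add: C1_def)

lemma K2_nonneg: "K2 B \<ge> 0" using C\<^sub>M K1_nonneg C1_nonneg[of B] by (simp add: K2_def)

end

context neumann_solution begin

lemma integrable_cutoff_difference_quotient:
  assumes \<zeta>: "\<zeta> \<in> test_functions W"
  shows "integrable lebesgue (\<lambda>x. (\<zeta> x)\<^sup>2 * (norm (c *\<^sub>R (P (x + \<tau>) - P x)))\<^sup>2)"
proof -
  have "square_integrable lebesgue (\<lambda>x. \<zeta> x * (c * (p i (x + \<tau>) - p i x)))" for i
    by (intro square_integrable_mult_test[OF _ \<zeta>] square_integrable_scale square_integrable_diff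
        square_integrable_translation sq_p)
  then have "integrable lebesgue (\<lambda>x. \<Sum>i\<in>UNIV. (\<zeta> x * (c * (p i (x + \<tau>) - p i x)))\<^sup>2)"
    by (intro Bochner_Integration.integrable_sum) (simp add: square_integrable_def)
  moreover have "(\<lambda>x. \<Sum>i\<in>UNIV. (\<zeta> x * (c * (p i (x + \<tau>) - p i x)))\<^sup>2)
      = (\<lambda>x. (\<zeta> x)\<^sup>2 * (norm (c *\<^sub>R (P (x + \<tau>) - P x)))\<^sup>2)"
    unfolding norm_vec_power2 by (simp add: fun_eq_iff P_def power_mult_distrib sum_distrib_left)
  ultimately show ?thesis by (simp only:)
qed

text \<open>Let X be the integral on the left. Coercivity yields \<open>C\<^sub>M / 2\<close> times
  X up to lower order terms, the norm of v returns at most \<open>C\<^sub>M / 4\<close> times X, and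
  X is finite for each h, so the inequality can be solved for X with a bound uniform in h.\<close>

lemma difference_quotient_estimate:
  assumes W: "open W" and \<zeta>: "\<zeta> \<in> test_functions W" and B0: "B > 0"
    and B: "\<And>x. \<bar>\<zeta> x\<bar> \<le> B" "\<And>x. norm (\<chi> i. partial_deriv i \<zeta> x) \<le> B"
    and h: "h \<noteq> 0" and seg: "\<And>x t. x \<in> W \<Longrightarrow> \<bar>t\<bar> \<le> \<bar>h\<bar> \<Longrightarrow> x + t *\<^sub>R axis k 1 \<in> U"
  shows "(LINT x|lebesgue. (\<zeta> x)\<^sup>2 * (norm ((1 / h) *\<^sub>R (P (x + h *\<^sub>R axis k 1) - P x)))\<^sup>2)
    \<le> K2 B * ((l2_norm U f)\<^sup>2 + (l2_norm U u)\<^sup>2 + 1)"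
proof -
  define \<tau> :: "real^'n" where "\<tau> = h *\<^sub>R axis k 1"
  define S where "S = (l2_norm U f)\<^sup>2 + (l2_norm U u)\<^sup>2 + 1"
  have S1: "S \<ge> 1" by (simp add: S_def)
  have WS: "W \<in> sets lebesgue" using W by simp
  define \<eta> where "\<eta> x = \<zeta> x * \<zeta> x" for x
  have \<eta>: "\<eta> \<in> test_functions W"
    unfolding \<eta>_def by (rule test_functions_mult[OF \<zeta> test_functions_smooth[OF \<zeta>]])
  have d\<eta>: "partial_deriv i \<eta> x = 2 * \<zeta> x * partial_deriv i \<zeta> x" for i x
    unfolding \<eta>_def[abs_def]
    using partial_deriv_mult[OF test_functions_smooth[OF \<zeta>] test_functions_smooth[OF \<zeta>]] by simp
  \<comment> \<open>The shift 0 is included because the quotient is a difference of two cut-off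
    translates, one of them by 0.\<close>
  have W\<tau>: "x + \<tau> \<in> U" "x + 0 \<in> U" if "x \<in> W" for x
    using seg[OF that, of h] seg[OF that, of 0] by (simp_all add: \<tau>_def)
  define du where "du x = (u0 (x + \<tau>) - u0 x) / h" for x
  define Dp where "Dp i x = (p i (x + \<tau>) - p i x) / h" for i x
  define D where "D x = (1 / h) *\<^sub>R (P (x + \<tau>) - P x)" for x
  have D_nth: "D x $ i = Dp i x" for x i by (simp add: D_def Dp_def P_def)
  have sdu: "square_integrable lebesgue du"
    unfolding du_def[abs_def]
    using square_integrable_scale[OF square_integrable_diff[OF square_integrable_translation[OF sq_u0, of \<tau>] sq_u0], of "1 / h"] by simp
  \<comment> \<open>This is \<zeta>^2 D^h u, weakly differentiable on the whole space with gradient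
    \<open>G\<close>.\<close>
  define w where "w x = \<eta> x * du x" for x
  define G where "G i x = \<eta> x * Dp i x + partial_deriv i \<eta> x * du x" for i x
  have wG: "weak_partial UNIV i w (G i)" for i
  proof -
    have *: "weak_partial UNIV i
        (\<lambda>x. 1 / h * (\<eta> x * u0 (x + \<tau>) - \<eta> x * u0 (x + 0)))
        (\<lambda>x. 1 / h * ((\<eta> x * p i (x + \<tau>) + partial_deriv i \<eta> x * u0 (x + \<tau>)) - (\<eta> x * p i (x + 0) + partial_deriv i \<eta> x * u0 (x + 0))))"
      by (intro weak_partial_scale weak_partial_diff weak_partial_cutoff_translation[OF weak_partial_u0 \<eta>] W\<tau>)
    have "(\<lambda>x. 1 / h * (\<eta> x * u0 (x + \<tau>) - \<eta> x * u0 (x + 0))) = w"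
      using h by (simp add: fun_eq_iff w_def du_def field_simps)
    moreover have "(\<lambda>x. 1 / h * ((\<eta> x * p i (x + \<tau>) + partial_deriv i \<eta> x * u0 (x + \<tau>)) - (\<eta> x * p i (x + 0) + partial_deriv i \<eta> x * u0 (x + 0)))) = G i"
      using h by (simp add: fun_eq_iff G_def du_def Dp_def field_simps)
    ultimately show ?thesis using * by (simp only:)
  qed
  have sw: "square_integrable lebesgue w" and sG: "square_integrable lebesgue (G i)" for i
    using wG by (auto simp: weak_partial_def)
  \<comment> \<open>the classical choice $v = -D^{-h}(\zeta^2 D^h u)$\<close>
  define v where "v x = 1 / h * (w (x + - \<tau>) - w x)" for x
  define \<Gamma> where "\<Gamma> i x = 1 / h * (G i (x + - \<tau>) - G i x)" for i x
  have vG: "weak_partial UNIV i v (\<Gamma> i)" for i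
    unfolding v_def[abs_def] \<Gamma>_def[abs_def]
    by (intro weak_partial_scale weak_partial_diff weak_partial_translation wG)
  have sv: "square_integrable lebesgue v" using vG by (auto simp: weak_partial_def)
  have sFi: "square_integrable lebesgue (\<lambda>x. (F (x + \<tau>) $ i - F x $ i) / h)" for i
    using square_integrable_scale[OF square_integrable_diff[OF square_integrable_translation[OF sq_F[of i], of \<tau>] sq_F[of i]], of "1 / h"] by simp
  have iDFG: "integrable lebesgue (\<lambda>x. (F (x + \<tau>) $ i - F x $ i) / h * G i x)" for i
    by (rule square_integrable_mult[OF sFi sG])
  \<comment> \<open>Summation by parts moves the outer quotient from \<open>\<Gamma>\<close> to
    \<open>F\<close>.\<close>
  have "(LINT x|lebesgue. F x $ i * \<Gamma> i x) = (LINT x|lebesgue. (F (x + \<tau>) $ i - F x $ i) / h * G i x)" for i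
  proof -
    note i1 = square_integrable_mult[OF sq_F[of i] square_integrable_translation[OF sG[of i], of "- \<tau>"]]
    note i2 = square_integrable_mult[OF sq_F[of i] sG[of i]]
    have "(LINT x|lebesgue. F x $ i * \<Gamma> i x) = (LINT x|lebesgue. 1 / h * (F x $ i * G i (x + - \<tau>) - F x $ i * G i x))"
      by (rule Bochner_Integration.integral_cong) (simp_all add: \<Gamma>_def right_diff_distrib)
    also have "\<dots> = ((LINT x|lebesgue. F x $ i * G i (x + - \<tau>)) - (LINT x|lebesgue. F x $ i * G i x)) / h"
      unfolding Bochner_Integration.integral_diff[OF i1 i2, symmetric] by simp
    also have "\<dots> = (LINT x|lebesgue. (F (x + \<tau>) $ i - F x $ i) / h * G i x)"
      unfolding pairing_difference_quotient[OF sq_F[of i] sG[of i], of \<tau> h] by simp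
    finally show ?thesis .
  qed
  then have eq: "(LINT x|lebesgue. (\<Sum>i\<in>UNIV. (F (x + \<tau>) $ i - F x $ i) / h * G i x)) = (LINT x|lebesgue. f0 x * v x)"
    using weak_formulation[OF weak_partial_mono[OF vG subset_UNIV]] iDFG by simp
  \<comment> \<open>Majorant on \<open>W\<close> of (|P| + 1)^2 + |D^h u|^2, by (r + 1)^2 \<le> 2
    r^2 + 2. Confining the constant to \<open>U\<close> and the quotient to \<open>W\<close> makes
    its integral controllable.\<close>
  define E where "E x = 2 * (norm (P x))\<^sup>2 + 2 * indicator U x + (zero_ext W du x)\<^sup>2" for x
  have E0: "E x \<ge> 0" for x by (simp add: E_def)
  have outside: "\<zeta> x = 0" "G i x = 0" if "x \<notin> W" for x i
    using that test_functions_outside[OF \<zeta>] test_functions_outside[OF \<eta>]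
      test_functions_outside[OF test_functions_partial_deriv[OF \<eta>]] by (auto simp: G_def)
  have pt: "C\<^sub>M / 2 * ((\<zeta> x)\<^sup>2 * (norm (D x))\<^sup>2) - C1 B * E x \<le> (\<Sum>i\<in>UNIV. (F (x + \<tau>) $ i - F x $ i) / h * G i x)" for x
  proof (cases "x \<in> W")
    case False
    then show ?thesis using outside[OF False] E0 C1_nonneg by simp
  next
    case True
    have xU: "x \<in> U" "x + \<tau> \<in> U" using W\<tau>[OF True] by simp_all
    \<comment> \<open>The increment is split at a(x + \<tau>, P x). The first part keeps the point
      fixed, as monotonicity requires; the second keeps p = \<open>P x\<close>, so that the error
      involves only the untranslated gradient.\<close>
    define A\<^sub>1 where "A\<^sub>1 = (1 / h) *\<^sub>R (a (x + \<tau>) (P (x + \<tau>)) - a (x + \<tau>) (P x))"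
    define A\<^sub>2 where "A\<^sub>2 = (1 / h) *\<^sub>R (a (x + \<tau>) (P x) - a x (P x))"
    define Z where "Z = (\<chi> i. partial_deriv i \<zeta> x)"
    have "C\<^sub>M / 2 * ((\<zeta> x)\<^sup>2 * (norm (D x))\<^sup>2) - C1 B * ((norm (P x) + 1)\<^sup>2 + (du x)\<^sup>2)
        \<le> (A\<^sub>1 + A\<^sub>2) \<bullet> ((\<zeta> x)\<^sup>2 *\<^sub>R D x + (2 * \<zeta> x * du x) *\<^sub>R Z)"
      unfolding C1_def
    proof (rule cutoff_coercivity[OF C\<^sub>M C\<^sub>L C\<^sub>Q])
      show "C\<^sub>M * (norm (D x))\<^sup>2 \<le> A\<^sub>1 \<bullet> D x"
      proof -
        have "A\<^sub>1 \<bullet> D x = (1 / h)\<^sup>2 * ((a (x + \<tau>) (P (x + \<tau>)) - a (x + \<tau>) (P x)) \<bullet> (P (x + \<tau>) - P x))"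
          by (simp add: A\<^sub>1_def D_def power2_eq_square)
        moreover have "C\<^sub>M * (norm (D x))\<^sup>2 = (1 / h)\<^sup>2 * (C\<^sub>M * (norm (P (x + \<tau>) - P x))\<^sup>2)"
          by (simp add: D_def power_mult_distrib power_divide)
        ultimately show ?thesis
          by (simp only:) (rule mult_left_mono[OF monotone zero_le_power2])
      qed
      show "norm A\<^sub>1 \<le> C\<^sub>L * norm (D x)"
      proof -
        have "norm A\<^sub>1 = \<bar>1 / h\<bar> * norm (a (x + \<tau>) (P (x + \<tau>)) - a (x + \<tau>) (P x))"
          by (simp add: A\<^sub>1_def)
        also have "\<dots> \<le> \<bar>1 / h\<bar> * (C\<^sub>L * norm (P (x + \<tau>) - P x))"
          by (rule mult_left_mono[OF lipschitz]) simp
        finally show ?thesis by (simp add: D_def)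
      qed
      show "norm A\<^sub>2 \<le> C\<^sub>Q * (norm (P x) + 1)"
      proof -
        have "norm A\<^sub>2 = \<bar>1 / h\<bar> * norm (a (x + \<tau>) (P x) - a x (P x))"
          by (simp add: A\<^sub>2_def)
        also have "\<dots> \<le> \<bar>1 / h\<bar> * (C\<^sub>Q * (norm (P x) + 1) * norm (x + \<tau> - x))"
          by (rule mult_left_mono[OF lipschitz_x]) simp
        also have "\<dots> = C\<^sub>Q * (norm (P x) + 1)" using h by (simp add: \<tau>_def)
        finally show ?thesis .
      qed
      show "norm Z \<le> B" unfolding Z_def by (rule B(2))
    qed (use B in auto)
    moreover have "(A\<^sub>1 + A\<^sub>2) \<bullet> ((\<zeta> x)\<^sup>2 *\<^sub>R D x + (2 * \<zeta> x * du x) *\<^sub>R Z)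
        = (\<Sum>i\<in>UNIV. (F (x + \<tau>) $ i - F x $ i) / h * G i x)"
    proof -
      have "A\<^sub>1 + A\<^sub>2 = (1 / h) *\<^sub>R (F (x + \<tau>) - F x)"
        using xU by (simp add: A\<^sub>1_def A\<^sub>2_def F_def flip: scaleR_right_distrib)
      then have "(A\<^sub>1 + A\<^sub>2) $ i = (F (x + \<tau>) $ i - F x $ i) / h" for i by simp
      moreover have "((\<zeta> x)\<^sup>2 *\<^sub>R D x + (2 * \<zeta> x * du x) *\<^sub>R Z) $ i = G i x" for i
        by (simp add: G_def Z_def D_nth d\<eta> \<eta>_def power2_eq_square)
      ultimately show ?thesis unfolding inner_vec_def by (simp only: inner_real_def)
    qed
    moreover have "C1 B * ((norm (P x) + 1)\<^sup>2 + (du x)\<^sup>2) \<le> C1 B * E x"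
    proof (rule mult_left_mono[OF _ C1_nonneg])
      have "(norm (P x) + 1)\<^sup>2 \<le> 2 * (norm (P x))\<^sup>2 + 2"
        using young_inequality_scaled[of 1 "norm (P x)" 1] by (simp add: power2_sum)
      then show "(norm (P x) + 1)\<^sup>2 + (du x)\<^sup>2 \<le> E x"
        using True xU by (simp add: E_def zero_ext_def)
    qed
    ultimately show ?thesis by linarith
  qed
  define X where "X = (LINT x|lebesgue. (\<zeta> x)\<^sup>2 * (norm (D x))\<^sup>2)"
  define N where "N = (LINT x|lebesgue. (norm (P x))\<^sup>2)"
  define n where "n = norm2 lebesgue (zero_ext W du)"
  have iX: "integrable lebesgue (\<lambda>x. (\<zeta> x)\<^sup>2 * (norm (D x))\<^sup>2)"
    unfolding D_def by (rule integrable_cutoff_difference_quotient[OF \<zeta>])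
  have iP: "integrable lebesgue (\<lambda>x. (norm (P x))\<^sup>2)" using sq_norm_P by (simp add: square_integrable_def)
  have iU: "integrable lebesgue (indicat_real U)"
    using U_lmeasurable by (intro integrable_real_indicator) (auto simp: fmeasurable_def)
  have iW: "integrable lebesgue (\<lambda>x. (zero_ext W du x)\<^sup>2)"
    using square_integrable_zero_ext[OF sdu WS] by (simp add: square_integrable_def)
  have iE: "integrable lebesgue E"
    unfolding E_def[abs_def] by (intro Bochner_Integration.integrable_add integrable_mult_right iP iU iW)
  have intE: "(LINT x|lebesgue. E x) = 2 * N + 2 * measure lebesgue U + n\<^sup>2"
    using iP iU iW by (simp add: E_def N_def n_def norm2_power2)
  have n_le: "n\<^sup>2 \<le> N"
  proof -
    have "n \<le> norm2 lebesgue (p k)"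
      unfolding n_def du_def[abs_def] \<tau>_def
    proof (rule difference_quotient_norm_le[OF W sq_u0 sq_p _ h])
      show "(LINT x|lebesgue. u0 x * partial_deriv k \<phi> x) = - (LINT x|lebesgue. p k x * \<phi> x)"
        if "\<phi> \<in> test_functions U" for \<phi>
        using weak_partial_u0[of k] that by (simp add: weak_partial_def)
      show "x + t *\<^sub>R axis k 1 \<in> U" if "x \<in> W" "t \<in> closed_segment 0 h" for x t
        using that by (intro seg) (auto simp: closed_segment_eq_real_ivl split: if_splits)
    qed
    then have "n\<^sup>2 \<le> (norm2 lebesgue (p k))\<^sup>2" by (intro power_mono) (auto simp: n_def norm2_nonneg)
    also have "\<dots> \<le> (\<Sum>i\<in>UNIV. (norm2 lebesgue (p i))\<^sup>2)" by (rule member_le_sum) auto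
    finally show ?thesis by (simp add: N_def integral_norm_P)
  qed
  have N_le: "N \<le> K1 * S" using gradient_bound by (simp add: N_def K1_def S_def)
  \<comment> \<open>Up to sign \<open>v\<close> is the quotient of \<open>w\<close> with step - h,
    so the quotient bound on the whole space applies with the k-th derivative
    \<open>G k\<close>.\<close>
  have v_le: "norm2 lebesgue v \<le> norm2 lebesgue (G k)"
  proof -
    have "norm2 lebesgue (zero_ext UNIV (\<lambda>x. (w (x + (- h) *\<^sub>R axis k 1) - w x) / (- h))) \<le> norm2 lebesgue (G k)"
      by (rule difference_quotient_norm_le[OF open_UNIV sw sG, of UNIV]) (use wG[of k] h in \<open>auto simp: weak_partial_def\<close>)
    moreover have "zero_ext UNIV (\<lambda>x. (w (x + (- h) *\<^sub>R axis k 1) - w x) / (- h)) = (\<lambda>x. - 1 * v x)"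
      by (simp add: fun_eq_iff zero_ext_def v_def \<tau>_def minus_divide_left)
    ultimately show ?thesis using norm2_scale[of lebesgue "- 1" v] by simp
  qed
  have G_le: "(norm2 lebesgue (G k))\<^sup>2 \<le> 2 * B\<^sup>2 * X + 8 * B ^ 4 * n\<^sup>2"
  proof -
    have "(G k x)\<^sup>2 \<le> 2 * B\<^sup>2 * ((\<zeta> x)\<^sup>2 * (norm (D x))\<^sup>2) + 8 * B ^ 4 * (zero_ext W du x)\<^sup>2" for x
    proof (cases "x \<in> W")
      case False
      then show ?thesis using outside[OF False] by simp
    next
      case True
      have z: "(\<zeta> x)\<^sup>2 \<le> B\<^sup>2" using B(1)[of x] by (metis abs_ge_zero power2_abs power_mono)
      have "\<bar>partial_deriv k \<zeta> x\<bar> \<le> B"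
        using component_le_norm_cart[of "\<chi> i. partial_deriv i \<zeta> x" k] B(2)[of x] by simp
      then have dz: "(partial_deriv k \<zeta> x)\<^sup>2 \<le> B\<^sup>2" by (metis abs_ge_zero power2_abs power_mono)
      have "\<bar>Dp k x\<bar> \<le> norm (D x)" using component_le_norm_cart[of "D x" k] by (simp add: D_nth)
      then have Dk: "(Dp k x)\<^sup>2 \<le> (norm (D x))\<^sup>2" by (metis abs_ge_zero power2_abs power_mono)
      \<comment> \<open>\<open>G k\<close> is \<zeta> (s + t) at this point; squaring the sum
        produces the factors 2 B^2 and 8 B^4.\<close>
      define s t where "s = \<zeta> x * Dp k x" and "t = 2 * partial_deriv k \<zeta> x * du x"
      have st: "(s + t)\<^sup>2 \<le> 2 * s\<^sup>2 + 2 * t\<^sup>2"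
        using young_inequality_scaled[of 1 s t] by (simp add: power2_sum)
      have "(G k x)\<^sup>2 = (\<zeta> x)\<^sup>2 * (s + t)\<^sup>2"
        unfolding power_mult_distrib[symmetric] by (simp add: G_def d\<eta> \<eta>_def s_def t_def algebra_simps)
      also have "\<dots> \<le> (\<zeta> x)\<^sup>2 * (2 * s\<^sup>2 + 2 * t\<^sup>2)" by (rule mult_left_mono[OF st]) simp
      also have "\<dots> \<le> B\<^sup>2 * (2 * s\<^sup>2 + 2 * t\<^sup>2)" by (rule mult_right_mono[OF z]) simp
      also have "\<dots> \<le> B\<^sup>2 * (2 * ((\<zeta> x)\<^sup>2 * (norm (D x))\<^sup>2) + 2 * (4 * B\<^sup>2 * (du x)\<^sup>2))"
      proof -
        have "s\<^sup>2 \<le> (\<zeta> x)\<^sup>2 * (norm (D x))\<^sup>2"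
          unfolding s_def power_mult_distrib by (rule mult_left_mono[OF Dk]) simp
        moreover have "t\<^sup>2 = 4 * (partial_deriv k \<zeta> x)\<^sup>2 * (du x)\<^sup>2" by (simp add: t_def power_mult_distrib)
        moreover have "4 * (partial_deriv k \<zeta> x)\<^sup>2 * (du x)\<^sup>2 \<le> 4 * B\<^sup>2 * (du x)\<^sup>2"
          using dz by (intro mult_right_mono) auto
        ultimately have "2 * s\<^sup>2 + 2 * t\<^sup>2 \<le> 2 * ((\<zeta> x)\<^sup>2 * (norm (D x))\<^sup>2) + 2 * (4 * B\<^sup>2 * (du x)\<^sup>2)" by linarith
        then show ?thesis by (rule mult_left_mono) simp
      qed
      also have "\<dots> = 2 * B\<^sup>2 * ((\<zeta> x)\<^sup>2 * (norm (D x))\<^sup>2) + 8 * B ^ 4 * (zero_ext W du x)\<^sup>2"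
      proof -
        have "B ^ 4 = B\<^sup>2 * B\<^sup>2" by (simp flip: power_add)
        then show ?thesis using True by (simp add: zero_ext_def distrib_left)
      qed
      finally show ?thesis .
    qed
    then have "(LINT x|lebesgue. (G k x)\<^sup>2)
        \<le> (LINT x|lebesgue. 2 * B\<^sup>2 * ((\<zeta> x)\<^sup>2 * (norm (D x))\<^sup>2) + 8 * B ^ 4 * (zero_ext W du x)\<^sup>2)"
      by (intro integral_mono Bochner_Integration.integrable_add integrable_mult_right iX iW)
        (use sG in \<open>auto simp: square_integrable_def\<close>)
    also have "\<dots> = 2 * B\<^sup>2 * X + 8 * B ^ 4 * n\<^sup>2"
      using iX iW by (simp add: X_def n_def norm2_power2)
    finally show ?thesis by (simp add: norm2_power2)
  qed
  have "C\<^sub>M / 2 * X - C1 B * (2 * N + 2 * measure lebesgue U + n\<^sup>2)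
      = (LINT x|lebesgue. C\<^sub>M / 2 * ((\<zeta> x)\<^sup>2 * (norm (D x))\<^sup>2) - C1 B * E x)"
    using iX iE intE by (simp add: X_def)
  also have "\<dots> \<le> (LINT x|lebesgue. (\<Sum>i\<in>UNIV. (F (x + \<tau>) $ i - F x $ i) / h * G i x))"
    by (rule integral_mono[OF _ _ pt])
      (intro Bochner_Integration.integrable_diff integrable_mult_right iX iE Bochner_Integration.integrable_sum iDFG)+
  also have "\<dots> \<le> norm2 lebesgue f0 * norm2 lebesgue v"
    unfolding eq using Cauchy_Schwarz_norm2[OF sq_f0 sv] by linarith
  also have "\<dots> \<le> norm2 lebesgue (G k) * norm2 lebesgue f0"
    using mult_right_mono[OF v_le norm2_nonneg, of lebesgue f0] by (simp add: mult.commute)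
  also have "\<dots> \<le> C\<^sub>M / (8 * B\<^sup>2) * (norm2 lebesgue (G k))\<^sup>2 + 2 * B\<^sup>2 / C\<^sub>M * (norm2 lebesgue f0)\<^sup>2"
  proof -
    \<comment> \<open>With this weight the term 2 B^2 X of \<open>G_le\<close> costs exactly
      \<open>C\<^sub>M / 4\<close> times X, half of the coercive term.\<close>
    have "0 < C\<^sub>M / (4 * B\<^sup>2)" using C\<^sub>M B0 by simp
    from young_inequality_scaled[OF this, of "norm2 lebesgue (G k)" "norm2 lebesgue f0"]
    show ?thesis using C\<^sub>M B0 by (simp add: field_simps)
  qed
  also have "\<dots> \<le> C\<^sub>M / (8 * B\<^sup>2) * (2 * B\<^sup>2 * X + 8 * B ^ 4 * n\<^sup>2) + 2 * B\<^sup>2 / C\<^sub>M * S"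
  proof (intro add_mono mult_left_mono G_le)
    show "(norm2 lebesgue f0)\<^sup>2 \<le> S" by (simp add: S_def f0_def l2_norm_eq[OF U_sets])
  qed (use C\<^sub>M in auto)
  also have "C\<^sub>M / (8 * B\<^sup>2) * (2 * B\<^sup>2 * X + 8 * B ^ 4 * n\<^sup>2) = C\<^sub>M / 4 * X + B\<^sup>2 * C\<^sub>M * n\<^sup>2"
  proof -
    have "B ^ 4 = B\<^sup>2 * B\<^sup>2" by (simp flip: power_add)
    then show ?thesis using B0 by (simp add: field_simps)
  qed
  finally have "C\<^sub>M / 4 * X \<le> B\<^sup>2 * C\<^sub>M * n\<^sup>2 + C1 B * (2 * N + 2 * measure lebesgue U + n\<^sup>2) + 2 * B\<^sup>2 / C\<^sub>M * S"
    by simp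
  also have "\<dots> \<le> B\<^sup>2 * C\<^sub>M * (K1 * S) + C1 B * (2 * (K1 * S) + 2 * measure lebesgue U * S + K1 * S) + 2 * B\<^sup>2 / C\<^sub>M * S"
  proof (intro add_mono mult_left_mono)
    show "n\<^sup>2 \<le> K1 * S" "n\<^sup>2 \<le> K1 * S" "N \<le> K1 * S" using n_le N_le by linarith+
    \<comment> \<open>S \<ge> 1 lets the constant term be absorbed into a multiple of S.\<close>
    show "2 * measure lebesgue U \<le> 2 * measure lebesgue U * S"
      using mult_left_mono[OF S1, of "2 * measure lebesgue U"] by simp
  qed (use C\<^sub>M C1_nonneg in auto)
  also have "\<dots> = C\<^sub>M / 4 * (K2 B * S)"
    using C\<^sub>M by (simp add: K2_def field_simps)
  finally have "X \<le> K2 B * S" using C\<^sub>M by simp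
  then show ?thesis by (simp add: X_def D_def \<tau>_def S_def)
qed

end

section \<open>Interior regularity\<close>

lemma zero_ext_subset_abs_le: "V \<subseteq> U \<Longrightarrow> \<bar>zero_ext V g x\<bar> \<le> \<bar>zero_ext U g x\<bar>"
  by (cases "x \<in> V") (auto simp: zero_ext_def)

lemma l2_space_subset:
  assumes V: "V \<in> sets lebesgue" and U: "U \<in> sets lebesgue" and VU: "V \<subseteq> U" and g: "g \<in> l2_space U"
  shows "g \<in> l2_space V" "l2_norm V g \<le> l2_norm U g"
proof -
  have sU: "square_integrable lebesgue (zero_ext U g)" using g l2_space_iff[OF U] by blast
  have "zero_ext V (zero_ext U g) = zero_ext V g" using VU by (auto simp: fun_eq_iff zero_ext_def indicator_def)
  then show "g \<in> l2_space V" using square_integrable_zero_ext[OF sU V] l2_space_iff[OF V, of g] by simp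
  show "l2_norm V g \<le> l2_norm U g"
    unfolding l2_norm_eq[OF V] l2_norm_eq[OF U] by (rule norm2_mono[OF sU zero_ext_subset_abs_le[OF VU]])
qed

lemma has_weak_deriv_subset:
  assumes "V \<in> sets lebesgue" "U \<in> sets lebesgue" "V \<subseteq> U" "u \<in> l2_space U" "g \<in> l2_space U" "has_weak_deriv U is u g"
  shows "has_weak_deriv V is u g"
proof -
  have t: "\<phi> \<in> test_functions V \<Longrightarrow> \<phi> \<in> test_functions U" for \<phi> using test_functions_mono[OF assms(3)] by blast
  have p: "partial_derivs is \<phi> \<in> test_functions V" if "\<phi> \<in> test_functions V" for \<phi>
    using that by (induction "is") (auto intro: test_functions_partial_deriv)
  show ?thesis
    unfolding has_weak_deriv_l2_iff[OF assms(1) l2_space_subset(1)[OF assms(1-4)] l2_space_subset(1)[OF assms(1-3,5)]]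
  proof
    fix \<phi> assume \<phi>: "\<phi> \<in> test_functions V"
    have "(LINT x|lebesgue. zero_ext U u x * partial_derivs is \<phi> x) = (-1) ^ length is * (LINT x|lebesgue. zero_ext U g x * \<phi> x)"
      using assms(6) t[OF \<phi>] unfolding has_weak_deriv_l2_iff[OF assms(2,4,5)] by blast
    then show "(LINT x|lebesgue. zero_ext V u x * partial_derivs is \<phi> x) = (-1) ^ length is * (LINT x|lebesgue. zero_ext V g x * \<phi> x)"
      by (simp only: zero_ext_mult_test[OF \<phi>] zero_ext_mult_test[OF t[OF \<phi>]]
          zero_ext_mult_test[OF p[OF \<phi>]] zero_ext_mult_test[OF t[OF p[OF \<phi>]]])
  qed
qed

text \<open>\<open>weak_deriv\<close> has the same norm as any derivative at hand, so one good
  derivative per list of directions suffices; the square root comes from counting the lists.\<close>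

lemma sobolev_norm_bound:
  fixes u :: "real^'n \<Rightarrow> real"
  assumes V: "open V" and T: "T \<ge> 0" and u: "u \<in> l2_space V"
    and d: "\<And>is. length is \<le> k \<Longrightarrow> \<exists>g\<in>l2_space V. has_weak_deriv V is u g \<and> l2_norm V g \<le> T"
  shows "u \<in> sobolev k V"
    "sobolev_norm k V u \<le> sqrt (card {is :: 'n list. length is \<le> k}) * T"
proof -
  show "u \<in> sobolev k V" using u d by (auto simp: sobolev_def)
  have "(l2_norm V (weak_deriv V is u))\<^sup>2 \<le> T\<^sup>2" if len: "length is \<le> k" for "is"
  proof -
    obtain g where g: "g \<in> l2_space V" "has_weak_deriv V is u g" "l2_norm V g \<le> T" using d[OF len] by blast
    show ?thesis
      unfolding weak_deriv_l2(3)[OF V g(2,1)]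
      by (rule power_mono[OF g(3)]) (simp add: l2_norm_def)
  qed
  then have "(\<Sum>is | length is \<le> k. (l2_norm V (weak_deriv V is u))\<^sup>2)
      \<le> of_nat (card {is :: 'n list. length is \<le> k}) * T\<^sup>2"
    by (intro sum_bounded_above) auto
  from real_sqrt_le_mono[OF this]
  show "sobolev_norm k V u \<le> sqrt (card {is :: 'n list. length is \<le> k}) * T"
    using T by (simp add: sobolev_norm_def real_sqrt_mult)
qed

text \<open>The order of choice matters: the neighbourhood, the cutoff, its bounds and C are fixed
  from \<open>U\<close>, \<open>V\<close> and \<open>a\<close> before \<open>f\<close> and
  \<open>u\<close> are introduced.\<close>

lemma (in neumann_problem) interior_regularity:
  assumes V: "open V" and VU: "compactly_contained V U"
  shows "\<exists>C\<ge>0. \<forall>f u. f \<in> l2_space U \<and> weak_neumann_solution a U f u \<longrightarrow>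
    u \<in> sobolev 2 V \<and> sobolev_norm 2 V u \<le> C * (l2_norm U f + l2_norm U u + 1)"
proof -
  have VS: "V \<in> sets lebesgue" using V by simp
  have K: "compact (closure V)" "closure V \<subseteq> U" using VU by (auto simp: compactly_contained_def)
  have V_sub: "V \<subseteq> U" using K(2) closure_subset by blast
  obtain e where e: "e > 0" "(\<Union>x\<in>closure V. ball x e) \<subseteq> U"
    using compact_subset_open_imp_ball_epsilon_subset[OF K(1) open_U K(2)] by blast
  \<comment> \<open>Half of the margin e is left for shifts: a point of \<open>W\<close> moved by
    less than e/2 stays in \<open>U\<close>.\<close>
  define W where "W = (\<Union>x\<in>closure V. ball x (e / 2))"
  have W: "open W" "closure V \<subseteq> W" using e(1) by (auto simp: W_def)
  have seg: "x + t *\<^sub>R axis k 1 \<in> U" if x: "x \<in> W" and t: "\<bar>t\<bar> < e / 2" for x t k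
  proof -
    obtain y where y: "y \<in> closure V" "dist y x < e / 2" using x by (auto simp: W_def)
    have "dist y (x + t *\<^sub>R axis k 1) \<le> dist y x + dist x (x + t *\<^sub>R axis k 1)" by (rule dist_triangle)
    also have "dist x (x + t *\<^sub>R axis k 1) = \<bar>t\<bar>" by (simp add: dist_norm)
    finally have "dist y (x + t *\<^sub>R axis k 1) < e" using y(2) t by linarith
    then have "x + t *\<^sub>R axis k 1 \<in> ball y e" by simp
    then show ?thesis using e(2) y(1) by blast
  qed
  obtain \<zeta> c where \<zeta>: "\<zeta> \<in> test_functions W" and c: "c > 0" and \<zeta>c: "\<And>x. x \<in> closure V \<Longrightarrow> \<zeta> x \<ge> c"
    using test_function_pos_on_compact[OF K(1) W] by metis
  have "\<exists>b. \<forall>x. \<bar>partial_deriv i \<zeta> x\<bar> \<le> b" for i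
    using test_functions_bounded[OF test_functions_partial_deriv[OF \<zeta>]] by metis
  then obtain b where b: "\<And>i x. \<bar>partial_deriv i \<zeta> x\<bar> \<le> b i" by metis
  obtain B' where B': "B' > 0" "\<And>x. \<bar>\<zeta> x\<bar> \<le> B'" using test_functions_bounded[OF \<zeta>] by metis
  \<comment> \<open>A common bound for \<zeta> and |\<nabla>\<zeta>|, whose Euclidean norm is at
    most the sum of the absolute partial derivatives.\<close>
  define B where "B = B' + (\<Sum>i\<in>UNIV. b i)"
  have b0: "b i \<ge> 0" for i using b[of i 0] by linarith
  have sb0: "(\<Sum>i\<in>UNIV. b i) \<ge> 0" by (rule sum_nonneg) (rule b0)
  have B0: "B > 0" using B'(1) sb0 by (simp add: B_def)
  have B1: "\<bar>\<zeta> x\<bar> \<le> B" for x using B'(2)[of x] sb0 by (simp add: B_def)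
  have B2: "norm (\<chi> i. partial_deriv i \<zeta> x) \<le> B" for x
  proof -
    have "norm (\<chi> i. partial_deriv i \<zeta> x) \<le> (\<Sum>i\<in>UNIV. \<bar>(\<chi> i. partial_deriv i \<zeta> x) $ i\<bar>)" by (rule norm_le_l1_cart)
    also have "\<dots> \<le> (\<Sum>i\<in>UNIV. b i)" by (rule sum_mono) (simp add: b)
    finally show ?thesis using B'(1) by (simp add: B_def)
  qed
  \<comment> \<open>One summand for each order of differentiation: 0, 1 and 2.\<close>
  define C\<^sub>0 where "C\<^sub>0 = 1 + sqrt K1 + sqrt (K2 B) / c"
  have nn: "sqrt K1 \<ge> 0" "sqrt (K2 B) / c \<ge> 0" using K1_nonneg K2_nonneg c by auto
  define C where "C = sqrt (card {is :: 'n list. length is \<le> 2}) * C\<^sub>0"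
  have main: "u \<in> sobolev 2 V \<and> sobolev_norm 2 V u \<le> C * (l2_norm U f + l2_norm U u + 1)"
    if f: "f \<in> l2_space U" and u: "weak_neumann_solution a U f u" for f u
  proof -
    interpret neumann_solution U a C\<^sub>L C\<^sub>M C\<^sub>Q R f u
      using f u by unfold_locales
    define T where "T = l2_norm U f + l2_norm U u + 1"
    define S where "S = (l2_norm U f)\<^sup>2 + (l2_norm U u)\<^sup>2 + 1"
    have l0: "l2_norm U g \<ge> 0" for g by (simp add: l2_norm_def)
    have T1: "T \<ge> 1" using l0[of f] l0[of u] by (simp add: T_def)
    \<comment> \<open>The preceding estimates are quadratic in the norms; this turns them into the
      linear form of the claim.\<close>
    have "S \<le> T\<^sup>2"
      using mult_nonneg_nonneg[OF l0[of f] l0[of u]] l0[of f] l0[of u]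
      by (simp add: S_def T_def power2_eq_square algebra_simps)
    then have ST: "sqrt S \<le> T" using T1 by (intro real_le_lsqrt) auto
    have T_le: "x \<le> C\<^sub>0 * T" if "x \<le> T \<or> x \<le> sqrt K1 * T \<or> x \<le> sqrt (K2 B) / c * T" for x
    proof -
      have "C\<^sub>0 * T = T + sqrt K1 * T + sqrt (K2 B) / c * T" by (simp add: C\<^sub>0_def algebra_simps)
      moreover have "sqrt K1 * T \<ge> 0" "sqrt (K2 B) / c * T \<ge> 0"
        using nn T1 by (intro mult_nonneg_nonneg; linarith)+
      ultimately show ?thesis using that T1 by linarith
    qed
    note u_V = l2_space_subset[OF VS U_sets V_sub u_l2]
    have "\<exists>g\<in>l2_space V. has_weak_deriv V is u g \<and> l2_norm V g \<le> C\<^sub>0 * T" if "length is \<le> 2" for "is"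
    proof -
      consider "is = []" | j where "is = [j]" | j k where "is = [j, k]"
        using \<open>length is \<le> 2\<close> by (cases "is" rule: list.exhaust; cases "tl is" rule: list.exhaust; cases "tl (tl is)") auto
      then show ?thesis
      proof cases
        case 1
        have "l2_norm V u \<le> C\<^sub>0 * T"
          by (rule T_le) (use u_V(2) l0[of f] in \<open>simp add: T_def\<close>)
        then show ?thesis using 1 u_V(1) has_weak_deriv_Nil[OF VS u_V(1)] by blast
      next
        case (2 j)
        note wd = weak_deriv_u[of j]
        have "(l2_norm U (weak_deriv U [j] u))\<^sup>2 \<le> K1 * S"
        proof -
          have "(l2_norm U (weak_deriv U [j] u))\<^sup>2 = (norm2 lebesgue (p j))\<^sup>2"
            by (simp add: l2_norm_eq[OF U_sets] p_def)
          also have "\<dots> \<le> (\<Sum>i\<in>UNIV. (norm2 lebesgue (p i))\<^sup>2)" by (rule member_le_sum) auto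
          also have "\<dots> \<le> K1 * S"
            using gradient_bound unfolding integral_norm_P by (simp add: K1_def S_def)
          finally show ?thesis .
        qed
        then have "l2_norm U (weak_deriv U [j] u) \<le> sqrt K1 * sqrt S"
          unfolding real_sqrt_mult[symmetric] by (rule real_le_rsqrt)
        also have "\<dots> \<le> sqrt K1 * T" by (rule mult_left_mono[OF ST nn(1)])
        finally have "l2_norm V (weak_deriv U [j] u) \<le> C\<^sub>0 * T"
          using l2_space_subset(2)[OF VS U_sets V_sub wd(1)] by (intro T_le) linarith
        then show ?thesis
          using 2 l2_space_subset(1)[OF VS U_sets V_sub wd(1)]
            has_weak_deriv_subset[OF VS U_sets V_sub u_l2 wd] by blast
      next
        case (3 j k)
        define M where "M = sqrt (K2 B) / c * T"
        have M0: "M \<ge> 0" unfolding M_def using nn(2) T1 by (intro mult_nonneg_nonneg) auto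
        have bd: "norm2 lebesgue (zero_ext V (\<lambda>x. (p j (x + h *\<^sub>R axis k 1) - p j x) / h)) \<le> M"
          if h: "h \<noteq> 0" "\<bar>h\<bar> < e / 2" for h
        proof -
          define q where "q x = (p j (x + h *\<^sub>R axis k 1) - p j x) / h" for x
          define D where "D x = (1 / h) *\<^sub>R (P (x + h *\<^sub>R axis k 1) - P x)" for x
          have sq: "square_integrable lebesgue q"
            unfolding q_def[abs_def]
            using square_integrable_scale[OF square_integrable_diff[OF square_integrable_translation[OF sq_p[of j], of "h *\<^sub>R axis k 1"] sq_p[of j]], of "1 / h"]
            by simp
          have X: "(LINT x|lebesgue. (\<zeta> x)\<^sup>2 * (norm (D x))\<^sup>2) \<le> K2 B * S"
            unfolding D_def S_def
            by (rule difference_quotient_estimate[OF W(1) \<zeta> B0 B1 B2 h(1)]) (use seg h(2) in auto)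
          have iX: "integrable lebesgue (\<lambda>x. (\<zeta> x)\<^sup>2 * (norm (D x))\<^sup>2)"
            unfolding D_def by (rule integrable_cutoff_difference_quotient[OF \<zeta>])
          have iq: "integrable lebesgue (\<lambda>x. (zero_ext V q x)\<^sup>2)"
            using square_integrable_zero_ext[OF sq VS] by (simp add: square_integrable_def)
          \<comment> \<open>On \<open>V\<close> the cutoff is at least c, so removing it costs a
            factor c^2.\<close>
          have "c\<^sup>2 * (zero_ext V q x)\<^sup>2 \<le> (\<zeta> x)\<^sup>2 * (norm (D x))\<^sup>2" for x
          proof (cases "x \<in> V")
            case True
            then have "c \<le> \<zeta> x" using \<zeta>c closure_subset by blast
            then have "c\<^sup>2 \<le> (\<zeta> x)\<^sup>2" using c by (intro power_mono) auto
            moreover have "\<bar>q x\<bar> \<le> norm (D x)"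
              using component_le_norm_cart[of "D x" j] by (simp add: D_def q_def P_def)
            then have "(q x)\<^sup>2 \<le> (norm (D x))\<^sup>2" by (metis abs_ge_zero power2_abs power_mono)
            ultimately show ?thesis using True by (simp add: zero_ext_def mult_mono)
          qed (simp add: zero_ext_def)
          then have "(LINT x|lebesgue. c\<^sup>2 * (zero_ext V q x)\<^sup>2) \<le> (LINT x|lebesgue. (\<zeta> x)\<^sup>2 * (norm (D x))\<^sup>2)"
            by (intro integral_mono integrable_mult_right iq iX)
          then have "c\<^sup>2 * (norm2 lebesgue (zero_ext V q))\<^sup>2 \<le> K2 B * S"
            using X by (simp add: norm2_power2)
          then have "(c * norm2 lebesgue (zero_ext V q))\<^sup>2 \<le> K2 B * S" by (simp add: power_mult_distrib)
          then have "c * norm2 lebesgue (zero_ext V q) \<le> sqrt (K2 B) * sqrt S"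
            unfolding real_sqrt_mult[symmetric] by (rule real_le_rsqrt)
          also have "\<dots> \<le> sqrt (K2 B) * T" using ST K2_nonneg by (intro mult_left_mono) auto
          finally have "norm2 lebesgue (zero_ext V q) \<le> M" using c by (simp add: M_def field_simps)
          then show ?thesis by (simp add: q_def[abs_def])
        qed
        obtain w where w: "square_integrable lebesgue w" "\<And>x. x \<notin> V \<Longrightarrow> w x = 0" "norm2 lebesgue w \<le> M"
          "\<And>\<phi>. \<phi> \<in> test_functions V \<Longrightarrow>
            (LINT x|lebesgue. p j x * partial_deriv k \<phi> x) = - (LINT x|lebesgue. w x * \<phi> x)"
          by (rule weak_deriv_from_difference_quotients[OF VS sq_p[of j] M0 half_gt_zero[OF e(1)] bd]) (assumption, assumption, rule that)
        have wV: "zero_ext V w = w" using w(2) by (auto simp: fun_eq_iff zero_ext_def indicator_def)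
        have w_l2: "w \<in> l2_space V" using w(1) by (simp add: l2_space_iff[OF VS] wV)
        \<comment> \<open>\<open>partial_derivs [j, k]\<close> applies k first. So the equation for
          \<open>p j\<close> is tested with the k-th derivative of \<phi>, then the one for
          \<open>w\<close> with \<phi>, and the two signs cancel.\<close>
        have "has_weak_deriv V [j, k] u w"
          unfolding has_weak_deriv_l2_iff[OF VS u_V(1) w_l2]
        proof
          fix \<phi> assume \<phi>: "\<phi> \<in> test_functions V"
          have \<phi>k: "partial_deriv k \<phi> \<in> test_functions V" by (rule test_functions_partial_deriv[OF \<phi>])
          then have \<phi>kU: "partial_deriv k \<phi> \<in> test_functions U" using test_functions_mono[OF V_sub] by blast
          have "(LINT x|lebesgue. zero_ext V u x * partial_deriv j (partial_deriv k \<phi>) x)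
              = (LINT x|lebesgue. u0 x * partial_deriv j (partial_deriv k \<phi>) x)"
            by (simp add: u0_def zero_ext_mult_test[OF test_functions_partial_deriv[OF \<phi>k]]
                zero_ext_mult_test[OF test_functions_partial_deriv[OF \<phi>kU]])
          also have "\<dots> = - (LINT x|lebesgue. p j x * partial_deriv k \<phi> x)"
            using weak_partial_u0[of j] \<phi>kU by (simp add: weak_partial_def)
          also have "\<dots> = (LINT x|lebesgue. w x * \<phi> x)" using w(4)[OF \<phi>] by simp
          finally show "(LINT x|lebesgue. zero_ext V u x * partial_derivs [j, k] \<phi> x)
              = (- 1) ^ length [j, k] * (LINT x|lebesgue. zero_ext V w x * \<phi> x)"
            by (simp add: wV)
        qed
        moreover have "l2_norm V w \<le> C\<^sub>0 * T"
          by (rule T_le) (use w(3) in \<open>simp add: l2_norm_eq[OF VS] wV M_def\<close>)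
        ultimately show ?thesis using 3 w_l2 by blast
      qed
    qed
    moreover have "C\<^sub>0 * T \<ge> 0" using T_le[of T] T1 by simp
    ultimately show ?thesis
      using sobolev_norm_bound[OF V _ u_V(1), of "C\<^sub>0 * T" 2] by (simp add: C_def T_def mult.assoc)
  qed
  have "C \<ge> 0" using nn by (simp add: C_def C\<^sub>0_def)
  then show ?thesis using main by blast
qed

theorem theorem5p2:
  fixes U :: "(real^'n) set"
    and a :: "real^'n \<Rightarrow> real^'n \<Rightarrow> real^'n"
  assumes "open U" and "bounded U" and "lipschitz_boundary U"
    and "\<exists>C\<^sub>L\<ge>0. \<forall>x p q. norm (a x p - a x q) \<le> C\<^sub>L * norm (p - q)"
    and "\<exists>C\<^sub>M>0. \<forall>x p q. (a x p - a x q) \<bullet> (p - q) \<ge> C\<^sub>M * (norm (p - q))\<^sup>2"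
    and "\<exists>C\<^sub>Q\<ge>0. \<forall>x y p. norm (a x p - a y p) \<le> C\<^sub>Q * (norm p + 1) * norm (x - y)"
  shows "(\<forall>f u. f \<in> l2_space U \<and> weak_neumann_solution a U f u \<longrightarrow> u \<in> sobolev_loc 2 U) \<and>
    (\<forall>V. open V \<and> compactly_contained V U \<longrightarrow>
      (\<exists>C\<ge>0. \<forall>f u. f \<in> l2_space U \<and> weak_neumann_solution a U f u \<longrightarrow>
         sobolev_norm 2 V u \<le> C * (l2_norm U f + l2_norm U u + 1)))"
proof -
  obtain C\<^sub>L where L: "C\<^sub>L \<ge> 0" "\<And>x p q. norm (a x p - a x q) \<le> C\<^sub>L * norm (p - q)" using assms(4) by blast
  obtain C\<^sub>M where M: "C\<^sub>M > 0" "\<And>x p q. (a x p - a x q) \<bullet> (p - q) \<ge> C\<^sub>M * (norm (p - q))\<^sup>2" using assms(5) by blast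
  obtain C\<^sub>Q where Q: "C\<^sub>Q \<ge> 0" "\<And>x y p. norm (a x p - a y p) \<le> C\<^sub>Q * (norm p + 1) * norm (x - y)" using assms(6) by blast
  obtain R where R: "\<And>x. x \<in> U \<Longrightarrow> norm x \<le> R" using assms(2) unfolding bounded_iff by blast
  interpret neumann_problem U a C\<^sub>L C\<^sub>M C\<^sub>Q R
    by unfold_locales (fact assms(1) L M Q R)+
  show ?thesis
  proof (intro conjI allI impI)
    fix f u assume fu: "f \<in> l2_space U \<and> weak_neumann_solution a U f u"
    show "u \<in> sobolev_loc 2 U"
      unfolding sobolev_loc_def
    proof (intro CollectI allI impI)
      fix V assume "open V \<and> compactly_contained V U"
      then show "u \<in> sobolev 2 V" using interior_regularity[of V] fu by blast
    qed
  next
    fix V assume "open V \<and> compactly_contained V U"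
    then show "\<exists>C\<ge>0. \<forall>f u. f \<in> l2_space U \<and> weak_neumann_solution a U f u \<longrightarrow>
         sobolev_norm 2 V u \<le> C * (l2_norm U f + l2_norm U u + 1)"
      using interior_regularity[of V] by blast
  qed
qed

end
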